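(* Let $X$ be a connected normal Noetherian scheme with function field $K$. Let $D_1,\ldots,D_r$ be Weil divisors on $X$, let $t_1,\ldots,t_r$ be variables over $K$, and set $$R=\bigoplus_{n_1,\ldots,n_r\in\mathbb{Z}} H^0\Bigl(X,\mathcal{O}_X\Bigl(\sum_i n_iD_i\Bigr)\Bigr)t_1^{n_1}\cdots t_r^{n_r}\ \subset\ K[t_1^{\pm1},\ldots,t_r^{\pm1}].$$ If the images of $D_1,\ldots,D_r$ in the divisor class group $\mathrm{Cl}(X)$ generate $\mathrm{Cl}(X)$, then $R$ is a unique factorization domain. In particular, if $X$ is a connected normal Noetherian scheme whose divisor class group $\mathrm{Cl}(X)$ is a finitely generated free abelian group, then the total coordinate ring $\mathrm{TC}(X)$ is a unique factorization domain.
   Context: For a Weil divisor $D$ on $X$, $H^0(X,\mathcal{O}_X(D))=\{a\in K^\times\mid \mathrm{div}_X(a)+D\ge 0\}\cup\{0\}$, regarded as an additive subgroup of $K$; with this convention $R$ is a subring of $K[t_1^{\pm1},\ldots,t_r^{\pm1}]$. $\mathrm{Cl}(X)$ is the group of Weil divisors modulo principal divisors. Total coordinate ring: suppose $\mathrm{Cl}(X)\cong\mathbb{Z}^{\oplus s}$. Choose Weil divisors $D_1,\ldots,D_s$ on $X$ whose images generate $\mathrm{Cl}(X)$, and variables $t_1,\ldots,t_s$ over $K$. Then $$\mathrm{TC}(X)=\bigoplus_{n_1,\ldots,n_s\in\mathbb{Z}}H^0\Bigl(X,\mathcal{O}_X\Bigl(\sum_i n_iD_i\Bigr)\Bigr)t_1^{n_1}\cdots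 t_s^{n_s}\subset K[t_1^{\pm1},\ldots,t_s^{\pm1}],$$ which is independent of the choice of $D_1,\ldots,D_s$ up to isomorphism. *)

theory Defs
  imports
    "HOL-Algebra.Ring_Divisibility"
    "HOL-Algebra.Free_Abelian_Groups"
    "HOL-Analysis.Abstract_Topology"
    "HOL-Library.Extended_Nat"
begin

section \<open>Commutative algebra\<close>

definition loc_frac :: "('b, 'm) ring_scheme \<Rightarrow> 'b set \<Rightarrow> 'b \<Rightarrow> 'b \<Rightarrow> ('b \<times> 'b) set" where
  "loc_frac A S a s =
     {(b, t). b \<in> carrier A \<and> t \<in> S \<and>
        (\<exists>u\<in>S. u \<otimes>\<^bsub>A\<^esub> (a \<otimes>\<^bsub>A\<^esub> t \<ominus>\<^bsub>A\<^esub> b \<otimes>\<^bsub>A\<^esub> s) = \<zero>\<^bsub>A\<^esub>)}"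

text \<open>In the operations below, and in those on stalks, the union over all representatives is a
  union of equal sets, since the operation does not depend on the representatives.\<close>

definition localization :: "('b, 'm) ring_scheme \<Rightarrow> 'b set \<Rightarrow> ('b \<times> 'b) set ring" where
  "localization A S =
     \<lparr>carrier = {loc_frac A S a s |a s. a \<in> carrier A \<and> s \<in> S},
      monoid.mult = (\<lambda>P Q. \<Union>(a, s)\<in>P. \<Union>(b, t)\<in>Q. loc_frac A S (a \<otimes>\<^bsub>A\<^esub> b) (s \<otimes>\<^bsub>A\<^esub> t)),
      monoid.one = loc_frac A S \<one>\<^bsub>A\<^esub> \<one>\<^bsub>A\<^esub>,
      ring.zero = loc_frac A S \<zero>\<^bsub>A\<^esub> \<one>\<^bsub>A\<^esub>,
      ring.add = (\<lambda>P Q. \<Union>(a, s)\<in>P. \<Union>(b, t)\<in>Q.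
               loc_frac A S (a \<otimes>\<^bsub>A\<^esub> t \<oplus>\<^bsub>A\<^esub> b \<otimes>\<^bsub>A\<^esub> s) (s \<otimes>\<^bsub>A\<^esub> t))\<rparr>"

definition fraction_field :: "('b, 'm) ring_scheme \<Rightarrow> ('b \<times> 'b) set ring" where
  "fraction_field A = localization A (carrier A - {\<zero>\<^bsub>A\<^esub>})"

definition to_fraction_field :: "('b, 'm) ring_scheme \<Rightarrow> 'b \<Rightarrow> ('b \<times> 'b) set" where
  "to_fraction_field A a = loc_frac A (carrier A - {\<zero>\<^bsub>A\<^esub>}) a \<one>\<^bsub>A\<^esub>"

text \<open>Integrality of \<open>x\<close> over \<open>A\<close>, where \<open>B\<close> is an \<open>A\<close>-algebra via \<open>h\<close>.\<close>

definition integral_over ::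
    "('b, 'm) ring_scheme \<Rightarrow> ('b \<Rightarrow> 'c) \<Rightarrow> ('c, 'n) ring_scheme \<Rightarrow> 'c \<Rightarrow> bool" where
  "integral_over A h B x \<longleftrightarrow>
     (\<exists>(n::nat) c. (\<forall>i<n. c i \<in> carrier A) \<and>
        x [^]\<^bsub>B\<^esub> n \<oplus>\<^bsub>B\<^esub> (\<Oplus>\<^bsub>B\<^esub>i\<in>{..<n}. h (c i) \<otimes>\<^bsub>B\<^esub> x [^]\<^bsub>B\<^esub> i) = \<zero>\<^bsub>B\<^esub>)"

definition integrally_closed_domain :: "('b, 'm) ring_scheme \<Rightarrow> bool" where
  "integrally_closed_domain A \<longleftrightarrow>
     domain A \<and>
     (\<forall>x\<in>carrier (fraction_field A).
        integral_over A (to_fraction_field A) (fraction_field A) x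
          \<longrightarrow> x \<in> to_fraction_field A ` carrier A)"

definition local_ring :: "('b, 'm) ring_scheme \<Rightarrow> bool" where
  "local_ring A \<longleftrightarrow> cring A \<and> (\<exists>!M. maximalideal M A)"

definition the_maximal_ideal :: "('b, 'm) ring_scheme \<Rightarrow> 'b set" where
  "the_maximal_ideal A = (THE M. maximalideal M A)"


section \<open>Ringed spaces\<close>

record ('a, 'b) ringed_space =
  pts :: "'a topology"
  sections :: "'a set \<Rightarrow> 'b ring"
  restr :: "'a set \<Rightarrow> 'a set \<Rightarrow> 'b \<Rightarrow> 'b"

text \<open>\<open>restr \<XX> U V\<close> is the restriction from \<open>U\<close> to \<open>V\<close>; only its values for open
  \<open>V \<subseteq> U\<close> are meaningful.\<close>

locale sheaf_of_rings =
  fixes \<XX> :: "('a, 'b) ringed_space"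
  assumes sections_cring: "openin (pts \<XX>) U \<Longrightarrow> cring (sections \<XX> U)"
    and restr_hom: "\<lbrakk>openin (pts \<XX>) U; openin (pts \<XX>) V; V \<subseteq> U\<rbrakk>
          \<Longrightarrow> restr \<XX> U V \<in> ring_hom (sections \<XX> U) (sections \<XX> V)"
    and restr_id: "\<lbrakk>openin (pts \<XX>) U; s \<in> carrier (sections \<XX> U)\<rbrakk> \<Longrightarrow> restr \<XX> U U s = s"
    and restr_trans: "\<lbrakk>openin (pts \<XX>) U; openin (pts \<XX>) V; openin (pts \<XX>) W; W \<subseteq> V; V \<subseteq> U;
            s \<in> carrier (sections \<XX> U)\<rbrakk>
          \<Longrightarrow> restr \<XX> V W (restr \<XX> U V s) = restr \<XX> U W s"
    and locality: "\<lbrakk>\<And>V. V \<in> \<V> \<Longrightarrow> openin (pts \<XX>) V;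
            s \<in> carrier (sections \<XX> (\<Union>\<V>)); t \<in> carrier (sections \<XX> (\<Union>\<V>));
            \<And>V. V \<in> \<V> \<Longrightarrow> restr \<XX> (\<Union>\<V>) V s = restr \<XX> (\<Union>\<V>) V t\<rbrakk> \<Longrightarrow> s = t"
    and gluing: "\<lbrakk>\<And>V. V \<in> \<V> \<Longrightarrow> openin (pts \<XX>) V;
            \<And>V. V \<in> \<V> \<Longrightarrow> \<sigma> V \<in> carrier (sections \<XX> V);
            \<And>V W. \<lbrakk>V \<in> \<V>; W \<in> \<V>\<rbrakk>
              \<Longrightarrow> restr \<XX> V (V \<inter> W) (\<sigma> V) = restr \<XX> W (V \<inter> W) (\<sigma> W)\<rbrakk>
          \<Longrightarrow> \<exists>s\<in>carrier (sections \<XX> (\<Union>\<V>)). \<forall>V\<in>\<V>. restr \<XX> (\<Union>\<V>) V s = \<sigma> V"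

definition germ :: "('a, 'b) ringed_space \<Rightarrow> 'a \<Rightarrow> 'a set \<Rightarrow> 'b \<Rightarrow> ('a set \<times> 'b) set" where
  "germ \<XX> x U s =
     {(V, t). openin (pts \<XX>) V \<and> x \<in> V \<and> t \<in> carrier (sections \<XX> V) \<and>
        (\<exists>W. openin (pts \<XX>) W \<and> x \<in> W \<and> W \<subseteq> U \<inter> V \<and> restr \<XX> U W s = restr \<XX> V W t)}"

definition stalk :: "('a, 'b) ringed_space \<Rightarrow> 'a \<Rightarrow> ('a set \<times> 'b) set ring" where
  "stalk \<XX> x =
     \<lparr>carrier = {germ \<XX> x U s |U s. openin (pts \<XX>) U \<and> x \<in> U \<and> s \<in> carrier (sections \<XX> U)},
      monoid.mult = (\<lambda>P Q. \<Union>(U, s)\<in>P. \<Union>(V, t)\<in>Q.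
         germ \<XX> x (U \<inter> V) (restr \<XX> U (U \<inter> V) s \<otimes>\<^bsub>sections \<XX> (U \<inter> V)\<^esub> restr \<XX> V (U \<inter> V) t)),
      monoid.one = germ \<XX> x (topspace (pts \<XX>)) \<one>\<^bsub>sections \<XX> (topspace (pts \<XX>))\<^esub>,
      ring.zero = germ \<XX> x (topspace (pts \<XX>)) \<zero>\<^bsub>sections \<XX> (topspace (pts \<XX>))\<^esub>,
      ring.add = (\<lambda>P Q. \<Union>(U, s)\<in>P. \<Union>(V, t)\<in>Q.
         germ \<XX> x (U \<inter> V) (restr \<XX> U (U \<inter> V) s \<oplus>\<^bsub>sections \<XX> (U \<inter> V)\<^esub> restr \<XX> V (U \<inter> V) t))\<rparr>"

text \<open>The map of stalks \<open>\<O>\<^sub>x \<rightarrow> \<O>\<^sub>y\<close>, \<open>(U, s) \<mapsto> (U, s)\<close>, for \<open>x\<close> in the closure of \<open>y\<close>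
  (every open neighbourhood of \<open>x\<close> then contains \<open>y\<close>).\<close>

definition cospecialize ::
    "('a, 'b) ringed_space \<Rightarrow> 'a \<Rightarrow> ('a set \<times> 'b) set \<Rightarrow> ('a set \<times> 'b) set" where
  "cospecialize \<XX> y P = (\<Union>(U, s)\<in>P. germ \<XX> y U s)"

locale locally_ringed_space = sheaf_of_rings +
  assumes stalk_local: "x \<in> topspace (pts \<XX>) \<Longrightarrow> local_ring (stalk \<XX> x)"

definition open_subspace :: "('a, 'b) ringed_space \<Rightarrow> 'a set \<Rightarrow> ('a, 'b) ringed_space" where
  "open_subspace \<XX> U = \<XX>\<lparr>pts := subtopology (pts \<XX>) U\<rparr>"

text \<open>Between locally ringed spaces, an isomorphism of ringed spaces is automatically an isomorphism of
  locally ringed spaces, as isomorphisms of stalks are local.\<close>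

definition isomorphic_ringed_spaces ::
    "('a, 'b) ringed_space \<Rightarrow> ('c, 'd) ringed_space \<Rightarrow> bool" where
  "isomorphic_ringed_spaces \<XX> Y \<longleftrightarrow>
     (\<exists>f \<phi>. homeomorphic_map (pts \<XX>) (pts Y) f \<and>
        (\<forall>V. openin (pts Y) V \<longrightarrow>
           \<phi> V \<in> ring_iso (sections Y V) (sections \<XX> {x \<in> topspace (pts \<XX>). f x \<in> V})) \<and>
        (\<forall>V W. openin (pts Y) V \<and> openin (pts Y) W \<and> W \<subseteq> V \<longrightarrow>
           (\<forall>s\<in>carrier (sections Y V).
              \<phi> W (restr Y V W s) =
              restr \<XX> {x \<in> topspace (pts \<XX>). f x \<in> V} {x \<in> topspace (pts \<XX>). f x \<in> W} (\<phi> V s))))"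


section \<open>Schemes\<close>

definition zariski :: "('b, 'm) ring_scheme \<Rightarrow> 'b set topology" where
  "zariski A = topology (\<lambda>U. \<exists>I. ideal I A \<and> U = {p. primeideal p A \<and> \<not> I \<subseteq> p})"

definition local_at :: "('b, 'm) ring_scheme \<Rightarrow> 'b set \<Rightarrow> ('b \<times> 'b) set ring" where
  "local_at A p = localization A (carrier A - p)"

text \<open>Sections of the structure sheaf over \<open>U\<close> are the functions \<open>s\<close> on \<open>U\<close> with
  \<open>s(p) \<in> A\<^sub>p\<close> that are locally given by a fraction \<open>a/f\<close>.\<close>

definition Spec_sections ::
    "('b, 'm) ring_scheme \<Rightarrow> 'b set set \<Rightarrow> ('b set \<Rightarrow> ('b \<times> 'b) set) ring" where
  "Spec_sections A U =
     \<lparr>carrier = {s \<in> (\<Pi>\<^sub>E p\<in>U. carrier (local_at A p)).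
         \<forall>p\<in>U. \<exists>V. openin (zariski A) V \<and> p \<in> V \<and> V \<subseteq> U \<and>
           (\<exists>a\<in>carrier A. \<exists>f\<in>carrier A. \<forall>q\<in>V. f \<notin> q \<and> s q = loc_frac A (carrier A - q) a f)},
      monoid.mult = (\<lambda>s t. \<lambda>p\<in>U. s p \<otimes>\<^bsub>local_at A p\<^esub> t p),
      monoid.one = (\<lambda>p\<in>U. \<one>\<^bsub>local_at A p\<^esub>),
      ring.zero = (\<lambda>p\<in>U. \<zero>\<^bsub>local_at A p\<^esub>),
      ring.add = (\<lambda>s t. \<lambda>p\<in>U. s p \<oplus>\<^bsub>local_at A p\<^esub> t p)\<rparr>"

definition Spec ::
    "('b, 'm) ring_scheme \<Rightarrow> ('b set, 'b set \<Rightarrow> ('b \<times> 'b) set) ringed_space" where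
  "Spec A = \<lparr>pts = zariski A, sections = Spec_sections A, restr = (\<lambda>U V s. restrict s V)\<rparr>"

text \<open>Taking \<open>A\<close> over the type of the sections of \<open>\<XX>\<close> is no restriction, since \<open>A\<close> is
  isomorphic to the ring of sections over \<open>U\<close>.\<close>

definition affine_open :: "('a, 'b) ringed_space \<Rightarrow> 'a set \<Rightarrow> 'b ring \<Rightarrow> bool" where
  "affine_open \<XX> U A \<longleftrightarrow>
     openin (pts \<XX>) U \<and> cring A \<and> isomorphic_ringed_spaces (open_subspace \<XX> U) (Spec A)"

locale Scheme = locally_ringed_space +
  assumes locally_affine: "x \<in> topspace (pts \<XX>) \<Longrightarrow> \<exists>U A. x \<in> U \<and> affine_open \<XX> U A"

locale Noetherian_Scheme = Scheme +
  assumes locally_noetherian: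
      "x \<in> topspace (pts \<XX>) \<Longrightarrow> \<exists>U A. x \<in> U \<and> affine_open \<XX> U A \<and> noetherian_ring A"
    and quasi_compact: "compact_space (pts \<XX>)"

locale Normal_Scheme = Scheme +
  assumes stalk_normal: "x \<in> topspace (pts \<XX>) \<Longrightarrow> integrally_closed_domain (stalk \<XX> x)"

text \<open>Connected spaces are nonempty here, whereas \<^const>\<open>connected_space\<close> admits the empty one.\<close>

locale Connected_Normal_Noetherian_Scheme = Noetherian_Scheme + Normal_Scheme +
  assumes connected: "connected_space (pts \<XX>)" "topspace (pts \<XX>) \<noteq> {}"


section \<open>Weil divisors\<close>

definition irreducible_subset :: "'a topology \<Rightarrow> 'a set \<Rightarrow> bool" where
  "irreducible_subset T Z \<longleftrightarrow>
     Z \<subseteq> topspace T \<and> Z \<noteq> {} \<and>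
     (\<forall>F G. closedin T F \<and> closedin T G \<and> Z \<subseteq> F \<union> G \<longrightarrow> Z \<subseteq> F \<or> Z \<subseteq> G)"

definition codim :: "'a topology \<Rightarrow> 'a set \<Rightarrow> enat" where
  "codim T Z =
     Sup {enat n |n. \<exists>c. c 0 = Z \<and> (\<forall>i\<le>n. closedin T (c i) \<and> irreducible_subset T (c i)) \<and>
                         (\<forall>i<n. c i \<subset> c (Suc i))}"

definition generic_point :: "'a topology \<Rightarrow> 'a set \<Rightarrow> 'a" where
  "generic_point T Z = (THE x. x \<in> topspace T \<and> T closure_of {x} = Z)"

definition function_field :: "('a, 'b) ringed_space \<Rightarrow> ('a set \<times> 'b) set ring" where
  "function_field \<XX> = stalk \<XX> (generic_point (pts \<XX>) (topspace (pts \<XX>)))"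

text \<open>An integral closed subscheme is determined by its underlying irreducible closed set.\<close>

definition prime_divisor :: "('a, 'b) ringed_space \<Rightarrow> 'a set \<Rightarrow> bool" where
  "prime_divisor \<XX> Z \<longleftrightarrow>
     closedin (pts \<XX>) Z \<and> irreducible_subset (pts \<XX>) Z \<and> codim (pts \<XX>) Z = 1"

text \<open>The valuation on the function field defined by the discrete valuation ring \<open>\<O>\<^sub>Z\<close> at the
  generic point of \<open>Z\<close>: \<open>a = u \<pi>\<^sup>n\<close> has valuation \<open>n\<close>, for a unit \<open>u\<close> and a uniformizer \<open>\<pi>\<close>.\<close>

definition ord_along :: "('a, 'b) ringed_space \<Rightarrow> 'a set \<Rightarrow> ('a set \<times> 'b) set \<Rightarrow> int" where
  "ord_along \<XX> Z a =
     (let \<O>Z = stalk \<XX> (generic_point (pts \<XX>) Z);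
          \<iota> = cospecialize \<XX> (generic_point (pts \<XX>) (topspace (pts \<XX>)))
      in THE n. \<exists>\<pi>\<in>carrier \<O>Z. \<exists>u\<in>Units \<O>Z.
           PIdl\<^bsub>\<O>Z\<^esub> \<pi> = the_maximal_ideal \<O>Z \<and>
           a = \<iota> u \<otimes>\<^bsub>function_field \<XX>\<^esub> (\<iota> \<pi> [^]\<^bsub>function_field \<XX>\<^esub> (n::int)))"

definition Weil_divisors :: "('a, 'b) ringed_space \<Rightarrow> ('a set \<Rightarrow>\<^sub>0 int) monoid" where
  "Weil_divisors \<XX> = free_Abelian_group {Z. prime_divisor \<XX> Z}"

definition div_of :: "('a, 'b) ringed_space \<Rightarrow> ('a set \<times> 'b) set \<Rightarrow> ('a set \<Rightarrow>\<^sub>0 int)" where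
  "div_of \<XX> a = Abs_poly_mapping (\<lambda>Z. if prime_divisor \<XX> Z then ord_along \<XX> Z a else 0)"

definition principal_divisors :: "('a, 'b) ringed_space \<Rightarrow> ('a set \<Rightarrow>\<^sub>0 int) set" where
  "principal_divisors \<XX> = div_of \<XX> ` (carrier (function_field \<XX>) - {\<zero>\<^bsub>function_field \<XX>\<^esub>})"

definition class_group :: "('a, 'b) ringed_space \<Rightarrow> ('a set \<Rightarrow>\<^sub>0 int) set monoid" where
  "class_group \<XX> = Weil_divisors \<XX> Mod principal_divisors \<XX>"

definition divisor_class ::
    "('a, 'b) ringed_space \<Rightarrow> ('a set \<Rightarrow>\<^sub>0 int) \<Rightarrow> ('a set \<Rightarrow>\<^sub>0 int) set" where
  "divisor_class \<XX> D = principal_divisors \<XX> #>\<^bsub>Weil_divisors \<XX>\<^esub> D"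

definition classes_generate ::
    "('a, 'b) ringed_space \<Rightarrow> nat \<Rightarrow> (nat \<Rightarrow> ('a set \<Rightarrow>\<^sub>0 int)) \<Rightarrow> bool" where
  "classes_generate \<XX> r D \<longleftrightarrow>
     generate (class_group \<XX>) ((\<lambda>i. divisor_class \<XX> (D i)) ` {1..r}) = carrier (class_group \<XX>)"

definition H0 :: "('a, 'b) ringed_space \<Rightarrow> ('a set \<Rightarrow>\<^sub>0 int) \<Rightarrow> ('a set \<times> 'b) set set" where
  "H0 \<XX> D =
     {a \<in> carrier (function_field \<XX>) - {\<zero>\<^bsub>function_field \<XX>\<^esub>}.
        \<forall>Z. 0 \<le> Poly_Mapping.lookup (div_of \<XX> a + D) Z} \<union> {\<zero>\<^bsub>function_field \<XX>\<^esub>}"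


section \<open>Multisection rings\<close>

text \<open>The ring of Laurent polynomials in \<open>t\<^sub>1, \<dots>, t\<^sub>r\<close> over \<open>K\<close>. The exponent vector
  \<open>(n\<^sub>1, \<dots>, n\<^sub>r)\<close> is the finitely supported function \<open>n\<close> with support in \<open>{1..r}\<close>, and
  \<open>f n\<close> is the coefficient of \<open>t\<^sub>1\<^bsup>n\<^sub>1\<^esup> \<cdots> t\<^sub>r\<^bsup>n\<^sub>r\<^esup>\<close> in \<open>f\<close>.\<close>

definition laurent_ring :: "('k, 'm) ring_scheme \<Rightarrow> nat \<Rightarrow> ((nat \<Rightarrow>\<^sub>0 int) \<Rightarrow> 'k) ring" where
  "laurent_ring K r =
     \<lparr>carrier = {f. (\<forall>n. f n \<in> carrier K) \<and> finite {n. f n \<noteq> \<zero>\<^bsub>K\<^esub>} \<and>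
                    (\<forall>n. f n \<noteq> \<zero>\<^bsub>K\<^esub> \<longrightarrow> Poly_Mapping.keys n \<subseteq> {1..r})},
      monoid.mult = (\<lambda>f g n. \<Oplus>\<^bsub>K\<^esub>m\<in>{m. f m \<noteq> \<zero>\<^bsub>K\<^esub>}. f m \<otimes>\<^bsub>K\<^esub> g (n - m)),
      monoid.one = (\<lambda>n. if n = 0 then \<one>\<^bsub>K\<^esub> else \<zero>\<^bsub>K\<^esub>),
      ring.zero = (\<lambda>n. \<zero>\<^bsub>K\<^esub>),
      ring.add = (\<lambda>f g n. f n \<oplus>\<^bsub>K\<^esub> g n)\<rparr>"

definition multisection_ring ::
    "('a, 'b) ringed_space \<Rightarrow> nat \<Rightarrow> (nat \<Rightarrow> ('a set \<Rightarrow>\<^sub>0 int))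
       \<Rightarrow> ((nat \<Rightarrow>\<^sub>0 int) \<Rightarrow> ('a set \<times> 'b) set) ring" where
  "multisection_ring \<XX> r D = (laurent_ring (function_field \<XX>) r)
     \<lparr>carrier := {f \<in> carrier (laurent_ring (function_field \<XX>) r).
        \<forall>n. Poly_Mapping.keys n \<subseteq> {1..r} \<longrightarrow>
          f n \<in> H0 \<XX> (\<Sum>i=1..r. frag_cmul (Poly_Mapping.lookup n i) (D i))}\<rparr>"

text \<open>The total coordinate ring depends, up to isomorphism only, on the choice of the divisors
  \<open>D\<^sub>1, \<dots>, D\<^sub>s\<close>; so being a total coordinate ring is a predicate.\<close>

definition is_total_coordinate_ring ::
    "('a, 'b) ringed_space \<Rightarrow> ((nat \<Rightarrow>\<^sub>0 int) \<Rightarrow> ('a set \<times> 'b) set) ring \<Rightarrow> bool" where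
  "is_total_coordinate_ring \<XX> T \<longleftrightarrow>
     (\<exists>s D. class_group \<XX> \<cong> free_Abelian_group {1..s} \<and>
        (\<forall>i\<in>{1..s}. D i \<in> carrier (Weil_divisors \<XX>)) \<and>
        classes_generate \<XX> s D \<and>
        T = multisection_ring \<XX> s D)"

end

theory Submission
  imports Defs "HOL-Algebra.Subrings"
begin

text \<open>The algebraic half asks of the scheme only this: a field K, integer valuations on it
  indexed by prime divisors, finitely many nonzero values for each nonzero a in K, and the
  realisation of every divisor. The geometric half supplies exactly these. K is a field with one
  generic point for all of X because every stalk is a domain, so each point has a neighbourhood with
  its own generic point, and connectedness makes these agree. The order along Z is a valuation
  because the stalk at the generic point of Z is a Noetherian normal local domain with exactly two
  primes. Finiteness holds because, on a chart, the divisors of zeros and poles of a/s come from the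
  finite set of minimal primes over as, and finitely many charts suffice.

  No chain condition on R is available, so factorisations cannot be obtained by splitting until
  nothing splits. Their length is controlled explicitly: write f = u g with u a unit of L and g of
  value zero everywhere. The number of primes in R is then the number of primes of g in L plus the
  degree of u, the sum of its values over all Z. The same counting device replaces greatest common
  divisors in Gauss's lemma.\<close>

text \<open>Let \<open>L = K[t\<^sub>1\<^sup>\<plusminus>\<^sup>1, \<dots>, t\<^sub>r\<^sup>\<plusminus>\<^sup>1]\<close>, which is factorial by Gauss's lemma. The valuation \<open>v\<^sub>Z\<close> of a prime divisor
  \<open>Z\<close> extends to \<open>L\<close> by \<open>w\<^sub>Z(f) = min\<^sub>n (v\<^sub>Z(f\<^sub>n) + (\<Sum>n\<^sub>iD\<^sub>i)(Z))\<close>, and \<open>R\<close> consists of the \<open>f\<close> with \<open>w\<^sub>Z(f) \<ge> 0\<close> for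
  all \<open>Z\<close>. Since the \<open>D\<^sub>i\<close> generate the class group, every divisor is \<open>(w\<^sub>Z(u))\<^sub>Z\<close> for some monomial
  \<open>u = a t\<^sup>n\<close>, a unit of \<open>L\<close>. Hence the monomial with divisor \<open>1\<cdot>Z\<close> is a prime element of \<open>R\<close>, and each prime
  element of \<open>L\<close>, divided by a monomial with the same divisor, is a prime element of \<open>R\<close>; these primes and the
  units generate \<open>R \<setminus> {0}\<close>.\<close>

section \<open>Products of primes\<close>

text \<open>The index counts primes with multiplicity and serves as an induction measure: cancelling
  one prime lowers it by exactly one. The unit sits in the base case, so associates cause no case
  distinctions later.\<close>

inductive prime_product :: "('a, 'm) ring_scheme \<Rightarrow> nat \<Rightarrow> 'a \<Rightarrow> bool" for R where
  unit: "u \<in> Units R \<Longrightarrow> prime_product R 0 u"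
| mult: "\<lbrakk>p \<in> carrier R; ring_prime\<^bsub>R\<^esub> p; prime_product R n a\<rbrakk> \<Longrightarrow> prime_product R (Suc n) (p \<otimes>\<^bsub>R\<^esub> a)"

context domain
begin

lemma Units_of_inverse: "\<lbrakk>a \<in> carrier R; b \<in> carrier R; a \<otimes> b = \<one>\<rbrakk> \<Longrightarrow> a \<in> Units R"
  by (metis Units_one_closed dividesI divides_one)

lemma Units_mult_inv: "\<lbrakk>u \<in> Units R; a \<in> carrier R\<rbrakk> \<Longrightarrow> u \<otimes> (inv u \<otimes> a) = a"
  by (metis Units_closed Units_inv_closed Units_r_inv l_one m_assoc)

lemma ring_primeD:
  assumes "ring_prime p"
  shows "p \<noteq> \<zero>" "p \<notin> Units R"
    "\<And>a b. \<lbrakk>a \<in> carrier R; b \<in> carrier R; p divides a \<otimes> b\<rbrakk> \<Longrightarrow> p divides a \<or> p divides b"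
  using assms unfolding ring_prime_def prime_def by auto

lemma prime_product_closed: "prime_product R n a \<Longrightarrow> a \<in> carrier R"
  by (induction rule: prime_product.induct) auto

lemma prime_product_nonzero: "prime_product R n a \<Longrightarrow> a \<noteq> \<zero>"
proof (induction rule: prime_product.induct)
  case (unit u)
  then show ?case using Units_r_inv_ex zero_not_one by force
next
  case (mult p n a)
  then show ?case using ring_primeD(1) integral prime_product_closed by blast
qed

lemma prime_product_unit_mult:
  assumes "prime_product R n a" "u \<in> Units R"
  shows "prime_product R n (u \<otimes> a)"
  using assms
proof (induction rule: prime_product.induct)
  case (unit v)
  then show ?case by (auto intro: prime_product.unit)
next
  case (mult p n a)
  have "u \<otimes> (p \<otimes> a) = p \<otimes> (u \<otimes> a)"
    using mult prime_product_closed Units_closed m_lcomm by metis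
  then show ?case using mult by (auto intro: prime_product.mult)
qed

lemma prime_product_mult:
  assumes "prime_product R n a" "prime_product R m b"
  shows "prime_product R (n + m) (a \<otimes> b)"
  using assms
proof (induction rule: prime_product.induct)
  case (unit v)
  then show ?case by (auto intro: prime_product_unit_mult)
next
  case (mult p n a)
  have "(p \<otimes> a) \<otimes> b = p \<otimes> (a \<otimes> b)"
    using mult prime_product_closed m_assoc by metis
  then show ?case using mult by (auto intro: prime_product.mult)
qed

lemma prime_divides_prime:
  assumes pq: "p \<in> carrier R" "q \<in> carrier R" "ring_prime p" "ring_prime q" and "p divides q"
  shows "\<exists>w\<in>Units R. q = p \<otimes> w"
proof -
  obtain w where w: "w \<in> carrier R" "q = p \<otimes> w" using \<open>p divides q\<close> by (auto elim: dividesE)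
  have "q divides p \<otimes> w" using w pq(2) by auto
  then consider "q divides p" | "q divides w" using ring_primeD(3)[OF pq(4) pq(1) w(1)] by blast
  then show ?thesis
  proof cases
    case 1
    then obtain v where v: "v \<in> carrier R" "p = q \<otimes> v" by (auto elim: dividesE)
    have "p \<otimes> \<one> = p \<otimes> (w \<otimes> v)" using v w pq m_assoc by auto
    then have "w \<otimes> v = \<one>" using pq ring_primeD(1)[OF pq(3)] v w m_lcancel by (metis m_closed one_closed)
    then have "w \<in> Units R" using w(1) v(1) Units_of_inverse by blast
    then show ?thesis using w by blast
  next
    case 2
    then obtain v where v: "v \<in> carrier R" "w = q \<otimes> v" by (auto elim: dividesE)
    have "q \<otimes> \<one> = q \<otimes> (p \<otimes> v)" using v w pq m_assoc m_comm by (metis m_closed r_one)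
    then have "p \<otimes> v = \<one>" using pq ring_primeD(1)[OF pq(4)] v w m_lcancel by (metis m_closed one_closed)
    then have "p \<in> Units R" using pq v Units_of_inverse by blast
    then show ?thesis using ring_primeD(2)[OF pq(3)] by blast
  qed
qed

text \<open>Either \<open>p\<close> divides the leading prime \<open>q\<close>, so the two differ by
  a unit that is absorbed into the rest, or \<open>p\<close> divides the remaining product and the
  induction hypothesis applies there.\<close>

lemma prime_product_cancel:
  assumes "prime_product R n c" "p \<in> carrier R" "ring_prime p" "b \<in> carrier R" "c = p \<otimes> b"
  shows "\<exists>m. n = Suc m \<and> prime_product R m b"
  using assms
proof (induction arbitrary: b rule: prime_product.induct)
  case (unit u)
  then have "p \<in> Units R" by (metis divides_unit dividesI)
  then show ?case using unit ring_primeD(2) by blast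
next
  case (mult q n c')
  have c': "c' \<in> carrier R" using mult.hyps(3) by (rule prime_product_closed)
  have "p divides q \<otimes> c'" using mult.prems by (metis dividesI)
  then consider "p divides q" | "p divides c'" using ring_primeD(3)[OF mult.prems(2) mult.hyps(1) c'] by blast
  then show ?case
  proof cases
    case 1
    then obtain w where w: "w \<in> Units R" "q = p \<otimes> w" using prime_divides_prime[OF mult.prems(1) mult.hyps(1) mult.prems(2) mult.hyps(2)] by blast
    have "p \<otimes> b = p \<otimes> (w \<otimes> c')" using w mult.prems mult.hyps c' m_assoc by (metis Units_closed)
    then have "b = w \<otimes> c'"
      using w mult.prems mult.hyps c' ring_primeD(1)[OF \<open>ring_prime p\<close>] m_lcancel by (metis Units_closed m_closed)
    then show ?thesis using prime_product_unit_mult[OF mult.hyps(3) w(1)] by blast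
  next
    case 2
    then obtain b' where b': "b' \<in> carrier R" "c' = p \<otimes> b'" by (auto elim: dividesE)
    then obtain m where m: "n = Suc m" "prime_product R m b'" using mult.IH mult.prems by blast
    have "p \<otimes> b = p \<otimes> (q \<otimes> b')" using b' mult.prems mult.hyps m_lcomm by metis
    then have "b = q \<otimes> b'"
      using b' mult.prems mult.hyps c' ring_primeD(1)[OF \<open>ring_prime p\<close>] m_lcancel by (metis m_closed)
    then show ?thesis using m prime_product.mult[OF mult.hyps(1,2) m(2)] by blast
  qed
qed

lemma ring_prime_unit_mult:
  assumes ab: "a \<in> carrier R" "b \<in> carrier R" and "ring_prime a" "u \<in> Units R" "a = u \<otimes> b"
  shows "ring_prime b"
proof -
  have "a \<sim>\<^bsub>mult_of R\<^esub> b"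
    using assms by (auto simp: ring_associated_iff simp flip: assoc_iff_assoc_mult)
  moreover have "a \<noteq> \<zero>" "b \<noteq> \<zero>" using assms ring_primeD(1) Units_closed r_null by metis+
  ultimately have "prime (mult_of R) b"
    using ab ring_primeE(2)[OF ab(1)] \<open>ring_prime a\<close> mult_of.prime_cong by auto
  then show ?thesis using ab \<open>b \<noteq> \<zero>\<close> by (intro ring_primeI') auto
qed

text \<open>Existence of prime factorisations already forces uniqueness: an irreducible element is
  one prime times a unit, hence itself prime, and where irreducibles are prime, factorisations into
  irreducibles are essentially unique.\<close>

lemma factorial_domainI:
  assumes pp: "\<And>a. \<lbrakk>a \<in> carrier R; a \<noteq> \<zero>\<rbrakk> \<Longrightarrow> \<exists>n. prime_product R n a"
  shows "factorial_domain R"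
proof -
  have ex: "\<exists>fs. set fs \<subseteq> carrier (mult_of R) \<and> wfactors (mult_of R) fs a" if "prime_product R n a" for n a
    using that
  proof (induction rule: prime_product.induct)
    case (unit u)
    then have "wfactors (mult_of R) [] u" by (intro mult_of.unit_wfactors) auto
    then show ?case by (intro exI[of _ "[]"]) auto
  next
    case (mult p n a)
    then obtain fs where fs: "set fs \<subseteq> carrier (mult_of R)" "wfactors (mult_of R) fs a" by blast
    have "irreducible (mult_of R) p"
      using mult mult_of.prime_irreducible ring_primeE(2) by blast
    then have "wfactors (mult_of R) (p # fs) (p \<otimes> a)"
      using mult fs prime_product_closed prime_product_nonzero ring_primeD(1)
      by (intro mult_of.wfactors_mult_single) auto
    then show ?case using fs mult ring_primeD(1) by (intro exI[of _ "p # fs"]) auto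
  qed
  have prm: "prime (mult_of R) a" if a: "a \<in> carrier (mult_of R)" "irreducible (mult_of R) a" for a
  proof -
    have a': "a \<in> carrier R" "ring_irreducible a" using a ring_irreducibleI' by auto
    obtain n where "prime_product R n a" using pp a by auto
    then show ?thesis
    proof cases
      case unit
      then show ?thesis using ring_irreducibleE(4)[OF a'] by blast
    next
      case (mult p m b)
      have b: "b \<in> carrier R" using mult prime_product_closed by blast
      then have "b \<in> Units R"
        using ring_irreducibleE(5)[OF a', of p b] mult ring_primeD(2) by blast
      moreover have "a = b \<otimes> p" using mult b m_comm by auto
      ultimately have "a \<sim> p" using ring_associated_iff a' mult by blast
      then have "p \<sim>\<^bsub>mult_of R\<^esub> a"
        using a' mult by (simp add: assoc_iff_assoc_mult mult_of.associated_sym)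
      then show ?thesis using mult ring_primeE(2) mult_of.prime_cong a ring_primeD(1)
        by (metis Diff_iff carrier_mult_of singletonD)
    qed
  qed
  interpret pc: primeness_condition_monoid "mult_of R"
    by (unfold_locales) (use prm in auto)
  have "factorial_monoid (mult_of R)"
  proof (rule mult_of.factorial_monoidI)
    show "\<exists>fs. set fs \<subseteq> carrier (mult_of R) \<and> wfactors (mult_of R) fs a"
      if "a \<in> carrier (mult_of R)" for a using that pp ex by auto
  qed (use pc.wfactors_unique in blast)
  then show ?thesis by (simp add: factorial_domain_def domain_axioms)
qed

end

section \<open>Factoriality of the subring cut out by a family of valuations\<close>

text \<open>Here \<open>L\<close> will be the Laurent polynomial ring and \<open>w z\<close> the Gauss extension of the valuation of
  a prime divisor \<open>z\<close>. Homogeneous units realise every divisor because the \<open>D\<^sub>i\<close> generate the class group.\<close>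

locale valued_factorial = domain L for L :: "('a, 'm) ring_scheme" (structure) +
  fixes P :: "'z set" and w :: "'z \<Rightarrow> 'a \<Rightarrow> int"
  assumes pp: "\<lbrakk>a \<in> carrier L; a \<noteq> \<zero>\<rbrakk> \<Longrightarrow> \<exists>n. prime_product L n a"
    and w_mult: "\<lbrakk>z \<in> P; a \<in> carrier L; b \<in> carrier L; a \<noteq> \<zero>; b \<noteq> \<zero>\<rbrakk> \<Longrightarrow> w z (a \<otimes> b) = w z a + w z b"
    and w_add: "\<lbrakk>z \<in> P; a \<in> carrier L; b \<in> carrier L; a \<noteq> \<zero>; b \<noteq> \<zero>; a \<oplus> b \<noteq> \<zero>\<rbrakk>
          \<Longrightarrow> min (w z a) (w z b) \<le> w z (a \<oplus> b)"
    and w_finite: "\<lbrakk>a \<in> carrier L; a \<noteq> \<zero>\<rbrakk> \<Longrightarrow> finite {z \<in> P. w z a \<noteq> 0}"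
    and realise: "finite {z \<in> P. m z \<noteq> 0} \<Longrightarrow> \<exists>u\<in>Units L. \<forall>z\<in>P. w z u = m z"
begin

definition "R = L\<lparr>carrier := {a \<in> carrier L. a = \<zero> \<or> (\<forall>z\<in>P. 0 \<le> w z a)}\<rparr>"

lemma R_simps [simp]: "(\<otimes>\<^bsub>R\<^esub>) = (\<otimes>)" "\<one>\<^bsub>R\<^esub> = \<one>" "\<zero>\<^bsub>R\<^esub> = \<zero>" "(\<oplus>\<^bsub>R\<^esub>) = (\<oplus>)"
  by (simp_all add: R_def)

lemma R_carrier: "a \<in> carrier R \<longleftrightarrow> a \<in> carrier L \<and> (a = \<zero> \<or> (\<forall>z\<in>P. 0 \<le> w z a))"
  by (simp add: R_def)

lemma w_one: "z \<in> P \<Longrightarrow> w z \<one> = 0"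
  using w_mult[of z \<one> \<one>] by simp

lemma Units_nonzero: "u \<in> Units L \<Longrightarrow> u \<noteq> \<zero>"
  using Units_r_inv_ex zero_not_one by force

lemma w_inv: "\<lbrakk>z \<in> P; u \<in> Units L\<rbrakk> \<Longrightarrow> w z (inv u) = - w z u"
  using w_mult[of z u "inv u"] w_one Units_nonzero Units_inv_Units Units_closed by force

lemma R_closed: "a \<in> carrier R \<Longrightarrow> a \<in> carrier L" by (simp add: R_carrier)

text \<open>The element \<open>\<ominus> \<one>\<close> squares to one, so twice its value is
  zero.\<close>

lemma w_minus: assumes "z \<in> P" "a \<in> carrier L" "a \<noteq> \<zero>" shows "w z (\<ominus> a) = w z a"
proof -
  have "\<ominus> \<one> \<in> Units L" by (metis Units_minus_one_closed)
  moreover have "(\<ominus> \<one>) \<otimes> (\<ominus> \<one>) = \<one>" by (simp add: l_minus)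
  ultimately have "2 * w z (\<ominus> \<one>) = 0"
    using w_mult[of z "\<ominus> \<one>" "\<ominus> \<one>"] w_one assms(1) Units_nonzero Units_closed by fastforce
  moreover have "\<ominus> a = (\<ominus> \<one>) \<otimes> a" using assms by (simp add: l_minus)
  ultimately show ?thesis
    using w_mult[of z "\<ominus> \<one>" a] assms \<open>\<ominus> \<one> \<in> Units L\<close> Units_nonzero Units_closed by fastforce
qed

lemma R_subring: "subring (carrier R) L"
proof (rule subringI)
  show "carrier R \<subseteq> carrier L" using R_closed by blast
  show "\<one> \<in> carrier R" by (simp add: R_carrier w_one)
  show "\<ominus> h \<in> carrier R" if "h \<in> carrier R" for h
    using that w_minus by (auto simp: R_carrier)
  fix a b assume ab: "a \<in> carrier R" "b \<in> carrier R"
  then show "a \<otimes> b \<in> carrier R" by (auto simp: R_carrier w_mult integral_iff)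
  show "a \<oplus> b \<in> carrier R"
  proof -
    have "0 \<le> w z (a \<oplus> b)" if "a \<noteq> \<zero>" "b \<noteq> \<zero>" "a \<oplus> b \<noteq> \<zero>" "z \<in> P" for z
      using w_add[of z a b] that ab by (force simp: R_carrier)
    then show ?thesis using ab by (cases "a = \<zero>"; cases "b = \<zero>") (auto simp: R_carrier)
  qed
qed

sublocale R: domain R
  using subring_is_domain[OF R_subring] by (simp add: R_def)

lemma w_zero_Units:
  assumes "u \<in> Units L" "\<And>z. z \<in> P \<Longrightarrow> w z u = 0"
  shows "u \<in> Units R"
proof -
  have "u \<in> carrier R" "inv u \<in> carrier R"
    using assms w_inv by (auto simp: R_carrier)
  then show ?thesis using assms(1) by (auto simp: Units_def[of R] intro!: bexI[of _ "inv u"])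
qed

text \<open>The quotient formed in \<open>L\<close> has values \<open>w z b - w z a\<close>, so it
  lies in \<open>R\<close> as soon as these are nonnegative. Both constructions of primes of
  \<open>R\<close> test divisibility through this.\<close>

lemma R_divides:
  assumes "a \<in> carrier L" "a \<noteq> \<zero>" "b \<in> carrier R" "\<And>z. \<lbrakk>z \<in> P; b \<noteq> \<zero>\<rbrakk> \<Longrightarrow> w z a \<le> w z b" "a divides b"
  shows "a divides\<^bsub>R\<^esub> b"
proof -
  obtain c where c: "c \<in> carrier L" "b = a \<otimes> c" using assms by (auto elim: dividesE)
  have "c \<in> carrier R"
  proof (cases "c = \<zero>")
    case False
    then have "b \<noteq> \<zero>" using c assms(1,2) by (simp add: integral_iff)
    then have "0 \<le> w z c" if "z \<in> P" for z
      using w_mult[OF that assms(1) c(1) assms(2) False] assms(4)[OF that] c(2) by simp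
    then show ?thesis using c by (simp add: R_carrier)
  qed (simp add: R_carrier)
  then show ?thesis using c by (auto simp: factor_def)
qed

text \<open>As \<open>p\<close> is a unit of \<open>L\<close>, it divides \<open>a\<close> in
  \<open>R\<close> as soon as \<open>w z a \<ge> 1\<close>; a product divisible by \<open>p\<close>
  has value at least one along \<open>z\<close>, and additivity of \<open>w z\<close> puts this into
  one of the factors.\<close>

lemma prime_of_valuation:
  assumes p: "p \<in> Units L" and z: "z \<in> P" and wp: "\<And>z'. z' \<in> P \<Longrightarrow> w z' p = (if z' = z then 1 else 0)"
  shows "p \<in> carrier R" "ring_prime\<^bsub>R\<^esub> p"
proof -
  have pL: "p \<in> carrier L" "p \<noteq> \<zero>" using p Units_nonzero by auto
  show pR: "p \<in> carrier R" using pL wp by (simp add: R_carrier)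
  have nu: "p \<notin> Units R"
  proof
    assume "p \<in> Units R"
    then obtain q where q: "q \<in> carrier R" "p \<otimes> q = \<one>" using R.Units_r_inv_ex by auto
    then have "q \<in> carrier L" "q \<noteq> \<zero>" using R_closed pL by auto
    then have "w z p + w z q = 0" using w_mult[OF z pL(1) _ pL(2)] q w_one[OF z] by metis
    moreover have "0 \<le> w z q" using q z R_carrier \<open>q \<noteq> \<zero>\<close> by auto
    ultimately show False using wp z by simp
  qed
  have dv: "p divides\<^bsub>R\<^esub> a" if "a \<in> carrier R" "a \<noteq> \<zero> \<Longrightarrow> 1 \<le> w z a" for a
  proof (rule R_divides)
    have "a = p \<otimes> (inv p \<otimes> a)"
      using p that R_closed by (metis Units_closed Units_inv_closed Units_r_inv l_one m_assoc)
    then show "p divides a" using p that R_closed by (metis Units_inv_closed dividesI m_closed)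
  qed (use pL that wp R_carrier in auto)
  show "ring_prime\<^bsub>R\<^esub> p"
  proof (rule R.ring_primeI, simp add: pL, rule primeI[OF nu])
    fix a b assume ab: "a \<in> carrier R" "b \<in> carrier R" "p divides\<^bsub>R\<^esub> a \<otimes>\<^bsub>R\<^esub> b"
    then have L: "a \<in> carrier L" "b \<in> carrier L" using R_closed by auto
    show "p divides\<^bsub>R\<^esub> a \<or> p divides\<^bsub>R\<^esub> b"
    proof (cases "a = \<zero> \<or> b = \<zero>")
      case True then show ?thesis using dv ab by blast
    next
      case False
      obtain c where c: "c \<in> carrier R" "a \<otimes> b = p \<otimes> c" using ab by (auto elim: dividesE)
      then have "c \<in> carrier L" "c \<noteq> \<zero>" using R_closed False L integral pL by (auto simp: integral_iff)
      then have "w z a + w z b = w z p + w z c" "0 \<le> w z c"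
        using w_mult[OF z] c L False pL z R_carrier by metis+
      then have "1 \<le> w z a \<or> 1 \<le> w z b" using wp z by auto
      then show ?thesis using dv ab by blast
    qed
  qed
qed

text \<open>With all values of \<open>q\<close> equal to zero, the quotient of an element of
  \<open>R\<close> by \<open>q\<close> keeps its values, so divisibility by \<open>q\<close> means
  the same in \<open>R\<close> and in \<open>L\<close>.\<close>

lemma prime_of_prime:
  assumes q: "q \<in> carrier L" "ring_prime q" and wq: "\<And>z. z \<in> P \<Longrightarrow> w z q = 0"
  shows "q \<in> carrier R" "ring_prime\<^bsub>R\<^esub> q"
proof -
  have q0: "q \<noteq> \<zero>" using q ring_primeD by auto
  show qR: "q \<in> carrier R" using q wq by (simp add: R_carrier)
  have nu: "q \<notin> Units R"
  proof
    assume "q \<in> Units R"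
    then have "q \<in> Units L" using R_closed by (auto simp: Units_def)
    then show False using q ring_primeD by blast
  qed
  have dv: "q divides\<^bsub>R\<^esub> a" if "a \<in> carrier R" "q divides a" for a
    using R_divides[of q a] that q q0 wq R_carrier by auto
  show "ring_prime\<^bsub>R\<^esub> q"
  proof (rule R.ring_primeI, simp add: q0, rule primeI[OF nu])
    fix a b assume ab: "a \<in> carrier R" "b \<in> carrier R" "q divides\<^bsub>R\<^esub> a \<otimes>\<^bsub>R\<^esub> b"
    then have L: "a \<in> carrier L" "b \<in> carrier L" using R_closed by auto
    have "q divides a \<otimes> b" using ab R_closed by (auto simp: factor_def)
    then show "q divides\<^bsub>R\<^esub> a \<or> q divides\<^bsub>R\<^esub> b"
      using ring_primeD(3)[OF q(2) L] dv ab by blast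
  qed
qed

text \<open>All correcting units are collected in \<open>u\<close>. That \<open>g\<close> has value
  zero everywhere matters as much as its factorisation: it makes \<open>u\<close> carry the whole
  divisor of \<open>a\<close>.\<close>

lemma prime_product_normalised:
  assumes "prime_product L n a"
  shows "\<exists>u g. u \<in> Units L \<and> prime_product R n g \<and> (\<forall>z\<in>P. w z g = 0) \<and> a = u \<otimes> g"
  using assms
proof (induction rule: prime_product.induct)
  case (unit u)
  have "prime_product R 0 \<one>" by (metis R.Units_one_closed R_simps(2) prime_product.unit)
  then show ?case using unit w_one by (intro exI[of _ u] exI[of _ "\<one>"]) auto
next
  case (mult q n a)
  then obtain u g where ug: "u \<in> Units L" "prime_product R n g" "\<forall>z\<in>P. w z g = 0" "a = u \<otimes> g" by blast
  have q: "q \<in> carrier L" "q \<noteq> \<zero>" using mult ring_primeD by auto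
  obtain v where v: "v \<in> Units L" "\<forall>z\<in>P. w z v = w z q" using realise[OF w_finite[OF q]] by blast
  define q' where "q' = inv v \<otimes> q"
  have q': "q' \<in> carrier L" "q = v \<otimes> q'" using v q Units_mult_inv by (simp_all add: q'_def)
  have "q' \<noteq> \<zero>" using q' q v by auto
  have wq': "w z q' = 0" if "z \<in> P" for z
    using w_mult[OF that, of v q'] q' v that Units_nonzero \<open>q' \<noteq> \<zero>\<close> by force
  have "ring_prime q'" using ring_prime_unit_mult[OF q(1) q'(1) mult.hyps(2) v(1) q'(2)] .
  from prime_of_prime[OF q'(1) this wq'] have q'R: "q' \<in> carrier R" "ring_prime\<^bsub>R\<^esub> q'" by auto
  have g: "g \<in> carrier R" "g \<noteq> \<zero>"
    using R.prime_product_closed[OF ug(2)] R.prime_product_nonzero[OF ug(2)] by auto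
  then have gL: "g \<in> carrier L" using R_closed by auto
  have "q \<otimes> a = (v \<otimes> u) \<otimes> (q' \<otimes> g)"
    using q' ug(4) gL Units_closed[OF ug(1)] Units_closed[OF v(1)] by (simp add: m_ac)
  moreover have "prime_product R (Suc n) (q' \<otimes> g)" using prime_product.mult[OF q'R ug(2)] by simp
  moreover have "w z (q' \<otimes> g) = 0" if "z \<in> P" for z
    using w_mult[OF that] q' gL g \<open>q' \<noteq> \<zero>\<close> wq' ug(3) that by simp
  ultimately show ?case using v ug by (intro exI[of _ "v \<otimes> u"] exI[of _ "q' \<otimes> g"]) auto
qed

text \<open>Induction on the degree \<open>n\<close>: dividing by a unit of \<open>L\<close> with
  divisor \<open>z\<close>, where \<open>w z u\<close> is positive, lowers the degree by one and
  keeps all values nonnegative. If no value is nonzero, \<open>u\<close> is a unit of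
  \<open>R\<close>.\<close>

lemma prime_product_unit:
  assumes "u \<in> Units L" "\<And>z. z \<in> P \<Longrightarrow> 0 \<le> w z u" "n = nat (\<Sum>z | z \<in> P \<and> w z u \<noteq> 0. w z u)"
  shows "prime_product R n u"
  using assms
proof (induction n arbitrary: u rule: less_induct)
  case (less n)
  have fin: "finite {z \<in> P. w z u \<noteq> 0}" using w_finite less Units_nonzero by blast
  show ?case
  proof (cases "\<exists>z\<in>P. w z u \<noteq> 0")
    case False
    then have "{z \<in> P. w z u \<noteq> 0} = {}" by blast
    then have "n = 0" using less(4) by simp
    then show ?thesis using w_zero_Units less False by (auto intro!: prime_product.unit)
  next
    case True
    then obtain z where z: "z \<in> P" "w z u \<noteq> 0" by blast
    have "finite {z' \<in> P. (if z' = z then 1 else 0::int) \<noteq> 0}"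
      by (rule finite_subset[of _ "{z}"]) auto
    then obtain p where p: "p \<in> Units L" "\<And>z'. z' \<in> P \<Longrightarrow> w z' p = (if z' = z then 1 else 0)"
      using realise[of "\<lambda>z'. if z' = z then 1 else 0"] by blast
    define u' where "u' = inv p \<otimes> u"
    have u': "u' \<in> Units L" "u = p \<otimes> u'"
      using p less.prems Units_mult_inv by (simp_all add: u'_def Units_closed)
    have w: "w z' u = w z' p + w z' u'" if "z' \<in> P" for z'
      using w_mult[OF that, of p u'] u' p Units_nonzero Units_closed by metis
    have nn: "0 \<le> w z' u'" if "z' \<in> P" for z'
      using w[OF that] p(2)[OF that] less(3)[OF that] z by (auto split: if_splits)
    let ?F = "{z \<in> P. w z u \<noteq> 0}"
    \<comment> \<open>The support can only shrink, so both degrees may be summed over the old,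
      finite support.\<close>
    have sub: "{z' \<in> P. w z' u' \<noteq> 0} \<subseteq> ?F"
    proof
      fix z' assume "z' \<in> {z' \<in> P. w z' u' \<noteq> 0}"
      then show "z' \<in> ?F" using w[of z'] p(2)[of z'] nn[of z'] by auto
    qed
    have "(\<Sum>z \<in> ?F. w z u) = (\<Sum>z' \<in> ?F. if z' = z then 1 else 0) + (\<Sum>z \<in> ?F. w z u')"
      using w p by (simp flip: sum.distrib)
    also have "(\<Sum>z' \<in> ?F. if z' = z then 1 else 0 :: int) = 1" using z fin by simp
    also have "(\<Sum>z \<in> ?F. w z u') = (\<Sum>z | z \<in> P \<and> w z u' \<noteq> 0. w z u')"
      by (rule sum.mono_neutral_right[OF fin sub]) auto
    finally have eq: "(\<Sum>z \<in> ?F. w z u) = 1 + (\<Sum>z | z \<in> P \<and> w z u' \<noteq> 0. w z u')" .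
    have nonneg: "0 \<le> (\<Sum>z | z \<in> P \<and> w z u' \<noteq> 0. w z u')" using nn by (auto intro: sum_nonneg)
    then have n: "n = Suc (nat (\<Sum>z | z \<in> P \<and> w z u' \<noteq> 0. w z u'))"
      using eq less(4) by simp
    have "prime_product R (nat (\<Sum>z | z \<in> P \<and> w z u' \<noteq> 0. w z u')) u'"
      by (rule less(1)) (use n u' nn in auto)
    then show ?thesis
      using prime_product.mult[OF prime_of_valuation[OF p(1) z(1) p(2)]] n u' by simp
  qed
qed

text \<open>Since \<open>g\<close> has value zero along every \<open>z\<close>, the unit
  \<open>u\<close> inherits the nonnegative values of \<open>a\<close>, and \<open>u\<close> and
  \<open>g\<close> factor separately.\<close>

theorem factorial: "factorial_domain R"
proof (rule R.factorial_domainI)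
  fix a assume a: "a \<in> carrier R" "a \<noteq> \<zero>\<^bsub>R\<^esub>"
  then have aL: "a \<in> carrier L" "a \<noteq> \<zero>" using R_closed by auto
  then obtain n where "prime_product L n a" using pp by blast
  then obtain u g where ug: "u \<in> Units L" "prime_product R n g" "\<forall>z\<in>P. w z g = 0" "a = u \<otimes> g"
    using prime_product_normalised by blast
  have g: "g \<in> carrier R" "g \<noteq> \<zero>"
    using R.prime_product_closed[OF ug(2)] R.prime_product_nonzero[OF ug(2)] by auto
  have "0 \<le> w z u" if "z \<in> P" for z
  proof -
    have "w z a = w z u + w z g"
      using w_mult[OF that] ug g R_closed Units_nonzero Units_closed by metis
    then show ?thesis using a aL that ug by (auto simp: R_carrier)
  qed
  then have "\<exists>m. prime_product R m u" using prime_product_unit ug by blast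
  then show "\<exists>n. prime_product R n a" using R.prime_product_mult[OF _ ug(2)] ug(4) by auto
qed

end

section \<open>Gauss's lemma for Laurent extensions\<close>

lemma (in cring) divides_add:
  assumes "p \<in> carrier R" "x \<in> carrier R" "y \<in> carrier R" "p divides x" "p divides y"
  shows "p divides (x \<oplus> y)"
proof -
  obtain a b where "a \<in> carrier R" "x = p \<otimes> a" "b \<in> carrier R" "y = p \<otimes> b"
    using assms by (auto elim!: dividesE)
  then have "x \<oplus> y = p \<otimes> (a \<oplus> b)" using assms(1) by (simp add: r_distr)
  then show ?thesis using \<open>a \<in> _\<close> \<open>b \<in> _\<close> by (auto intro: dividesI)
qed

lemma (in cring) divides_minus:
  assumes "p \<in> carrier R" "x \<in> carrier R" "y \<in> carrier R" "p divides x" "p divides y"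
  shows "p divides (x \<ominus> y)"
proof -
  obtain b where "b \<in> carrier R" "y = p \<otimes> b" using assms by (auto elim!: dividesE)
  then have "\<ominus> y = p \<otimes> (\<ominus> b)" using assms(1) by (simp add: r_minus)
  then have "p divides \<ominus> y" using \<open>b \<in> _\<close> by (auto intro: dividesI)
  then show ?thesis using divides_add assms by (simp add: minus_eq)
qed

lemma (in ring) diff_self: "x \<in> carrier R \<Longrightarrow> x \<ominus> x = \<zero>"
  by (simp add: minus_eq r_neg)

lemma (in ring) diff_zero: "x \<in> carrier R \<Longrightarrow> x \<ominus> \<zero> = x"
  by (simp add: minus_eq)

lemma (in ring) add_diff_cancel: "\<lbrakk>x \<in> carrier R; y \<in> carrier R\<rbrakk> \<Longrightarrow> y \<oplus> (x \<ominus> y) = x"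
  by (simp add: minus_eq a_lcomm r_neg)

text \<open>\<open>B\<close> plays the role of \<open>A[t, t\<^sup>-\<^sup>1]\<close>, with \<open>T i = t\<^sup>i\<close> and \<open>cf f k\<close> the coefficient of \<open>t\<^sup>k\<close>.\<close>

locale laurent_extension = A: domain A + domain B
  for A :: "('a, 'm) ring_scheme" and B :: "('a, 'm) ring_scheme" (structure) +
  fixes cf :: "'a \<Rightarrow> int \<Rightarrow> 'a" and T :: "int \<Rightarrow> 'a"
  assumes A_sub: "carrier A \<subseteq> carrier B"
    and A_ops: "(\<otimes>\<^bsub>A\<^esub>) = (\<otimes>)" "\<one>\<^bsub>A\<^esub> = \<one>" "\<zero>\<^bsub>A\<^esub> = \<zero>" "(\<oplus>\<^bsub>A\<^esub>) = (\<oplus>)"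
    and T_closed [simp]: "T i \<in> carrier B"
    and T_add: "T i \<otimes> T j = T (i + j)"
    and T_0: "T 0 = \<one>"
    and cf_closed [simp]: "f \<in> carrier B \<Longrightarrow> cf f k \<in> carrier A"
    and cf_finite: "f \<in> carrier B \<Longrightarrow> finite {k. cf f k \<noteq> \<zero>}"
    and cf_eq_zero: "\<lbrakk>f \<in> carrier B; \<And>k. cf f k = \<zero>\<rbrakk> \<Longrightarrow> f = \<zero>"
    and cf_add: "\<lbrakk>f \<in> carrier B; g \<in> carrier B\<rbrakk> \<Longrightarrow> cf (f \<oplus> g) k = cf f k \<oplus> cf g k"
    and cf_mono_mult: "\<lbrakk>a \<in> carrier A; g \<in> carrier B\<rbrakk> \<Longrightarrow> cf (a \<otimes> T i \<otimes> g) k = a \<otimes> cf g (k - i)"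
    and cf_one: "cf \<one> k = (if k = 0 then \<one> else \<zero>)"
begin

declare A_ops [simp]

lemma A_B [simp, intro]: "a \<in> carrier A \<Longrightarrow> a \<in> carrier B"
  using A_sub by blast

lemma cf_B [simp]: "f \<in> carrier B \<Longrightarrow> cf f k \<in> carrier B"
  by (rule A_B) simp

lemma T_Units: "T i \<in> Units B"
  using Units_of_inverse[of "T i" "T (- i)"] by (simp add: T_add T_0)

lemma cf_zero [simp]: "cf \<zero> k = \<zero>"
proof -
  have "cf \<zero> k \<oplus> cf \<zero> k = cf \<zero> k" using cf_add[of \<zero> \<zero> k] by simp
  then show ?thesis by (metis cf_B add.l_cancel_one' zero_closed)
qed

lemma cf_minus: assumes "f \<in> carrier B" shows "cf (\<ominus> f) k = \<ominus> cf f k"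
proof -
  have "cf (\<ominus> f) k \<oplus> cf f k = \<zero>" using cf_add[of "\<ominus> f" f k] assms by (simp add: l_neg)
  then show ?thesis using assms by (simp add: minus_equality)
qed

lemma cf_diff: "\<lbrakk>f \<in> carrier B; g \<in> carrier B\<rbrakk> \<Longrightarrow> cf (f \<ominus> g) k = cf f k \<ominus> cf g k"
  by (simp add: minus_eq cf_add cf_minus)

lemma cf_mono: "a \<in> carrier A \<Longrightarrow> cf (a \<otimes> T i) k = (if k = i then a else \<zero>)"
  using cf_mono_mult[of a \<one> i k] by (simp add: cf_one)

lemma cf_const_mult: "\<lbrakk>a \<in> carrier A; g \<in> carrier B\<rbrakk> \<Longrightarrow> cf (a \<otimes> g) k = a \<otimes> cf g k"
  using cf_mono_mult[of a g 0 k] by (simp add: T_0)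

lemma cf_const: "a \<in> carrier A \<Longrightarrow> cf a k = (if k = 0 then a else \<zero>)"
  using cf_mono[of a 0 k] by (simp add: T_0)

text \<open>The locale describes multiplication only against monomials, so \<open>f\<close> is
  dismantled term by term, by induction on its number of terms. The bounds \<open>i\<close> and
  \<open>j\<close> need not be attained, which lets the hypotheses survive the removal of a
  term.\<close>

lemma low_mult:
  assumes "f \<in> carrier B" "g \<in> carrier B" "\<forall>k<i. cf f k = \<zero>" "\<forall>k<j. cf g k = \<zero>"
  shows "(\<forall>k<i + j. cf (f \<otimes> g) k = \<zero>) \<and> cf (f \<otimes> g) (i + j) = cf f i \<otimes> cf g j"
  using assms
proof (induction "card {k. cf f k \<noteq> \<zero>}" arbitrary: f rule: less_induct)
  case less
  note B = less.prems(1,2)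
  show ?case
  proof (cases "\<forall>k. cf f k = \<zero>")
    case True
    then have "f = \<zero>" using cf_eq_zero B by blast
    then show ?thesis using B by simp
  next
    case False
    then obtain k where k: "cf f k \<noteq> \<zero>" by blast
    then have ki: "i \<le> k" using less.prems by (meson linorder_not_le)
    define f' where "f' = f \<ominus> cf f k \<otimes> T k"
    have f': "f' \<in> carrier B" using B by (simp add: f'_def)
    have cf': "cf f' n = (if n = k then \<zero> else cf f n)" for n
      using B by (simp add: f'_def cf_diff cf_mono diff_self diff_zero)
    have "card {k. cf f' k \<noteq> \<zero>} < card {k. cf f k \<noteq> \<zero>}"
      using k cf' by (intro psubset_card_mono cf_finite B) auto
    then have IH: "\<forall>k<i + j. cf (f' \<otimes> g) k = \<zero>" "cf (f' \<otimes> g) (i + j) = cf f' i \<otimes> cf g j"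
      using less.hyps[of f'] f' B less.prems cf' by auto
    have "f = cf f k \<otimes> T k \<oplus> f'"
      using B by (simp add: f'_def add_diff_cancel)
    then have "f \<otimes> g = cf f k \<otimes> T k \<otimes> g \<oplus> f' \<otimes> g"
      using B f' by (metis T_closed cf_B l_distr m_closed)
    then have eq: "cf (f \<otimes> g) n = cf f k \<otimes> cf g (n - k) \<oplus> cf (f' \<otimes> g) n" for n
      using B f' by (simp add: cf_add cf_mono_mult)
    have "cf (f \<otimes> g) n = \<zero>" if "n < i + j" for n
      using eq[of n] IH(1) that ki less.prems(4) B by simp
    moreover have "cf (f \<otimes> g) (i + j) = cf f i \<otimes> cf g j"
    \<comment> \<open>The removed term meets \<open>cf g (i + j - k)\<close>: this is
      \<open>cf g j\<close> for \<open>k = i\<close>, and vanishes for \<open>k > i\<close>.\<close>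
    proof (cases "k = i")
      case True
      then show ?thesis using eq[of "i + j"] IH(2) cf' B by simp
    next
      case False
      then show ?thesis using eq[of "i + j"] IH(2) cf' B ki less.prems(4) by simp
    qed
    ultimately show ?thesis by blast
  qed
qed

text \<open>Exchanging \<open>t\<close> and its inverse gives the same extension with reversed
  coefficients, and turns highest terms into lowest ones.\<close>

lemma high_mult:
  assumes "f \<in> carrier B" "g \<in> carrier B" "\<forall>k>i. cf f k = \<zero>" "\<forall>k>j. cf g k = \<zero>"
  shows "(\<forall>k>i + j. cf (f \<otimes> g) k = \<zero>) \<and> cf (f \<otimes> g) (i + j) = cf f i \<otimes> cf g j"
proof -
  interpret rev: laurent_extension A B "\<lambda>f k. cf f (- k)" "\<lambda>i. T (- i)"
  proof
    fix f assume "f \<in> carrier B"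
    then have "finite (uminus -` {k. cf f k \<noteq> \<zero>})" by (intro finite_vimageI cf_finite) simp_all
    then show "finite {k. cf f (- k) \<noteq> \<zero>}" by (simp add: vimage_def)
  next
    fix f assume f: "f \<in> carrier B" "\<And>k. cf f (- k) = \<zero>"
    have "cf f k = \<zero>" for k using f(2)[of "- k"] by simp
    then show "f = \<zero>" using cf_eq_zero[OF f(1)] by blast
  next
    fix a g :: 'a and i k :: int assume "a \<in> carrier A" "g \<in> carrier B"
    then show "cf (a \<otimes> T (- i) \<otimes> g) (- k) = a \<otimes> cf g (- (k - i))"
      using cf_mono_mult[of a g "- i" "- k"] by (simp add: algebra_simps)
  qed (use A_sub in \<open>auto simp: T_add T_0 cf_add cf_one\<close>)
  have *: "\<forall>k< - i. cf f (- k) = \<zero>" "\<forall>k< - j. cf g (- k) = \<zero>" using assms by auto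
  have **: "\<forall>k < (- i) + (- j). cf (f \<otimes> g) (- k) = \<zero>" "cf (f \<otimes> g) (- ((- i) + (- j))) = cf f (- (- i)) \<otimes> cf g (- (- j))"
    using rev.low_mult[OF assms(1,2) *] by blast+
  have "cf (f \<otimes> g) k = \<zero>" if "k > i + j" for k
    using **(1)[rule_format, of "- k"] that by simp
  then show ?thesis using **(2) by (simp add: add.commute)
qed

definition lo :: "'a \<Rightarrow> int" where "lo f = Min {k. cf f k \<noteq> \<zero>}"
definition hi :: "'a \<Rightarrow> int" where "hi f = Max {k. cf f k \<noteq> \<zero>}"
text \<open>As powers of \<open>t\<close> are units, the degree is replaced by the distance between
  the extreme exponents. It is additive on products of nonzero elements and vanishes among them only
  on monomials, hence serves as the measure for division with remainder.\<close>

definition width :: "'a \<Rightarrow> nat" where "width f = nat (hi f - lo f)"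

lemma lo_hi:
  assumes "f \<in> carrier B" "f \<noteq> \<zero>"
  shows "cf f (lo f) \<noteq> \<zero>" "cf f (hi f) \<noteq> \<zero>" "\<forall>k<lo f. cf f k = \<zero>" "\<forall>k>hi f. cf f k = \<zero>" "lo f \<le> hi f"
proof -
  let ?S = "{k. cf f k \<noteq> \<zero>}"
  have S: "finite ?S" "?S \<noteq> {}" using cf_finite cf_eq_zero[OF assms(1)] assms by blast+
  show "cf f (lo f) \<noteq> \<zero>" "cf f (hi f) \<noteq> \<zero>"
    using Min_in[OF S] Max_in[OF S] by (auto simp: lo_def hi_def)
  show "\<forall>k<lo f. cf f k = \<zero>" using Min_le[OF S(1)] by (force simp: lo_def)
  show "\<forall>k>hi f. cf f k = \<zero>" using Max_ge[OF S(1)] by (force simp: hi_def)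
  show "lo f \<le> hi f" 
    using Max_ge[OF S(1) Min_in[OF S]] by (simp add: lo_def hi_def)
qed

lemma lo_unique: "\<lbrakk>f \<in> carrier B; cf f i \<noteq> \<zero>; \<forall>k<i. cf f k = \<zero>\<rbrakk> \<Longrightarrow> lo f = i"
  unfolding lo_def by (rule Min_eqI) (auto simp: cf_finite intro: leI)

lemma hi_unique: "\<lbrakk>f \<in> carrier B; cf f i \<noteq> \<zero>; \<forall>k>i. cf f k = \<zero>\<rbrakk> \<Longrightarrow> hi f = i"
  unfolding hi_def by (rule Max_eqI) (auto simp: cf_finite intro: leI)

lemma width_mult:
  assumes "f \<in> carrier B" "g \<in> carrier B" "f \<noteq> \<zero>" "g \<noteq> \<zero>"
  shows "width (f \<otimes> g) = width f + width g"
proof -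
  have "lo (f \<otimes> g) = lo f + lo g"
    using low_mult[OF assms(1,2), of "lo f" "lo g"] lo_hi assms
    by (intro lo_unique) (auto simp: integral_iff)
  moreover have "hi (f \<otimes> g) = hi f + hi g"
    using high_mult[OF assms(1,2), of "hi f" "hi g"] lo_hi assms
    by (intro hi_unique) (auto simp: integral_iff)
  moreover have "lo f \<le> hi f" "lo g \<le> hi g" using lo_hi(5) assms by auto
  ultimately show ?thesis by (simp add: width_def)
qed

lemma width_const: "\<lbrakk>a \<in> carrier A; a \<noteq> \<zero>\<rbrakk> \<Longrightarrow> width a = 0"
  using lo_unique[of a 0] hi_unique[of a 0] by (simp add: width_def cf_const)

lemma width_zero_mono:
  assumes "f \<in> carrier B" "f \<noteq> \<zero>" "width f = 0"
  shows "f = cf f (lo f) \<otimes> T (lo f)"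
proof -
  have "hi f = lo f" using lo_hi(5) assms by (force simp: width_def)
  then have *: "cf f k = \<zero>" if "k \<noteq> lo f" for k
    using lo_hi assms that by (metis linorder_neqE)
  have "f \<ominus> cf f (lo f) \<otimes> T (lo f) = \<zero>"
    by (rule cf_eq_zero) (use assms * in \<open>auto simp: cf_diff cf_mono diff_self diff_zero\<close>)
  then show ?thesis using assms by simp
qed

lemma divides_B: "a divides\<^bsub>A\<^esub> b \<Longrightarrow> a divides b"
  by (auto simp: factor_def)

lemma divides_cf:
  assumes "p \<in> carrier A" "p divides f" shows "p divides\<^bsub>A\<^esub> cf f k"
  using assms by (auto simp: factor_def cf_const_mult intro!: bexI[of _ "cf _ k"])

lemma Units_A_B: "u \<in> Units A \<Longrightarrow> u \<in> Units B"
  by (auto simp: Units_def)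

text \<open>The lowest coefficient of \<open>f \<otimes> g\<close> is the product of the lowest
  coefficients, so \<open>p\<close> divides one of these. Dropping that term changes the factor by a
  multiple of \<open>p\<close> and shortens it; the induction is on the total number of
  terms.\<close>

lemma prime_lift:
  assumes p: "p \<in> carrier A" "ring_prime\<^bsub>A\<^esub> p"
  shows "ring_prime p"
proof (rule ring_primeI)
  show "p \<noteq> \<zero>" using A.ring_primeD(1)[OF p(2)] by simp
  show "prime B p"
  proof (rule primeI)
    show "p \<notin> Units B"
    proof
      assume "p \<in> Units B"
      then obtain q where q: "q \<in> carrier B" "p \<otimes> q = \<one>" using Units_r_inv_ex by auto
      \<comment> \<open>The constant coefficient of an inverse in \<open>B\<close> is an inverse in
        \<open>A\<close>.\<close>
      then have "p \<otimes> cf q 0 = \<one>" using cf_const_mult[OF p(1) q(1), of 0] by (simp add: cf_one)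
      then show False using A.Units_of_inverse[of p "cf q 0"] A.ring_primeD(2)[OF p(2)] p q by simp
    qed
    fix f g assume "f \<in> carrier B" "g \<in> carrier B" "p divides f \<otimes> g"
    then show "p divides f \<or> p divides g"
    proof (induction "card {k. cf f k \<noteq> \<zero>} + card {k. cf g k \<noteq> \<zero>}" arbitrary: f g rule: less_induct)
      case less
      note B = less.prems(1,2)
      show ?case
      proof (cases "f = \<zero> \<or> g = \<zero>")
        case True
        then show ?thesis using divides_zero p by auto
      next
        case False
        have red: "\<exists>h'. h' \<in> carrier B \<and> card {k. cf h' k \<noteq> \<zero>} < card {k. cf h k \<noteq> \<zero>} \<and>
            p divides (h \<ominus> h')" if h: "h \<in> carrier B" "h \<noteq> \<zero>" "p divides\<^bsub>A\<^esub> cf h (lo h)" for h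
        proof (intro exI conjI)
          let ?m = "cf h (lo h) \<otimes> T (lo h)" let ?h = "h \<ominus> ?m"
          show "?h \<in> carrier B" using h by simp
          have "cf ?h n = (if n = lo h then \<zero> else cf h n)" for n
            using h by (simp add: cf_diff cf_mono diff_self diff_zero)
          then show "card {k. cf ?h k \<noteq> \<zero>} < card {k. cf h k \<noteq> \<zero>}"
            using lo_hi(1)[OF h(1,2)] by (intro psubset_card_mono cf_finite h(1)) auto
          have "?m \<in> carrier B" using h by simp
          then have "h \<ominus> ?h = ?m" using h(1) by algebra
          then show "p divides (h \<ominus> ?h)" using divides_B[OF h(3)] p h
            by (simp add: divides_prod_r)
        qed
        have "cf (f \<otimes> g) (lo f + lo g) = cf f (lo f) \<otimes> cf g (lo g)"
          using low_mult[OF B, of "lo f" "lo g"] lo_hi(3)[OF B(1)] lo_hi(3)[OF B(2)] False by auto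
        then have "p divides\<^bsub>A\<^esub> cf f (lo f) \<otimes>\<^bsub>A\<^esub> cf g (lo g)"
          using divides_cf[OF p(1) less.prems(3), of "lo f + lo g"] by simp
        then consider "p divides\<^bsub>A\<^esub> cf f (lo f)" | "p divides\<^bsub>A\<^esub> cf g (lo g)"
          using A.ring_primeD(3)[OF p(2) cf_closed[OF B(1)] cf_closed[OF B(2)]] by blast
        then show ?thesis
        proof cases
          case 1
          then obtain f' where f': "f' \<in> carrier B" "card {k. cf f' k \<noteq> \<zero>} < card {k. cf f k \<noteq> \<zero>}"
            "p divides (f \<ominus> f')" using red[OF B(1) _ 1] False by blast
          have pB: "p \<in> carrier B" using p by simp
          have "p divides (f \<ominus> f') \<otimes> g" using f' B p by (simp add: divides_prod_r)
          then have "p divides (f \<otimes> g \<ominus> (f \<ominus> f') \<otimes> g)" 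
            by (intro divides_minus[OF pB _ _ less.prems(3)]) (use f' B in auto)
          moreover have "f \<otimes> g \<ominus> (f \<ominus> f') \<otimes> g = f' \<otimes> g" using f' B by algebra
          ultimately have "p divides f' \<or> p divides g" 
            using less.hyps[OF _ f'(1) B(2)] f'(2) by simp
          moreover have "f = f' \<oplus> (f \<ominus> f')" using f' B by algebra
          ultimately show ?thesis
            using divides_add[OF pB f'(1) minus_closed[OF B(1) f'(1)] _ f'(3)] by auto
        next
          case 2
          then obtain g' where g': "g' \<in> carrier B" "card {k. cf g' k \<noteq> \<zero>} < card {k. cf g k \<noteq> \<zero>}"
            "p divides (g \<ominus> g')" using red[OF B(2) _ 2] False by blast
          have pB: "p \<in> carrier B" using p by simp
          have "p divides f \<otimes> (g \<ominus> g')" using g' B p by (simp add: divides_prod_l)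
          then have "p divides (f \<otimes> g \<ominus> f \<otimes> (g \<ominus> g'))" 
            by (intro divides_minus[OF pB _ _ less.prems(3)]) (use g' B in auto)
          moreover have "f \<otimes> g \<ominus> f \<otimes> (g \<ominus> g') = f \<otimes> g'" using g' B by algebra
          ultimately have "p divides f \<or> p divides g'" 
            using less.hyps[OF _ B(1) g'(1)] g'(2) by simp
          moreover have "g = g' \<oplus> (g \<ominus> g')" using g' B by algebra
          ultimately show ?thesis
            using divides_add[OF pB g'(1) minus_closed[OF B(2) g'(1)] _ g'(3)] by auto
        qed
      qed
    qed
  qed
qed

lemma prime_product_lift: "prime_product A n a \<Longrightarrow> prime_product B n a"
  by (induction rule: prime_product.induct) (auto intro!: prime_product.intros Units_A_B prime_lift)

text \<open>Stands for content one. Testing against primes of \<open>A\<close> avoids greatest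
  common divisors of coefficients.\<close>

definition primitive :: "'a \<Rightarrow> bool" where
  "primitive f \<longleftrightarrow> f \<in> carrier B \<and> f \<noteq> \<zero> \<and> (\<forall>p\<in>carrier A. ring_prime\<^bsub>A\<^esub> p \<longrightarrow> \<not> p divides f)"

text \<open>The primes of \<open>c\<close> are removed one at a time: each is prime in
  \<open>B\<close>, does not divide the primitive \<open>e\<close>, and therefore divides
  \<open>y\<close>. This plays the part of inverting constants in the fraction field of
  \<open>A\<close>.\<close>

lemma primitive_cancel:
  assumes "primitive e" "prime_product A n c" "x \<in> carrier B" "y \<in> carrier B" "c \<otimes> x = y \<otimes> e"
  shows "e divides x"
  using assms(2-)
proof (induction arbitrary: y rule: prime_product.induct)
  case (unit u)
  have e: "e \<in> carrier B" using assms(1) by (simp add: primitive_def)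
  have u: "u \<in> Units B" using unit Units_A_B by blast
  have "x = inv u \<otimes> (u \<otimes> x)"
    using u unit.prems by (metis Units_closed Units_inv_closed Units_l_inv l_one m_assoc)
  also have "\<dots> = e \<otimes> (inv u \<otimes> y)" using u unit e by (simp add: m_ac)
  finally show ?case using u unit e by (metis Units_inv_closed dividesI m_closed)
next
  case (mult p n c)
  have e: "e \<in> carrier B" using assms(1) by (simp add: primitive_def)
  have c: "c \<in> carrier A" using A.prime_product_closed mult.hyps(3) by blast
  have p: "ring_prime p" "p \<in> carrier B" "p \<noteq> \<zero>" using prime_lift mult.hyps ring_primeD(1) by auto
  have "p \<otimes> (c \<otimes> x) = y \<otimes> e" using mult.prems mult.hyps c by (simp add: m_assoc)
  then have "p divides y \<otimes> e" using mult.hyps mult.prems c by (metis A_B dividesI m_closed)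
  moreover have "\<not> p divides e" using assms(1) mult.hyps by (simp add: primitive_def)
  ultimately have "p divides y" using ring_primeD(3)[OF p(1)] e mult.prems by blast
  then obtain y' where y': "y' \<in> carrier B" "y = p \<otimes> y'" by (auto elim: dividesE)
  have "p \<otimes> (c \<otimes> x) = p \<otimes> (y' \<otimes> e)"
    using \<open>p \<otimes> (c \<otimes> x) = y \<otimes> e\<close> y' e p by (simp add: m_assoc)
  then have "c \<otimes> x = y' \<otimes> e" using p y' e c mult.prems by (simp add: m_lcancel)
  then show ?case using mult.IH mult.prems y' by blast
qed

text \<open>Division with remainder needs the extreme coefficient of \<open>e\<close> to be
  invertible; instead \<open>h\<close> is multiplied by it. The elimination proceeds from the lowest
  terms, and the constants accumulate in \<open>c\<close>.\<close>

lemma pseudo_division: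
  assumes e: "e \<in> carrier B" "e \<noteq> \<zero>" and "h \<in> carrier B"
  shows "\<exists>c\<in>carrier A - {\<zero>}. \<exists>q\<in>carrier B.
           c \<otimes> h \<ominus> q \<otimes> e = \<zero> \<or> width (c \<otimes> h \<ominus> q \<otimes> e) < width e"
  using assms(3)
proof (induction "width h" arbitrary: h rule: less_induct)
  case less
  note h = less.prems
  show ?case
  proof (cases "h = \<zero> \<or> width h < width e")
    case True
    have "\<one> \<otimes> h \<ominus> \<zero> \<otimes> e = h" using e h by (simp add: diff_zero)
    then show ?thesis using True A.one_closed by (intro bexI[of _ \<one>] bexI[of _ \<zero>]) auto
  next
    case False
    \<comment> \<open>The shift that aligns the lowest terms of \<open>e\<close> and
      \<open>h\<close>.\<close>
    define k where "k = lo h - lo e"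
    define a where "a = cf e (lo e)"
    define b where "b = cf h (lo h)"
    have ab: "a \<in> carrier A" "b \<in> carrier A" "a \<noteq> \<zero>" "b \<noteq> \<zero>"
      using e h False lo_hi by (auto simp: a_def b_def)
    define h' where "h' = a \<otimes> h \<ominus> b \<otimes> T k \<otimes> e"
    have h': "h' \<in> carrier B" using ab e h by (simp add: h'_def)
    have cf': "cf h' n = a \<otimes> cf h n \<ominus> b \<otimes> cf e (n - k)" for n
      using ab e h by (simp add: h'_def cf_diff cf_const_mult cf_mono_mult)
    have low: "cf h' n = \<zero>" if "n \<le> lo h" for n
    proof (cases "n = lo h")
      case True
      have "cf h' n = a \<otimes> b \<ominus> b \<otimes> a" using cf'[of n] True by (simp add: k_def a_def b_def)
      then show ?thesis using ab by (simp add: m_comm diff_self)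
    next
      case False
      then show ?thesis using that cf'[of n] lo_hi(3) h e ab \<open>\<not> (h = \<zero> \<or> _)\<close>
        by (simp add: k_def minus_eq)
    qed
    \<comment> \<open>This restates \<open>width e \<le> width h\<close>. The subtraction thus does
      not raise the top exponent while it removes the lowest, so the width drops.\<close>
    have "hi e + k \<le> hi h"
      using False lo_hi(5)[OF e] lo_hi(5)[OF h] by (auto simp: k_def width_def)
    then have high: "cf h' n = \<zero>" if "n > hi h" for n
      using that cf'[of n] lo_hi(4) h e ab False by (simp add: diff_zero)
    have "\<exists>c\<in>carrier A - {\<zero>}. \<exists>q\<in>carrier B.
           c \<otimes> h' \<ominus> q \<otimes> e = \<zero> \<or> width (c \<otimes> h' \<ominus> q \<otimes> e) < width e"
    proof (cases "h' = \<zero>")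
      case True
      then have "\<one> \<otimes> h' \<ominus> \<zero> \<otimes> e = \<zero>" using e by (simp add: diff_zero)
      then show ?thesis using A.one_closed by (intro bexI[of _ \<one>] bexI[of _ \<zero>]) auto
    next
      case nz: False
      have "lo h < lo h'" using low lo_hi(1)[OF h' nz] by (meson linorder_not_le)
      moreover have "hi h' \<le> hi h" using high lo_hi(2)[OF h' nz] by (meson linorder_not_le)
      ultimately have "width h' < width h" using lo_hi(5)[OF h' nz] by (simp add: width_def)
      then show ?thesis using less.hyps h' by blast
    qed
    then obtain c q where cq: "c \<in> carrier A" "c \<noteq> \<zero>" "q \<in> carrier B"
      "c \<otimes> h' \<ominus> q \<otimes> e = \<zero> \<or> width (c \<otimes> h' \<ominus> q \<otimes> e) < width e" by blast
    have "c \<otimes> h' \<ominus> q \<otimes> e = (c \<otimes> a) \<otimes> h \<ominus> (c \<otimes> b \<otimes> T k \<oplus> q) \<otimes> e"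
    proof -
      have "c \<in> carrier B" "a \<in> carrier B" "b \<in> carrier B" "T k \<in> carrier B" using cq ab by auto
      then show ?thesis unfolding h'_def using cq(3) e(1) h by algebra
    qed
    moreover have "c \<otimes> a \<in> carrier A" "c \<otimes> a \<noteq> \<zero>"
      using cq ab A.m_closed[of c a] by (auto simp: integral_iff)
    moreover have "c \<otimes> b \<otimes> T k \<oplus> q \<in> carrier B" using cq ab by auto
    ultimately show ?thesis using cq(4)
      by (intro bexI[of _ "c \<otimes> a"] bexI[of _ "c \<otimes> b \<otimes> T k \<oplus> q"]) auto
  qed
qed

context
  assumes A_pp: "\<And>a. \<lbrakk>a \<in> carrier A; a \<noteq> \<zero>\<rbrakk> \<Longrightarrow> \<exists>n. prime_product A n a"
begin

text \<open>One nonzero coefficient, at a fixed exponent \<open>k\<close>, bounds the process: every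
  prime divided out of \<open>f\<close> is divided out of that coefficient too, which consists of
  finitely many primes.\<close>

lemma primitive_part:
  assumes "f \<in> carrier B" "f \<noteq> \<zero>"
  shows "\<exists>n a f'. prime_product A n a \<and> primitive f' \<and> f = a \<otimes> f'"
proof -
  define k where "k = lo f"
  have "cf f k \<in> carrier A" "cf f k \<noteq> \<zero>" using assms lo_hi(1) by (simp_all add: k_def)
  then obtain n where "prime_product A n (cf f k)" using A_pp by blast
  then show ?thesis using assms
  proof (induction n arbitrary: f rule: less_induct)
    case (less n)
    show ?case
    proof (cases "primitive f")
      case True
      have "prime_product A 0 \<one>" by (metis A.Units_one_closed A_ops(2) prime_product.unit)
      then show ?thesis using True less.prems by force
    next
      case False
      then obtain p where p: "p \<in> carrier A" "ring_prime\<^bsub>A\<^esub> p" "p divides f"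
        using less.prems by (auto simp: primitive_def)
      then obtain g where g: "g \<in> carrier B" "f = p \<otimes> g" by (auto elim: dividesE)
      then have "cf f k = p \<otimes>\<^bsub>A\<^esub> cf g k" using p by (simp add: cf_const_mult)
      then obtain m where m: "n = Suc m" "prime_product A m (cf g k)"
        using A.prime_product_cancel[OF less.prems(1) p(1,2) cf_closed[OF g(1)]] by blast
      have "g \<noteq> \<zero>" using g(2) less.prems(3) p(1) by auto
      moreover have "m < n" using m(1) by simp
      ultimately obtain n' a f' where af: "prime_product A n' a" "primitive f'" "g = a \<otimes> f'"
        using less.IH[OF _ m(2) g(1)] by blast
      have "f = (p \<otimes> a) \<otimes> f'"
        using g af p A.prime_product_closed[OF af(1)] by (simp add: primitive_def m_assoc)
      then show ?thesis using prime_product.mult[OF p(1,2) af(1)] af(2) by auto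
    qed
  qed
qed

text \<open>Over the fraction field of \<open>A\<close> one would use that Laurent polynomials in
  one variable form a principal ideal domain. Here an element \<open>e\<close> of least width in the
  ideal \<open>(f, h)\<close> replaces the generator, pseudo-division replaces division, and
  \<open>primitive_cancel\<close> removes the constants.\<close>

lemma primitive_irreducible_prime:
  assumes f: "primitive f" and nu: "f \<notin> Units B"
    and irr: "\<And>g h. \<lbrakk>g \<in> carrier B; h \<in> carrier B; f = g \<otimes> h\<rbrakk> \<Longrightarrow> g \<in> Units B \<or> h \<in> Units B"
  shows "ring_prime f"
proof (rule ring_primeI)
  have fB: "f \<in> carrier B" "f \<noteq> \<zero>" using f by (auto simp: primitive_def)
  show "f \<noteq> \<zero>" by fact
  show "prime B f"
  proof (rule primeI[OF nu])
    fix g h assume gh: "g \<in> carrier B" "h \<in> carrier B" "f divides g \<otimes> h"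
    show "f divides g \<or> f divides h"
    proof (rule disjCI)
      assume nh: "\<not> f divides h"
      \<comment> \<open>The nonzero elements of the ideal generated by \<open>f\<close> and
        \<open>h\<close>.\<close>
      define S where "S = {s. s \<noteq> \<zero> \<and> (\<exists>u\<in>carrier B. \<exists>v\<in>carrier B. s = u \<otimes> f \<oplus> v \<otimes> h)}"
      have SI: "s \<in> S" if "s = x \<otimes> f \<oplus> y \<otimes> h" "x \<in> carrier B" "y \<in> carrier B" "s \<noteq> \<zero>" for s x y
        using that unfolding S_def by blast
      have "f \<in> S" using fB gh by (intro SI[of f \<one> \<zero>]) auto
      then obtain e where e: "e \<in> S" and min: "\<And>s. s \<in> S \<Longrightarrow> width e \<le> width s"
        using ex_has_least_nat[of "\<lambda>s. s \<in> S" f width] by blast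
      obtain u v where uv: "u \<in> carrier B" "v \<in> carrier B" "e = u \<otimes> f \<oplus> v \<otimes> h" "e \<noteq> \<zero>"
        using e by (auto simp: S_def)
      have eB: "e \<in> carrier B" using uv fB gh by simp
      obtain n a e' where e': "prime_product A n a" "primitive e'" "e = a \<otimes> e'"
        using primitive_part eB uv(4) by blast
      have a: "a \<in> carrier A" "a \<noteq> \<zero>"
        using A.prime_product_closed[OF e'(1)] A.prime_product_nonzero[OF e'(1)] by auto
      have e'B: "e' \<in> carrier B" using e' by (simp add: primitive_def)
      \<comment> \<open>Minimality of \<open>width e\<close> kills the pseudo-remainder, so a
        constant multiple of \<open>x\<close> is a multiple of \<open>e\<close>, and the constant
        cancels against the primitive \<open>e'\<close>.\<close>
      have dv: "e' divides x" if x: "x \<in> carrier B"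
        and lin: "\<And>c q. \<lbrakk>c \<in> carrier A; q \<in> carrier B; c \<otimes> x \<ominus> q \<otimes> e \<noteq> \<zero>\<rbrakk> \<Longrightarrow> c \<otimes> x \<ominus> q \<otimes> e \<in> S" for x
      proof -
        obtain c q where cq: "c \<in> carrier A" "c \<noteq> \<zero>" "q \<in> carrier B"
            "c \<otimes> x \<ominus> q \<otimes> e = \<zero> \<or> width (c \<otimes> x \<ominus> q \<otimes> e) < width e"
          using pseudo_division[OF eB uv(4) x] by blast
        then have "c \<otimes> x \<ominus> q \<otimes> e = \<zero>" using lin min by (meson leD)
        then have "c \<otimes> x = (q \<otimes> a) \<otimes> e'"
          using cq x eB e' a e'B by (simp add: m_assoc)
        moreover obtain m where "prime_product A m c" using A_pp cq by blast
        ultimately show ?thesis using primitive_cancel e'(2) x cq a by blast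
      qed
      have "e' divides f"
      proof (rule dv[OF fB(1)])
        fix c q assume cq: "c \<in> carrier A" "q \<in> carrier B" "c \<otimes> f \<ominus> q \<otimes> e \<noteq> \<zero>"
        have "c \<in> carrier B" using cq by simp
        then have "c \<otimes> f \<ominus> q \<otimes> e = (c \<ominus> q \<otimes> u) \<otimes> f \<oplus> (\<ominus> (q \<otimes> v)) \<otimes> h"
          unfolding uv(3) using cq uv(1,2) fB gh by algebra
        then show "c \<otimes> f \<ominus> q \<otimes> e \<in> S"
          by (rule SI) (use cq uv(1,2) \<open>c \<in> carrier B\<close> in auto)
      qed
      moreover have "e' divides h"
      proof (rule dv[OF gh(2)])
        fix c q assume cq: "c \<in> carrier A" "q \<in> carrier B" "c \<otimes> h \<ominus> q \<otimes> e \<noteq> \<zero>"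
        have "c \<in> carrier B" using cq by simp
        then have "c \<otimes> h \<ominus> q \<otimes> e = (\<ominus> (q \<otimes> u)) \<otimes> f \<oplus> (c \<ominus> q \<otimes> v) \<otimes> h"
          unfolding uv(3) using cq uv(1,2) fB gh by algebra
        then show "c \<otimes> h \<ominus> q \<otimes> e \<in> S"
          by (rule SI) (use cq uv(1,2) \<open>c \<in> carrier B\<close> in auto)
      qed
      ultimately obtain y z where yz: "y \<in> carrier B" "f = e' \<otimes> y" "z \<in> carrier B" "h = e' \<otimes> z"
        by (auto elim!: dividesE)
      \<comment> \<open>If \<open>y\<close> were a unit, \<open>f\<close> would be associated to
        \<open>e'\<close> and would divide \<open>h\<close>. Irreducibility then makes
        \<open>e'\<close> a unit, so the ideal \<open>(f, h)\<close> contains the nonzero constant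
        \<open>a\<close>.\<close>
      have "y \<notin> Units B"
      proof
        assume y: "y \<in> Units B"
        have "f \<otimes> (inv y \<otimes> z) = e' \<otimes> (y \<otimes> (inv y \<otimes> z))" using y yz e'B by (simp add: m_assoc)
        then have "f \<otimes> (inv y \<otimes> z) = h" using y yz by (simp add: Units_mult_inv)
        then show False using nh y yz by (metis Units_inv_closed dividesI m_closed)
      qed
      then have e'u: "e' \<in> Units B" using irr[OF e'B yz(1,2)] by blast
      \<comment> \<open>A Bezout identity for the constant \<open>a\<close>, multiplied by
        \<open>g\<close>; the right-hand side becomes a multiple of \<open>f\<close> because
        \<open>f\<close> divides \<open>g \<otimes> h\<close>.\<close>
      have "a \<otimes> g = (a \<otimes> e') \<otimes> (inv e' \<otimes> g)"
        using Units_mult_inv[OF e'u gh(1)] m_assoc[of a e' "inv e' \<otimes> g"] e'B e'u a gh(1) by simp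
      also have "\<dots> = (u \<otimes> f \<oplus> v \<otimes> h) \<otimes> (inv e' \<otimes> g)" using e'(3) uv(3) by simp
      also have "\<dots> = inv e' \<otimes> ((u \<otimes> g) \<otimes> f \<oplus> v \<otimes> (g \<otimes> h))"
      proof -
        have "inv e' \<in> carrier B" using e'u by simp
        then show ?thesis using uv(1,2) fB gh by algebra
      qed
      finally have eq: "a \<otimes> g = inv e' \<otimes> ((u \<otimes> g) \<otimes> f \<oplus> v \<otimes> (g \<otimes> h))" .
      obtain x where x: "x \<in> carrier B" "g \<otimes> h = f \<otimes> x" using gh by (auto elim: dividesE)
      have ie: "inv e' \<in> carrier B" using e'u by simp
      have "a \<otimes> g = (inv e' \<otimes> (u \<otimes> g \<oplus> v \<otimes> x)) \<otimes> f"
        unfolding eq x(2) using ie uv(1,2) fB gh(1) x(1) by algebra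
      moreover have "inv e' \<otimes> (u \<otimes> g \<oplus> v \<otimes> x) \<in> carrier B" using ie uv gh x by simp
      ultimately show "f divides g" using primitive_cancel[OF f e'(1) gh(1)] by blast
    qed
  qed
qed

text \<open>Induction on the width. The constant part of \<open>f\<close> factors in
  \<open>A\<close>, where primes stay prime in \<open>B\<close>; the primitive part either splits
  into narrower factors or is irreducible, hence prime.\<close>

theorem laurent_prime_product:
  assumes "f \<in> carrier B" "f \<noteq> \<zero>"
  shows "\<exists>n. prime_product B n f"
  using assms
proof (induction "width f" arbitrary: f rule: less_induct)
  case less
  obtain n a f' where f': "prime_product A n a" "primitive f'" "f = a \<otimes> f'"
    using primitive_part less.prems by blast
  have a: "a \<in> carrier A" "a \<noteq> \<zero>"
    using A.prime_product_closed[OF f'(1)] A.prime_product_nonzero[OF f'(1)] by auto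
  have f'B: "f' \<in> carrier B" "f' \<noteq> \<zero>" using f' by (auto simp: primitive_def)
  have w: "width f = width f'" using f' a f'B by (simp add: width_mult width_const)
  \<comment> \<open>A factor of width zero is a constant times a power of \<open>t\<close>; a prime
    occurring in the constant would divide the primitive \<open>f'\<close>.\<close>
  have unit: "g \<in> Units B" if g: "g \<in> carrier B" "h \<in> carrier B" "f' = g \<otimes> h" "width g = 0" for g h
  proof -
    have "g \<noteq> \<zero>" using g f'B by auto
    define c where "c = cf g (lo g)"
    have c: "c \<in> carrier A" "c \<noteq> \<zero>" using lo_hi(1)[OF g(1) \<open>g \<noteq> \<zero>\<close>] g by (auto simp: c_def)
    have gc: "g = c \<otimes> T (lo g)" using width_zero_mono[OF g(1) \<open>g \<noteq> \<zero>\<close> g(4)] by (simp add: c_def)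
    obtain m where "prime_product A m c" using A_pp c by blast
    then have "c \<in> Units A"
    proof cases
      case (mult p k d)
      have d: "d \<in> carrier B" using mult A.prime_product_closed by blast
      have "f' = (c \<otimes> T (lo g)) \<otimes> h" using g(3) by (subst gc[symmetric])
      also have "\<dots> = p \<otimes> (d \<otimes> (T (lo g) \<otimes> h))"
        using mult d g(2) by (simp add: m_assoc)
      finally have "f' = p \<otimes> (d \<otimes> (T (lo g) \<otimes> h))" .
      then have "p divides f'" using mult d g by (metis T_closed dividesI m_closed)
      then show ?thesis using f'(2) mult by (auto simp: primitive_def)
    qed
    then show ?thesis using gc T_Units Units_A_B by (metis Units_m_closed)
  qed
  \<comment> \<open>Two factors of positive width are both narrower than \<open>f\<close>. If no
    such splitting exists, every factorisation contains a factor of width zero, which is a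
    unit.\<close>
  have "\<exists>n. prime_product B n f'"
  proof (cases "\<exists>g\<in>carrier B. \<exists>h\<in>carrier B. f' = g \<otimes> h \<and> width g \<noteq> 0 \<and> width h \<noteq> 0")
    case True
    then obtain g h where gh: "g \<in> carrier B" "h \<in> carrier B" "f' = g \<otimes> h" "width g \<noteq> 0" "width h \<noteq> 0"
      by blast
    then have nz: "g \<noteq> \<zero>" "h \<noteq> \<zero>" using f'B by auto
    then have "width g < width f" "width h < width f" using w gh width_mult by auto
    then obtain i j where "prime_product B i g" "prime_product B j h" using less.hyps gh nz by metis
    then show ?thesis using prime_product_mult gh by blast
  next
    case False
    have irr: "g \<in> Units B \<or> h \<in> Units B" if "g \<in> carrier B" "h \<in> carrier B" "f' = g \<otimes> h" for g h
      using False unit[of g h] unit[of h g] that m_comm by metis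
    show ?thesis
    proof (cases "f' \<in> Units B")
      case True
      then show ?thesis by (blast intro: prime_product.unit)
    next
      case False
      have "ring_prime f'" by (rule primitive_irreducible_prime[OF f'(2) False irr])
      then have "prime_product B (Suc 0) (f' \<otimes> \<one>)"
        using prime_product.mult[OF f'B(1) _ prime_product.unit[OF Units_one_closed]] by blast
      then show ?thesis using f'B(1) by auto
    qed
  qed
  then obtain m where "prime_product B m f'" by blast
  then have "prime_product B (n + m) (a \<otimes> f')"
    by (rule prime_product_mult[OF prime_product_lift[OF f'(1)]])
  then show ?case using f'(3) by blast
qed

end

end

section \<open>Laurent polynomials and Gauss valuations\<close>

text \<open>Laurent polynomials in all variables at once, with no bound on the indices. The
  convolution laws are proved here once and then serve for every number \<open>r\<close> of
  variables.\<close>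

definition finite_support :: "('k, 'm) ring_scheme \<Rightarrow> ((nat \<Rightarrow>\<^sub>0 int) \<Rightarrow> 'k) set" where
  "finite_support K = {f. (\<forall>n. f n \<in> carrier K) \<and> finite {n. f n \<noteq> \<zero>\<^bsub>K\<^esub>}}"

definition laurent_mult ::
    "('k, 'm) ring_scheme \<Rightarrow> ((nat \<Rightarrow>\<^sub>0 int) \<Rightarrow> 'k) \<Rightarrow> ((nat \<Rightarrow>\<^sub>0 int) \<Rightarrow> 'k) \<Rightarrow> (nat \<Rightarrow>\<^sub>0 int) \<Rightarrow> 'k" where
  "laurent_mult K f g = (\<lambda>n. \<Oplus>\<^bsub>K\<^esub>m\<in>{m. f m \<noteq> \<zero>\<^bsub>K\<^esub>}. f m \<otimes>\<^bsub>K\<^esub> g (n - m))"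

definition monomial :: "('k, 'm) ring_scheme \<Rightarrow> 'k \<Rightarrow> (nat \<Rightarrow>\<^sub>0 int) \<Rightarrow> (nat \<Rightarrow>\<^sub>0 int) \<Rightarrow> 'k" where
  "monomial K c m = (\<lambda>n. if n = m then c else \<zero>\<^bsub>K\<^esub>)"

lemma laurent_ring_simps:
  "monoid.mult (laurent_ring K r) = laurent_mult K"
  "\<one>\<^bsub>laurent_ring K r\<^esub> = monomial K \<one>\<^bsub>K\<^esub> 0"
  "\<zero>\<^bsub>laurent_ring K r\<^esub> = (\<lambda>n. \<zero>\<^bsub>K\<^esub>)"
  "f \<oplus>\<^bsub>laurent_ring K r\<^esub> g = (\<lambda>n. f n \<oplus>\<^bsub>K\<^esub> g n)"
  by (simp_all add: laurent_ring_def laurent_mult_def monomial_def fun_eq_iff)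

lemma laurent_ring_carrier:
  "f \<in> carrier (laurent_ring K r) \<longleftrightarrow>
     f \<in> finite_support K \<and> (\<forall>n. f n \<noteq> \<zero>\<^bsub>K\<^esub> \<longrightarrow> Poly_Mapping.keys n \<subseteq> {1..r})"
  by (auto simp: laurent_ring_def finite_support_def)

context cring
begin

abbreviation "FS \<equiv> finite_support R"
abbreviation "mnm \<equiv> monomial R"
abbreviation "conv \<equiv> laurent_mult R"

lemma FS_I: "\<lbrakk>\<And>n. f n \<in> carrier R; finite {n. f n \<noteq> \<zero>}\<rbrakk> \<Longrightarrow> f \<in> FS"
  by (simp add: finite_support_def)

lemma FS_finite [simp]: "f \<in> FS \<Longrightarrow> finite {n. f n \<noteq> \<zero>}"
  unfolding finite_support_def by blast

lemma FS_closed [simp]: "f \<in> FS \<Longrightarrow> f n \<in> carrier R"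
  unfolding finite_support_def by blast

lemma FS_subset:
  "\<lbrakk>\<And>n. f n \<in> carrier R; finite A; {n. f n \<noteq> \<zero>} \<subseteq> A\<rbrakk> \<Longrightarrow> f \<in> FS"
  by (rule FS_I) (auto intro: finite_subset)

lemma FS_zero [simp]: "(\<lambda>n. \<zero>) \<in> FS"
  by (rule FS_I) auto

lemma FS_mono [simp]: "c \<in> carrier R \<Longrightarrow> mnm c m \<in> FS"
  by (rule FS_subset[of _ "{m}"]) (auto simp: monomial_def)

lemma FS_add [simp]: "\<lbrakk>f \<in> FS; g \<in> FS\<rbrakk> \<Longrightarrow> (\<lambda>n. f n \<oplus> g n) \<in> FS"
  by (rule FS_subset[of _ "{n. f n \<noteq> \<zero>} \<union> {n. g n \<noteq> \<zero>}"]) auto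

lemma FS_minus [simp]: "f \<in> FS \<Longrightarrow> (\<lambda>n. \<ominus> f n) \<in> FS"
  by (rule FS_subset[of _ "{n. f n \<noteq> \<zero>}"]) auto

lemma FS_shift [simp]:
  assumes "f \<in> FS" "c \<in> carrier R" shows "(\<lambda>n. c \<otimes> f (n - m)) \<in> FS"
proof (rule FS_subset)
  show "{n. c \<otimes> f (n - m) \<noteq> \<zero>} \<subseteq> (\<lambda>k. k + m) ` {n. f n \<noteq> \<zero>}"
  proof
    fix n assume "n \<in> {n. c \<otimes> f (n - m) \<noteq> \<zero>}"
    then have "n - m \<in> {n. f n \<noteq> \<zero>}" using assms by auto
    then show "n \<in> (\<lambda>k. k + m) ` {n. f n \<noteq> \<zero>}" by (intro image_eqI[of _ _ "n - m"]) auto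
  qed
qed (use assms in auto)

text \<open>Builds \<open>f\<close> one monomial at a time; the laws of convolution then reduce to
  multiplication by a monomial, which is a shift.\<close>

lemma FS_induct [consumes 1, case_names zero add]:
  assumes "f \<in> FS" "P (\<lambda>n. \<zero>)"
    and step: "\<And>c m f. \<lbrakk>c \<in> carrier R; f \<in> FS; P f\<rbrakk> \<Longrightarrow> P (\<lambda>n. mnm c m n \<oplus> f n)"
  shows "P f"
  using assms(1)
proof (induction "card {n. f n \<noteq> \<zero>}" arbitrary: f rule: less_induct)
  case less
  show ?case
  proof (cases "\<exists>m. f m \<noteq> \<zero>")
    case False
    then have "f = (\<lambda>n. \<zero>)" by auto
    then show ?thesis using assms(2) by simp
  next
    case True
    then obtain m where m: "f m \<noteq> \<zero>" by blast
    define f' where "f' = f(m := \<zero>)"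
    have sub: "{n. f' n \<noteq> \<zero>} \<subset> {n. f n \<noteq> \<zero>}" using m by (auto simp: f'_def)
    have f': "f' \<in> FS"
      by (rule FS_subset[OF _ FS_finite[OF less.prems] psubset_imp_subset[OF sub]])
        (use less.prems in \<open>simp add: f'_def\<close>)
    have "P f'" using less.hyps[OF psubset_card_mono[OF _ sub] f'] less.prems by simp
    then have "P (\<lambda>n. mnm (f m) m n \<oplus> f' n)" using step f' less.prems by simp
    moreover have "(\<lambda>n. mnm (f m) m n \<oplus> f' n) = f"
      using less.prems by (auto simp: monomial_def f'_def)
    ultimately show ?thesis by simp
  qed
qed

lemma conv_superset:
  assumes "f \<in> FS" "g \<in> FS" "finite F" "{m. f m \<noteq> \<zero>} \<subseteq> F"
  shows "conv f g n = (\<Oplus>m\<in>F. f m \<otimes> g (n - m))"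
  unfolding laurent_mult_def
  by (rule add.finprod_mono_neutral_cong_left) (use assms in auto)

lemma conv_closed [simp]: "\<lbrakk>f \<in> FS; g \<in> FS\<rbrakk> \<Longrightarrow> conv f g n \<in> carrier R"
  unfolding laurent_mult_def by (rule finsum_closed) auto

lemma conv_zero [simp]: "g \<in> FS \<Longrightarrow> conv (\<lambda>n. \<zero>) g n = \<zero>"
  by (simp add: laurent_mult_def)

lemma conv_zero_right [simp]: "f \<in> FS \<Longrightarrow> conv f (\<lambda>n. \<zero>) n = \<zero>"
  unfolding laurent_mult_def by (rule add.finprod_one_eqI) auto

lemma conv_mono [simp]:
  assumes "g \<in> FS" "c \<in> carrier R" shows "conv (mnm c m) g n = c \<otimes> g (n - m)"
proof -
  have "conv (mnm c m) g n = (\<Oplus>k\<in>{m}. mnm c m k \<otimes> g (n - k))"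
    by (rule conv_superset[OF FS_mono[OF assms(2)] assms(1)]) (auto simp: monomial_def)
  then show ?thesis using assms by (simp add: monomial_def)
qed

lemma conv_add:
  assumes "f \<in> FS" "f' \<in> FS" "g \<in> FS"
  shows "conv (\<lambda>n. f n \<oplus> f' n) g n = conv f g n \<oplus> conv f' g n"
proof -
  let ?F = "{n. f n \<noteq> \<zero>} \<union> {n. f' n \<noteq> \<zero>}"
  have F: "finite ?F" using assms by simp
  have "conv (\<lambda>n. f n \<oplus> f' n) g n = (\<Oplus>m\<in>?F. (f m \<oplus> f' m) \<otimes> g (n - m))"
    by (rule conv_superset) (use assms F in auto)
  also have "\<dots> = (\<Oplus>m\<in>?F. f m \<otimes> g (n - m) \<oplus> f' m \<otimes> g (n - m))"
    using assms by (simp add: l_distr)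
  also have "\<dots> = (\<Oplus>m\<in>?F. f m \<otimes> g (n - m)) \<oplus> (\<Oplus>m\<in>?F. f' m \<otimes> g (n - m))"
    by (rule finsum_addf) (use assms in auto)
  also have "\<dots> = conv f g n \<oplus> conv f' g n"
    using conv_superset[OF assms(1,3) F] conv_superset[OF assms(2,3) F] by simp
  finally show ?thesis .
qed

lemma conv_add_right:
  assumes "f \<in> FS" "g \<in> FS" "g' \<in> FS"
  shows "conv f (\<lambda>n. g n \<oplus> g' n) n = conv f g n \<oplus> conv f g' n"
proof -
  have "conv f (\<lambda>n. g n \<oplus> g' n) n = (\<Oplus>m\<in>{m. f m \<noteq> \<zero>}. f m \<otimes> g (n - m) \<oplus> f m \<otimes> g' (n - m))"
    using assms by (simp add: laurent_mult_def r_distr)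
  also have "\<dots> = conv f g n \<oplus> conv f g' n"
    unfolding laurent_mult_def by (rule finsum_addf) (use assms in auto)
  finally show ?thesis .
qed

lemma conv_mono_right:
  assumes "g \<in> FS" "c \<in> carrier R" shows "conv g (mnm c m) n = c \<otimes> g (n - m)"
  using assms(1)
proof (induction g rule: FS_induct)
  case zero
  then show ?case using assms by simp
next
  case (add c' m' g)
  have "conv (\<lambda>n. mnm c' m' n \<oplus> g n) (mnm c m) n = c' \<otimes> mnm c m (n - m') \<oplus> c \<otimes> g (n - m)"
    using add assms by (simp add: conv_add)
  moreover have "c' \<otimes> mnm c m (n - m') = c \<otimes> mnm c' m' (n - m)"
    using add assms by (auto simp: monomial_def m_comm algebra_simps)
  ultimately show ?case using add assms by (simp add: r_distr)
qed

lemma conv_comm: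
  assumes "f \<in> FS" "g \<in> FS" shows "conv f g n = conv g f n"
  using assms(1)
proof (induction f rule: FS_induct)
  case zero
  then show ?case using assms by simp
next
  case (add c m f)
  then show ?case using assms(2) by (simp add: conv_add conv_add_right conv_mono_right)
qed

lemma conv_shift:
  assumes "g \<in> FS" "h \<in> FS" "c \<in> carrier R"
  shows "conv (\<lambda>n. c \<otimes> g (n - m)) h n = c \<otimes> conv g h (n - m)"
  using assms(1)
proof (induction g rule: FS_induct)
  case zero
  then show ?case using assms by simp
next
  case (add c' m' g)
  have "(\<lambda>n. c \<otimes> (mnm c' m' (n - m) \<oplus> g (n - m))) = (\<lambda>n. mnm (c \<otimes> c') (m + m') n \<oplus> c \<otimes> g (n - m))"
    using add assms by (auto simp: monomial_def r_distr algebra_simps)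
  then have "conv (\<lambda>n. c \<otimes> (mnm c' m' (n - m) \<oplus> g (n - m))) h n
      = (c \<otimes> c') \<otimes> h (n - (m + m')) \<oplus> c \<otimes> conv g h (n - m)"
    using add assms by (simp add: conv_add)
  also have "\<dots> = c \<otimes> (c' \<otimes> h (n - m - m') \<oplus> conv g h (n - m))"
    using add assms by (simp add: m_assoc r_distr diff_diff_eq)
  also have "\<dots> = c \<otimes> conv (\<lambda>n. mnm c' m' n \<oplus> g n) h (n - m)"
    using add assms by (simp add: conv_add)
  finally show ?case .
qed

lemma FS_conv [simp]: assumes "f \<in> FS" "g \<in> FS" shows "conv f g \<in> FS"
  using assms(1)
proof (induction f rule: FS_induct)
  case zero
  have "conv (\<lambda>n. \<zero>) g = (\<lambda>n. \<zero>)" using assms by auto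
  then show ?case by simp
next
  case (add c m f)
  have "conv (\<lambda>n. mnm c m n \<oplus> f n) g = (\<lambda>n. c \<otimes> g (n - m) \<oplus> conv f g n)"
    using add assms by (auto simp: conv_add)
  then show ?case using add assms by simp
qed

lemma conv_assoc:
  assumes "f \<in> FS" "g \<in> FS" "h \<in> FS"
  shows "conv (conv f g) h n = conv f (conv g h) n"
  using assms(1)
proof (induction f rule: FS_induct)
  case zero
  have "conv (\<lambda>n. \<zero>) g = (\<lambda>n. \<zero>)" using assms by auto
  then show ?case using assms by simp
next
  case (add c m f)
  have "conv (\<lambda>n. mnm c m n \<oplus> f n) g = (\<lambda>n. c \<otimes> g (n - m) \<oplus> conv f g n)"
    using add assms by (auto simp: conv_add)
  then show ?case using add assms by (simp add: conv_add conv_shift)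
qed

lemma conv_nonzeroD:
  assumes "f \<in> FS" "g \<in> FS" "conv f g n \<noteq> \<zero>"
  shows "\<exists>m. f m \<noteq> \<zero> \<and> g (n - m) \<noteq> \<zero>"
proof (rule ccontr)
  assume "\<not> ?thesis"
  then have "conv f g n = \<zero>"
    unfolding laurent_mult_def using assms by (intro add.finprod_one_eqI) auto
  then show False using assms by simp
qed

lemma cring_laurent_ring: "cring (laurent_ring R r)"
proof (rule cringI)
  show "abelian_group (laurent_ring R r)"
  proof (rule abelian_groupI; unfold laurent_ring_simps laurent_ring_carrier)
    fix f g assume fg: "f \<in> FS \<and> (\<forall>n. f n \<noteq> \<zero> \<longrightarrow> Poly_Mapping.keys n \<subseteq> {1..r})"
      "g \<in> FS \<and> (\<forall>n. g n \<noteq> \<zero> \<longrightarrow> Poly_Mapping.keys n \<subseteq> {1..r})"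
    show "(\<lambda>n. f n \<oplus> g n) \<in> FS \<and> (\<forall>n. f n \<oplus> g n \<noteq> \<zero> \<longrightarrow> Poly_Mapping.keys n \<subseteq> {1..r})"
    proof (intro conjI allI impI)
      show "(\<lambda>n. f n \<oplus> g n) \<in> FS" using fg by simp
      fix n assume "f n \<oplus> g n \<noteq> \<zero>"
      then have "f n \<noteq> \<zero> \<or> g n \<noteq> \<zero>" by auto
      then show "Poly_Mapping.keys n \<subseteq> {1..r}" using fg by blast
    qed
  next
    fix f assume f: "f \<in> FS \<and> (\<forall>n. f n \<noteq> \<zero> \<longrightarrow> Poly_Mapping.keys n \<subseteq> {1..r})"
    then show "\<exists>g\<in>carrier (laurent_ring R r). (\<lambda>n. g n \<oplus> f n) = (\<lambda>n. \<zero>)"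
      by (intro bexI[of _ "\<lambda>n. \<ominus> f n"]) (auto simp: laurent_ring_carrier l_neg)
  qed (auto simp: a_ac)
  show "Group.comm_monoid (laurent_ring R r)"
  proof (rule comm_monoidI; unfold laurent_ring_simps laurent_ring_carrier)
    fix f g assume fg: "f \<in> FS \<and> (\<forall>n. f n \<noteq> \<zero> \<longrightarrow> Poly_Mapping.keys n \<subseteq> {1..r})"
      "g \<in> FS \<and> (\<forall>n. g n \<noteq> \<zero> \<longrightarrow> Poly_Mapping.keys n \<subseteq> {1..r})"
    show "conv f g \<in> FS \<and> (\<forall>n. conv f g n \<noteq> \<zero> \<longrightarrow> Poly_Mapping.keys n \<subseteq> {1..r})"
    proof (intro conjI allI impI)
      show "conv f g \<in> FS" using fg by simp
      fix n assume "conv f g n \<noteq> \<zero>"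
      then obtain m where "f m \<noteq> \<zero>" "g (n - m) \<noteq> \<zero>" using conv_nonzeroD fg by blast
      then have "Poly_Mapping.keys m \<subseteq> {1..r}" "Poly_Mapping.keys (n - m) \<subseteq> {1..r}" using fg by auto
      then show "Poly_Mapping.keys n \<subseteq> {1..r}" using keys_add[of "n - m" m] by auto
    qed
  next
    show "mnm \<one> 0 \<in> FS \<and> (\<forall>n. mnm \<one> 0 n \<noteq> \<zero> \<longrightarrow> Poly_Mapping.keys n \<subseteq> {1..r})"
      by (simp add: FS_mono) (simp add: monomial_def)
  qed (use conv_assoc conv_comm in \<open>blast intro: ext | force intro!: ext\<close>)+
  fix f g h assume "f \<in> carrier (laurent_ring R r)" "g \<in> carrier (laurent_ring R r)" "h \<in> carrier (laurent_ring R r)"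
  then show "(f \<oplus>\<^bsub>laurent_ring R r\<^esub> g) \<otimes>\<^bsub>laurent_ring R r\<^esub> h
      = f \<otimes>\<^bsub>laurent_ring R r\<^esub> h \<oplus>\<^bsub>laurent_ring R r\<^esub> g \<otimes>\<^bsub>laurent_ring R r\<^esub> h"
    by (auto simp: laurent_ring_simps laurent_ring_carrier conv_add)
qed

end

section \<open>Gauss extension of a valuation\<close>

text \<open>The codomain has no infinity, so the axioms are restricted to nonzero elements and
  nonzero sums.\<close>

definition valuation :: "('k, 'm) ring_scheme \<Rightarrow> ('k \<Rightarrow> int) \<Rightarrow> bool" where
  "valuation K v \<longleftrightarrow>
     (\<forall>a\<in>carrier K - {\<zero>\<^bsub>K\<^esub>}. \<forall>b\<in>carrier K - {\<zero>\<^bsub>K\<^esub>}.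
        v (a \<otimes>\<^bsub>K\<^esub> b) = v a + v b \<and> (a \<oplus>\<^bsub>K\<^esub> b \<noteq> \<zero>\<^bsub>K\<^esub> \<longrightarrow> min (v a) (v b) \<le> v (a \<oplus>\<^bsub>K\<^esub> b)))"

text \<open>In the application \<open>d n\<close> is the coefficient of the divisor with exponent
  vector \<open>n\<close> along a fixed prime divisor. For the zero polynomial the minimum runs over
  the empty set, so the results below assume a nonzero coefficient.\<close>

definition gauss :: "('k, 'm) ring_scheme \<Rightarrow> ('k \<Rightarrow> int) \<Rightarrow> ((nat \<Rightarrow>\<^sub>0 int) \<Rightarrow> int) \<Rightarrow> ((nat \<Rightarrow>\<^sub>0 int) \<Rightarrow> 'k) \<Rightarrow> int" where
  "gauss K v d f = Min ((\<lambda>n. v (f n) + d n) ` {n. f n \<noteq> \<zero>\<^bsub>K\<^esub>})"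

locale gauss_valuation = domain K for K (structure) +
  fixes v :: "'a \<Rightarrow> int" and d :: "(nat \<Rightarrow>\<^sub>0 int) \<Rightarrow> int"
  assumes val: "valuation K v" and d_add: "d (m + n) = d m + d n"
begin

lemma v_mult: "\<lbrakk>a \<in> carrier K; b \<in> carrier K; a \<noteq> \<zero>; b \<noteq> \<zero>\<rbrakk> \<Longrightarrow> v (a \<otimes> b) = v a + v b"
  using val by (simp add: valuation_def)

lemma v_add: "\<lbrakk>a \<in> carrier K; b \<in> carrier K; a \<noteq> \<zero>; b \<noteq> \<zero>; a \<oplus> b \<noteq> \<zero>\<rbrakk> \<Longrightarrow> min (v a) (v b) \<le> v (a \<oplus> b)"
  using val by (simp add: valuation_def)

lemma v_minus: assumes "a \<in> carrier K" "a \<noteq> \<zero>" shows "v (\<ominus> a) = v a"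
proof -
  have m: "\<ominus> \<one> \<in> carrier K" "\<ominus> \<one> \<noteq> \<zero>" by auto
  have "(\<ominus> \<one>) \<otimes> (\<ominus> \<one>) = \<one>" by (simp add: l_minus)
  then have "2 * v (\<ominus> \<one>) = v \<one>" using v_mult[OF m(1) m(1) m(2) m(2)] by simp
  moreover have "v \<one> = 0" using v_mult[of \<one> \<one>] by simp
  moreover have "\<ominus> a = (\<ominus> \<one>) \<otimes> a" using assms by (simp add: l_minus)
  ultimately show ?thesis using v_mult[OF m(1) assms(1) m(2) assms(2)] by simp
qed

text \<open>The inequality \<open>c \<le> v x\<close> under the convention that zero has infinite
  value, which makes it stable under arbitrary finite sums.\<close>

definition "vge x c \<longleftrightarrow> x = \<zero> \<or> c \<le> v x"

lemma vge_add: assumes "x \<in> carrier K" "y \<in> carrier K" "vge x c" "vge y c" shows "vge (x \<oplus> y) c"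
proof (cases "x = \<zero> \<or> y = \<zero> \<or> x \<oplus> y = \<zero>")
  case True
  then show ?thesis using assms by (auto simp: vge_def)
next
  case False
  then show ?thesis using assms v_add[of x y] by (auto simp: vge_def)
qed

lemma vge_finsum:
  assumes "finite F" "\<And>i. i \<in> F \<Longrightarrow> f i \<in> carrier K" "\<And>i. i \<in> F \<Longrightarrow> vge (f i) c"
  shows "vge (\<Oplus>i\<in>F. f i) c"
  using assms
proof (induction F rule: finite_induct)
  case empty
  then show ?case by (simp add: vge_def)
next
  case (insert i F)
  then have "(\<Oplus>i\<in>insert i F. f i) = f i \<oplus> (\<Oplus>i\<in>F. f i)" by (intro finsum_insert) auto
  moreover have "(\<Oplus>i\<in>F. f i) \<in> carrier K" using insert by (intro finsum_closed) auto
  ultimately show ?case using insert vge_add by simp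
qed

text \<open>A summand of strictly larger value does not disturb the value: if
  \<open>v (x \<oplus> y)\<close> exceeded \<open>v x\<close>, then \<open>x\<close>, being the
  difference of \<open>x \<oplus> y\<close> and \<open>y\<close>, would have too large a
  value.\<close>

lemma v_dominant:
  assumes xy: "x \<in> carrier K" "y \<in> carrier K" "x \<noteq> \<zero>" "vge y (v x + 1)"
  shows "x \<oplus> y \<noteq> \<zero>" "v (x \<oplus> y) = v x"
proof -
  have "x \<oplus> y \<noteq> \<zero> \<and> v (x \<oplus> y) = v x"
  proof (cases "y = \<zero>")
    case True
    then show ?thesis using xy by simp
  next
    case False
    then have y: "v x < v y" using xy by (auto simp: vge_def)
    have nz: "x \<oplus> y \<noteq> \<zero>"
    proof
      assume "x \<oplus> y = \<zero>"
      then have "x = \<ominus> y" using xy minus_equality by metis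
      then show False using v_minus[OF xy(2) False] y by simp
    qed
    have ge: "v x \<le> v (x \<oplus> y)" using v_add[OF xy(1,2,3) False nz] y by simp
    have m: "\<ominus> y \<in> carrier K" "\<ominus> y \<noteq> \<zero>" using xy False by auto
    have eq: "(x \<oplus> y) \<oplus> \<ominus> y = x" using xy by (simp add: a_assoc r_neg)
    have "min (v (x \<oplus> y)) (v (\<ominus> y)) \<le> v x"
      using v_add[of "x \<oplus> y" "\<ominus> y"] xy m nz eq by simp
    then have "v (x \<oplus> y) \<le> v x" using y v_minus[OF xy(2) False] by simp
    then show ?thesis using ge nz by simp
  qed
  then show "x \<oplus> y \<noteq> \<zero>" "v (x \<oplus> y) = v x" by auto
qed

abbreviation "W \<equiv> gauss K v d"

lemma gauss_le: "\<lbrakk>f \<in> finite_support K; f n \<noteq> \<zero>\<rbrakk> \<Longrightarrow> W f \<le> v (f n) + d n"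
  unfolding gauss_def by (intro Min_le) auto

lemma gauss_attained: assumes "f \<in> finite_support K" "f n \<noteq> \<zero>" shows "\<exists>n. f n \<noteq> \<zero> \<and> W f = v (f n) + d n"
proof -
  have "W f \<in> (\<lambda>n. v (f n) + d n) ` {n. f n \<noteq> \<zero>}"
    unfolding gauss_def by (rule Min_in) (use assms in auto)
  then show ?thesis by auto
qed

lemma gauss_ge: assumes "f \<in> finite_support K" "f n \<noteq> \<zero>"
  shows "c \<le> W f \<longleftrightarrow> (\<forall>n. f n \<noteq> \<zero> \<longrightarrow> c \<le> v (f n) + d n)"
  using gauss_attained[OF assms] gauss_le[OF assms(1)] by fastforce

text \<open>Several exponents may attain the minimum; the linear order on exponent vectors singles
  out the least of them, before which all values are strictly larger.\<close>

lemma first_minimal: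
  assumes "f \<in> finite_support K" "f n \<noteq> \<zero>"
  shows "\<exists>i. f i \<noteq> \<zero> \<and> v (f i) + d i = W f \<and> (\<forall>m<i. f m \<noteq> \<zero> \<longrightarrow> W f < v (f m) + d m)"
proof -
  let ?S = "{n. f n \<noteq> \<zero> \<and> v (f n) + d n = W f}"
  have S: "finite ?S" "?S \<noteq> {}"
    using gauss_attained[OF assms] finite_subset[of ?S "{n. f n \<noteq> \<zero>}"] assms by auto
  show ?thesis
  proof (intro exI conjI allI impI)
    show "f (Min ?S) \<noteq> \<zero>" "v (f (Min ?S)) + d (Min ?S) = W f" using Min_in[OF S] by auto
    fix m assume m: "m < Min ?S" "f m \<noteq> \<zero>"
    then have "m \<notin> ?S" using Min_le[OF S(1)] by (meson linorder_not_le)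
    then show "W f < v (f m) + d m" using gauss_le[OF assms(1) m(2)] m by auto
  qed
qed

text \<open>The extremal monomials of \<open>f\<close> and \<open>g\<close>, earliest in a compatible linear order of the exponents,
  meet in a single term of the product, which therefore dominates.\<close>

lemma gauss_mult:
  assumes f: "f \<in> finite_support K" "f n1 \<noteq> \<zero>" and g: "g \<in> finite_support K" "g n2 \<noteq> \<zero>"
  shows "\<exists>n. conv f g n \<noteq> \<zero>" "W (conv f g) = W f + W g"
proof -
  obtain i where i: "f i \<noteq> \<zero>" "v (f i) + d i = W f" "\<And>m. \<lbrakk>m < i; f m \<noteq> \<zero>\<rbrakk> \<Longrightarrow> W f < v (f m) + d m"
    using first_minimal[OF f] by blast
  obtain j where j: "g j \<noteq> \<zero>" "v (g j) + d j = W g" "\<And>m. \<lbrakk>m < j; g m \<noteq> \<zero>\<rbrakk> \<Longrightarrow> W g < v (g m) + d m"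
    using first_minimal[OF g] by blast
  have dd: "d n = d m + d (n - m)" for n m using d_add[of m "n - m"] by simp
  have tm: "vge (f m \<otimes> g (n - m)) (W f + W g - d n)" if "f m \<noteq> \<zero>" for m n
  proof (cases "g (n - m) = \<zero>")
    case True
    then show ?thesis using f by (simp add: vge_def)
  next
    case False
    then have "v (f m \<otimes> g (n - m)) = v (f m) + v (g (n - m))" using v_mult f g that by simp
    then show ?thesis using gauss_le[OF f(1) that] gauss_le[OF g(1) False] dd[of n m] by (simp add: vge_def)
  qed
  have ge: "vge (conv f g n) (W f + W g - d n)" for n
    unfolding laurent_mult_def by (rule vge_finsum) (use f g tm in auto)
  let ?n = "i + j" let ?S = "{m. f m \<noteq> \<zero>}" let ?rest = "\<Oplus>m\<in>?S - {i}. f m \<otimes> g (?n - m)"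
  have "conv f g ?n = (\<Oplus>m\<in>insert i (?S - {i}). f m \<otimes> g (?n - m))"
    unfolding laurent_mult_def using i by (simp add: insert_absorb)
  also have "\<dots> = f i \<otimes> g (?n - i) \<oplus> ?rest"
    by (rule finsum_insert) (use f g in auto)
  finally have eq: "conv f g ?n = f i \<otimes> g j \<oplus> ?rest" by simp
  have vij: "v (f i \<otimes> g j) = W f + W g - d ?n" using v_mult f g i j d_add[of i j] by simp
  have "vge ?rest (v (f i \<otimes> g j) + 1)"
  proof (rule vge_finsum)
    fix m assume m: "m \<in> ?S - {i}"
    show "vge (f m \<otimes> g (?n - m)) (v (f i \<otimes> g j) + 1)"
    proof (cases "g (?n - m) = \<zero>")
      case True
      then show ?thesis using f by (simp add: vge_def)
    next
      case False
      \<comment> \<open>For \<open>m \<noteq> i\<close> either \<open>m < i\<close> or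
        \<open>?n - m < j\<close>, as the order is compatible with addition; strict minimality of
        \<open>i\<close> or \<open>j\<close> makes the term too large to interfere.\<close>
      have "W f < v (f m) + d m \<or> W g < v (g (?n - m)) + d (?n - m)"
      proof (cases "m < i")
        case True
        then show ?thesis using i m by auto
      next
        case nless: False
        then have "i < m" using m by auto
        have "?n - m < j"
        proof (rule ccontr)
          assume "\<not> ?n - m < j"
          then have "j + m \<le> (?n - m) + m" by (intro add_right_mono) (simp add: linorder_not_less)
          moreover have "i + j < m + j" using \<open>i < m\<close> by (rule add_strict_right_mono)
          ultimately show False by (simp add: add.commute leD)
        qed
        then show ?thesis using j False by auto
      qed
      moreover have "v (f m \<otimes> g (?n - m)) = v (f m) + v (g (?n - m))" using v_mult f g m False by simp
      moreover have "W f \<le> v (f m) + d m" "W g \<le> v (g (?n - m)) + d (?n - m)"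
        using gauss_le f(1) g(1) m False by auto
      ultimately show ?thesis using dd[of ?n m] vij by (auto simp: vge_def)
    qed
  qed (use f g in auto)
  moreover have "?rest \<in> carrier K" by (rule finsum_closed) (use f g in auto)
  ultimately have dom: "conv f g ?n \<noteq> \<zero>" "v (conv f g ?n) = W f + W g - d ?n"
    using v_dominant[of "f i \<otimes> g j" ?rest] i j f g vij eq by (auto simp: integral_iff)
  then show "\<exists>n. conv f g n \<noteq> \<zero>" by blast
  have "W (conv f g) \<le> W f + W g"
    using gauss_le[OF FS_conv[OF f(1) g(1)] dom(1)] dom(2) by simp
  moreover have "W f + W g \<le> W (conv f g)"
    using gauss_ge[OF FS_conv[OF f(1) g(1)] dom(1), of "W f + W g"] ge by (auto simp: vge_def algebra_simps)
  ultimately show "W (conv f g) = W f + W g" by simp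
qed

lemma gauss_add:
  assumes "f \<in> finite_support K" "g \<in> finite_support K" "f n1 \<noteq> \<zero>" "g n2 \<noteq> \<zero>" "f n \<oplus> g n \<noteq> \<zero>"
  shows "min (W f) (W g) \<le> W (\<lambda>n. f n \<oplus> g n)"
proof -
  have *: "min (W f) (W g) \<le> v (f n \<oplus> g n) + d n" if "f n \<oplus> g n \<noteq> \<zero>" for n
  proof -
    have "vge (f n) (min (W f) (W g) - d n)" "vge (g n) (min (W f) (W g) - d n)"
      using gauss_le[OF assms(1), of n] gauss_le[OF assms(2), of n] unfolding vge_def by linarith+
    then have "vge (f n \<oplus> g n) (min (W f) (W g) - d n)" using vge_add assms(1,2) by simp
    then show ?thesis using that unfolding vge_def by linarith
  qed
  then show ?thesis using gauss_ge[of "\<lambda>n. f n \<oplus> g n" n "min (W f) (W g)"] FS_add[OF assms(1,2)] assms(5) by blast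
qed

end

section \<open>Laurent polynomial rings over a field\<close>

text \<open>The absence of zero divisors is the first conclusion of \<open>gauss_mult\<close> for
  the trivial valuation and trivial weights.\<close>

lemma (in domain) domain_laurent_ring: "domain (laurent_ring R r)"
proof -
  interpret g: gauss_valuation R "\<lambda>_. 0" "\<lambda>_. 0"
    by unfold_locales (auto simp: valuation_def)
  interpret L: cring "laurent_ring R r" by (rule cring_laurent_ring)
  show ?thesis
  proof
    show "\<one>\<^bsub>laurent_ring R r\<^esub> \<noteq> \<zero>\<^bsub>laurent_ring R r\<^esub>"
      by (auto simp: laurent_ring_simps monomial_def fun_eq_iff)
    fix f h assume fh: "f \<otimes>\<^bsub>laurent_ring R r\<^esub> h = \<zero>\<^bsub>laurent_ring R r\<^esub>"
      "f \<in> carrier (laurent_ring R r)" "h \<in> carrier (laurent_ring R r)"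
    then have fh: "conv f h = (\<lambda>n. \<zero>)" "f \<in> FS" "h \<in> FS" by (auto simp: laurent_ring_simps laurent_ring_carrier)
    have "(\<forall>n. f n = \<zero>) \<or> (\<forall>n. h n = \<zero>)"
    proof (rule ccontr)
      assume "\<not> ?thesis"
      then obtain n1 n2 where "f n1 \<noteq> \<zero>" "h n2 \<noteq> \<zero>" by blast
      then show False using g.gauss_mult(1)[OF fh(2) _ fh(3)] fh(1) by simp
    qed
    then show "f = \<zero>\<^bsub>laurent_ring R r\<^esub> \<or> h = \<zero>\<^bsub>laurent_ring R r\<^esub>"
      by (auto simp: laurent_ring_simps)
  qed
qed

lemma (in field) monomial_Units:
  assumes "c \<in> carrier R" "c \<noteq> \<zero>" "Poly_Mapping.keys n \<subseteq> {1..r}"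
  shows "monomial R c n \<in> Units (laurent_ring R r)"
proof -
  interpret L: domain "laurent_ring R r" by (rule domain_laurent_ring)
  have c: "inv c \<in> carrier R" "c \<otimes> inv c = \<one>" using assms field_Units by auto
  have carr: "monomial R a m \<in> carrier (laurent_ring R r)" if "a \<in> carrier R" "Poly_Mapping.keys m \<subseteq> {1..r}" for a m
    using FS_mono[OF that(1)] that(2) by (simp add: laurent_ring_carrier) (simp add: monomial_def)
  have "conv (monomial R c n) (monomial R (inv c) (- n)) k = monomial R \<one> 0 k" for k
  proof -
    have "conv (monomial R c n) (monomial R (inv c) (- n)) k = c \<otimes> monomial R (inv c) (- n) (k - n)"
      by (rule conv_mono) (use assms c in auto)
    then show ?thesis using assms(1) c by (simp add: monomial_def)
  qed
  then have "conv (monomial R c n) (monomial R (inv c) (- n)) = monomial R \<one> 0" by blast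
  then have "monomial R c n \<otimes>\<^bsub>laurent_ring R r\<^esub> monomial R (inv c) (- n) = \<one>\<^bsub>laurent_ring R r\<^esub>"
    by (simp only: laurent_ring_simps)
  then show ?thesis
    by (rule L.Units_of_inverse[rotated 2]) (use carr assms c in auto)
qed

text \<open>Elements of both rings are functions on the same exponent vectors, so the ring in
  \<open>r\<close> variables is literally a subset of the one in \<open>Suc r\<close>. The
  coefficient of the \<open>k\<close>-th power of the last variable is obtained by shifting the last
  exponent by \<open>k\<close> and keeping only vectors whose own last entry is zero.\<close>

lemma (in field) laurent_ring_extension:
  "laurent_extension (laurent_ring R r) (laurent_ring R (Suc r))
     (\<lambda>f k n. if Poly_Mapping.lookup n (Suc r) = 0 then f (n + Poly_Mapping.single (Suc r) k) else \<zero>)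
     (\<lambda>i. monomial R \<one> (Poly_Mapping.single (Suc r) i))"
proof -
  let ?e = "Poly_Mapping.single (Suc r) :: int \<Rightarrow> _"
  let ?cf = "\<lambda>f k n. if Poly_Mapping.lookup n (Suc r) = 0 then f (n + ?e k) else \<zero>"
  let ?T = "\<lambda>i. monomial R \<one> (?e i)"
  let ?A = "laurent_ring R r" and ?B = "laurent_ring R (Suc r)"
  interpret A: domain ?A by (rule domain_laurent_ring)
  interpret B: domain ?B by (rule domain_laurent_ring)
  have lk0: "Poly_Mapping.lookup n (Suc r) = 0" if "f \<in> carrier ?A" "f n \<noteq> \<zero>" for f n
  proof -
    have "Poly_Mapping.keys n \<subseteq> {1..r}" using that unfolding laurent_ring_carrier by blast
    then have "Suc r \<notin> Poly_Mapping.keys n" by auto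
    then show ?thesis by (simp add: in_keys_iff)
  qed
  have "{1..r} \<subseteq> {1..Suc r}" by auto
  then have AB: "f \<in> carrier ?B" if "f \<in> carrier ?A" for f
    using that unfolding laurent_ring_carrier by blast
  have BFS: "f \<in> FS" if "f \<in> carrier ?B" for f using that by (simp add: laurent_ring_carrier)
  have AFS: "f \<in> FS" if "f \<in> carrier ?A" for f using that by (simp add: laurent_ring_carrier)
  have cfFS: "?cf f k \<in> FS" if f: "f \<in> carrier ?B" for f k
  proof (rule FS_subset)
    show "finite ((\<lambda>n. n - ?e k) ` {n. f n \<noteq> \<zero>})" using BFS[OF f] by simp
    show "{n. ?cf f k n \<noteq> \<zero>} \<subseteq> (\<lambda>n. n - ?e k) ` {n. f n \<noteq> \<zero>}"
    proof
      fix n assume "n \<in> {n. ?cf f k n \<noteq> \<zero>}"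
      then have "f (n + ?e k) \<noteq> \<zero>" by (auto split: if_splits)
      then show "n \<in> (\<lambda>n. n - ?e k) ` {n. f n \<noteq> \<zero>}" by (intro image_eqI[of _ _ "n + ?e k"]) auto
    qed
  qed (use BFS[OF f] in auto)
  have cfA: "?cf f k \<in> carrier ?A" if f: "f \<in> carrier ?B" for f k
    unfolding laurent_ring_carrier
  proof (intro conjI allI impI cfFS f subsetI)
    fix n j assume n: "?cf f k n \<noteq> \<zero>" and j: "j \<in> Poly_Mapping.keys n"
    from n have n0: "Poly_Mapping.lookup n (Suc r) = 0" and "f (n + ?e k) \<noteq> \<zero>" by (auto split: if_splits)
    then have k: "Poly_Mapping.keys (n + ?e k) \<subseteq> {1..Suc r}" using f unfolding laurent_ring_carrier by blast
    have "j \<noteq> Suc r" using n0 j by (auto simp: in_keys_iff)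
    then have "j \<in> Poly_Mapping.keys (n + ?e k)" using j by (simp add: in_keys_iff lookup_add lookup_single)
    then show "j \<in> {1..r}" using k \<open>j \<noteq> Suc r\<close> by force
  qed
  have TB: "?T i \<in> carrier ?B" for i
    using FS_mono[OF one_closed] by (simp add: laurent_ring_carrier) (simp add: monomial_def)
  show ?thesis
  proof (rule laurent_extension.intro[OF A.domain_axioms B.domain_axioms], unfold_locales)
    show "carrier ?A \<subseteq> carrier ?B" using AB by blast
    show "(\<otimes>\<^bsub>?A\<^esub>) = (\<otimes>\<^bsub>?B\<^esub>)" "\<one>\<^bsub>?A\<^esub> = \<one>\<^bsub>?B\<^esub>" "\<zero>\<^bsub>?A\<^esub> = \<zero>\<^bsub>?B\<^esub>" "(\<oplus>\<^bsub>?A\<^esub>) = (\<oplus>\<^bsub>?B\<^esub>)"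
      by (simp_all add: laurent_ring_def)
    show "?T i \<in> carrier ?B" for i by (rule TB)
    show "?T 0 = \<one>\<^bsub>?B\<^esub>" by (simp add: laurent_ring_simps)
    show "?cf f k \<in> carrier ?A" if "f \<in> carrier ?B" for f k by (rule cfA[OF that])
    show "?T i \<otimes>\<^bsub>?B\<^esub> ?T j = ?T (i + j)" for i j
    proof
      fix n
      have "(?T i \<otimes>\<^bsub>?B\<^esub> ?T j) n = \<one> \<otimes> ?T j (n - ?e i)"
        unfolding laurent_ring_simps by (rule conv_mono) auto
      then show "(?T i \<otimes>\<^bsub>?B\<^esub> ?T j) n = ?T (i + j) n"
        by (auto simp: monomial_def single_add algebra_simps)
    qed
    show "?cf \<one>\<^bsub>?B\<^esub> k = (if k = 0 then \<one>\<^bsub>?B\<^esub> else \<zero>\<^bsub>?B\<^esub>)" for k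
    proof
      fix n
      have *: "n + ?e k = 0 \<longleftrightarrow> n = 0 \<and> k = 0" if "Poly_Mapping.lookup n (Suc r) = 0"
      proof
        assume "n + ?e k = 0"
        then have "Poly_Mapping.lookup (n + ?e k) (Suc r) = 0" by simp
        then have "k = 0" using that by (simp add: lookup_add)
        then show "n = 0 \<and> k = 0" using \<open>n + ?e k = 0\<close> by simp
      qed simp
      then show "?cf \<one>\<^bsub>?B\<^esub> k n = (if k = 0 then \<one>\<^bsub>?B\<^esub> else \<zero>\<^bsub>?B\<^esub>) n"
        by (simp add: laurent_ring_simps) (auto simp: monomial_def)
    qed
  next
    fix f assume f: "f \<in> carrier ?B"
    have "k \<in> (\<lambda>n. Poly_Mapping.lookup n (Suc r)) ` {n. f n \<noteq> \<zero>}" if nz: "?cf f k \<noteq> \<zero>\<^bsub>?B\<^esub>" for k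
    proof -
      obtain n where "?cf f k n \<noteq> \<zero>" using nz by (auto simp: laurent_ring_simps fun_eq_iff)
      then have "Poly_Mapping.lookup n (Suc r) = 0" "f (n + ?e k) \<noteq> \<zero>" by (auto split: if_splits)
      then show ?thesis by (intro image_eqI[of _ _ "n + ?e k"]) (auto simp: lookup_add)
    qed
    then have "{k. ?cf f k \<noteq> \<zero>\<^bsub>?B\<^esub>} \<subseteq> (\<lambda>n. Poly_Mapping.lookup n (Suc r)) ` {n. f n \<noteq> \<zero>}" by blast
    then show "finite {k. ?cf f k \<noteq> \<zero>\<^bsub>?B\<^esub>}" using BFS[OF f] finite_subset by (metis (no_types, lifting) FS_finite finite_imageI)
  next
    fix f assume f: "f \<in> carrier ?B" "\<And>k. ?cf f k = \<zero>\<^bsub>?B\<^esub>"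
    have "f n = \<zero>" for n
    proof -
      let ?k = "Poly_Mapping.lookup n (Suc r)"
      have "?cf f ?k (n - ?e ?k) = \<zero>" 
        using fun_cong[OF f(2)[of ?k], of "n - ?e ?k"] by (simp only: laurent_ring_simps)
      then show ?thesis by (simp add: lookup_minus)
    qed
    then show "f = \<zero>\<^bsub>?B\<^esub>" by (auto simp: laurent_ring_simps)
  next
    fix f g k assume "f \<in> carrier ?B" "g \<in> carrier ?B"
    then show "?cf (f \<oplus>\<^bsub>?B\<^esub> g) k = ?cf f k \<oplus>\<^bsub>?B\<^esub> ?cf g k"
      by (auto simp: laurent_ring_simps)
  next
    fix a g i k assume a: "a \<in> carrier ?A" and g: "g \<in> carrier ?B"
    note FSs = AFS[OF a] BFS[OF g] cfFS[OF g]
    have "conv a (?T i) = (\<lambda>n. \<one> \<otimes> a (n - ?e i))"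
      using FSs by (auto simp: conv_mono_right)
    then have eq: "(a \<otimes>\<^bsub>?B\<^esub> ?T i \<otimes>\<^bsub>?B\<^esub> g) n = conv a g (n - ?e i)" for n
      unfolding laurent_ring_simps using conv_shift[OF FSs(1,2) one_closed] FSs by simp
    show "?cf (a \<otimes>\<^bsub>?B\<^esub> ?T i \<otimes>\<^bsub>?B\<^esub> g) k = a \<otimes>\<^bsub>?B\<^esub> ?cf g (k - i)"
    proof
      fix n
      show "?cf (a \<otimes>\<^bsub>?B\<^esub> ?T i \<otimes>\<^bsub>?B\<^esub> g) k n = (a \<otimes>\<^bsub>?B\<^esub> ?cf g (k - i)) n"
      proof (cases "Poly_Mapping.lookup n (Suc r) = 0")
        case True
        \<comment> \<open>Exponents \<open>m\<close> occurring in \<open>a\<close> have last entry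
          zero, so \<open>n - m\<close> passes the same test as \<open>n\<close> in every
          term.\<close>
        have "conv a g (n + ?e k - ?e i) = conv a (?cf g (k - i)) n"
          unfolding laurent_mult_def
        proof (rule finsum_cong')
          fix m assume "m \<in> {m. a m \<noteq> \<zero>}"
          then have lk: "Poly_Mapping.lookup (n - m) (Suc r) = 0" using lk0[OF a] True by (simp add: lookup_minus)
          have sh: "n + ?e k - ?e i - m = n - m + ?e (k - i)" by (simp add: single_diff algebra_simps)
          show "a m \<otimes> g (n + ?e k - ?e i - m) = a m \<otimes> ?cf g (k - i) (n - m)"
            by (simp only: lk sh if_True simp_thms)
        qed (use FSs in auto)
        then show ?thesis using True eq[of "n + ?e k"] by (simp add: laurent_ring_simps)
      next
        case False
        have "conv a (?cf g (k - i)) n = \<zero>"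
        proof (rule ccontr)
          assume "conv a (?cf g (k - i)) n \<noteq> \<zero>"
          then obtain m where "a m \<noteq> \<zero>" "?cf g (k - i) (n - m) \<noteq> \<zero>"
            using conv_nonzeroD[OF FSs(1) FSs(3)] by blast
          then have "Poly_Mapping.lookup m (Suc r) = 0" "Poly_Mapping.lookup (n - m) (Suc r) = 0"
            using lk0[OF a] by (auto split: if_splits)
          then show False using False by (simp add: lookup_minus)
        qed
        then show ?thesis using False by (simp add: laurent_ring_simps)
      qed
    qed
  qed
qed

text \<open>With no variables a nonzero element is a nonzero constant, a unit since the base is a
  field; each further variable is one Laurent extension.\<close>

lemma (in field) laurent_ring_prime_product:
  "\<lbrakk>f \<in> carrier (laurent_ring R r); f \<noteq> \<zero>\<^bsub>laurent_ring R r\<^esub>\<rbrakk> \<Longrightarrow> \<exists>n. prime_product (laurent_ring R r) n f"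
proof (induction r arbitrary: f)
  case 0
  have "f = monomial R (f 0) 0"
  proof
    fix n
    have "f n \<noteq> \<zero> \<Longrightarrow> Poly_Mapping.keys n \<subseteq> {}" using 0 unfolding laurent_ring_carrier by auto
    then show "f n = monomial R (f 0) 0 n" by (cases "n = 0") (auto simp: monomial_def)
  qed
  moreover have "f 0 \<noteq> \<zero>"
  proof
    assume "f 0 = \<zero>"
    then have "f = (\<lambda>n. \<zero>)" using calculation by (simp add: monomial_def)
    then show False using 0 by (simp add: laurent_ring_simps)
  qed
  moreover have "f 0 \<in> carrier R" using 0 by (simp add: laurent_ring_carrier)
  ultimately have "f \<in> Units (laurent_ring R 0)" by (metis monomial_Units empty_subsetI keys_zero)
  then show ?case by (blast intro: prime_product.unit)
next
  case (Suc r)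
  show ?case
  proof (rule laurent_extension.laurent_prime_product[OF laurent_ring_extension _ Suc.prems])
    fix a assume "a \<in> carrier (laurent_ring R r)" "a \<noteq> \<zero>\<^bsub>laurent_ring R (Suc r)\<^esub>"
    then show "\<exists>n. prime_product (laurent_ring R r) n a" using Suc.IH by (simp add: laurent_ring_simps)
  qed
qed

text \<open>The interface between algebra and geometry: \<open>P\<close> is an abstract index set,
  \<open>v z\<close> the order along \<open>z\<close>, and \<open>D z n\<close> the coefficient
  along \<open>z\<close> of the divisor attached to \<open>n\<close>. The assumption
  \<open>real\<close> says that the class group is generated.\<close>

theorem (in field) multisection_factorial:
  fixes v :: "'z \<Rightarrow> 'a \<Rightarrow> int" and D :: "'z \<Rightarrow> (nat \<Rightarrow>\<^sub>0 int) \<Rightarrow> int"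
  assumes val: "\<And>z. z \<in> P \<Longrightarrow> valuation R (v z)"
    and v_fin: "\<And>a. \<lbrakk>a \<in> carrier R; a \<noteq> \<zero>\<rbrakk> \<Longrightarrow> finite {z \<in> P. v z a \<noteq> 0}"
    and D_add: "\<And>z m n. D z (m + n) = D z m + D z n"
    and D_fin: "\<And>n. Poly_Mapping.keys n \<subseteq> {1..r} \<Longrightarrow> finite {z \<in> P. D z n \<noteq> 0}"
    and real: "\<And>m. finite {z \<in> P. m z \<noteq> 0} \<Longrightarrow>
        \<exists>a n. a \<in> carrier R \<and> a \<noteq> \<zero> \<and> Poly_Mapping.keys n \<subseteq> {1..r} \<and> (\<forall>z\<in>P. m z = v z a + D z n)"
  shows "factorial_domain ((laurent_ring R r)\<lparr>carrier := {f \<in> carrier (laurent_ring R r).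
           \<forall>n. f n \<noteq> \<zero> \<longrightarrow> (\<forall>z\<in>P. 0 \<le> v z (f n) + D z n)}\<rparr>)"
proof -
  let ?L = "laurent_ring R r"
  define w where "w z = gauss R (v z) (D z)" for z
  have gv: "gauss_valuation R (v z) (D z)" if "z \<in> P" for z
    by unfold_locales (use val[OF that] D_add in auto)
  have FS: "f \<in> FS" if "f \<in> carrier ?L" for f using that by (simp add: laurent_ring_carrier)
  have nz: "\<exists>n. f n \<noteq> \<zero>" if "f \<noteq> \<zero>\<^bsub>?L\<^esub>" for f using that by (auto simp: laurent_ring_simps)
  interpret L: domain ?L by (rule domain_laurent_ring)
  interpret V: valued_factorial ?L P w
  proof (unfold_locales, goal_cases)
    case (1 a)
    then show ?case by (rule laurent_ring_prime_product)
  next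
    case (2 z a b)
    interpret gauss_valuation R "v z" "D z" using gv 2 by blast
    show ?case using gauss_mult(2) 2 FS nz by (metis laurent_ring_simps(1) w_def)
  next
    case (3 z a b)
    interpret gauss_valuation R "v z" "D z" using gv 3 by blast
    obtain i j k where "a i \<noteq> \<zero>" "b j \<noteq> \<zero>" "(a \<oplus>\<^bsub>?L\<^esub> b) k \<noteq> \<zero>" using nz 3 by metis
    then show ?case using gauss_add[OF FS[OF 3(2)] FS[OF 3(3)]] by (simp add: laurent_ring_simps w_def)
  next
    case (4 a)
    let ?S = "{n. a n \<noteq> \<zero>}"
    \<comment> \<open>A Gauss value is attained at some exponent of the finite support, so it can be
      nonzero only where one of the finitely many coefficients or weights is.\<close>
    have "finite (\<Union>n\<in>?S. {z \<in> P. v z (a n) \<noteq> 0} \<union> {z \<in> P. D z n \<noteq> 0})"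
      using 4 FS v_fin D_fin unfolding laurent_ring_carrier by (intro finite_UN_I finite_UnI) auto
    moreover have "{z \<in> P. w z a \<noteq> 0} \<subseteq> (\<Union>n\<in>?S. {z \<in> P. v z (a n) \<noteq> 0} \<union> {z \<in> P. D z n \<noteq> 0})"
    proof
      fix z assume z: "z \<in> {z \<in> P. w z a \<noteq> 0}"
      interpret gauss_valuation R "v z" "D z" using gv z by blast
      obtain n where "a n \<noteq> \<zero>" "w z a = v z (a n) + D z n"
        using gauss_attained FS[OF 4(1)] nz[OF 4(2)] by (metis w_def)
      then show "z \<in> (\<Union>n\<in>?S. {z \<in> P. v z (a n) \<noteq> 0} \<union> {z \<in> P. D z n \<noteq> 0})" using z by auto
    qed
    ultimately show ?case by (rule finite_subset[rotated])
  next
    case (5 m)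
    then obtain a n where an: "a \<in> carrier R" "a \<noteq> \<zero>" "Poly_Mapping.keys n \<subseteq> {1..r}" "\<forall>z\<in>P. m z = v z a + D z n"
      using real by blast
    have "w z (monomial R a n) = m z" if "z \<in> P" for z
    proof -
      have "{k. monomial R a n k \<noteq> \<zero>} = {n}" using an by (auto simp: monomial_def)
      then show ?thesis using an that by (simp add: w_def gauss_def monomial_def)
    qed
    then show ?case using monomial_Units[OF an(1-3)] by blast
  qed
  have *: "(f = \<zero>\<^bsub>?L\<^esub> \<or> (\<forall>z\<in>P. 0 \<le> w z f)) \<longleftrightarrow> (\<forall>n. f n \<noteq> \<zero> \<longrightarrow> (\<forall>z\<in>P. 0 \<le> v z (f n) + D z n))"
    if f: "f \<in> carrier ?L" for f
  proof (cases "f = \<zero>\<^bsub>?L\<^esub>")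
    case True
    then show ?thesis by (simp add: laurent_ring_simps)
  next
    case False
    then obtain n where n: "f n \<noteq> \<zero>" using nz by blast
    have "0 \<le> w z f \<longleftrightarrow> (\<forall>n. f n \<noteq> \<zero> \<longrightarrow> 0 \<le> v z (f n) + D z n)" if "z \<in> P" for z
      using gauss_valuation.gauss_ge[OF gv[OF that] FS[OF f] n] by (simp add: w_def)
    then show ?thesis using False by blast
  qed
  then have "V.R = ?L\<lparr>carrier := {f \<in> carrier ?L. \<forall>n. f n \<noteq> \<zero> \<longrightarrow> (\<forall>z\<in>P. 0 \<le> v z (f n) + D z n)}\<rparr>"
    
    unfolding V.R_def by (intro arg_cong[where f = "\<lambda>X. ?L\<lparr>carrier := X\<rparr>"]) blast
  then show ?thesis using V.factorial by simp
qed

section \<open>Localisations and stalks\<close>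

text \<open>Operations on fractions and germs are unions over all representatives. Once the result
  is known to be independent of them, the union collapses to its value at any one pair.\<close>

lemma UN_pairs_constant:
  assumes "(a, s) \<in> P" "(b, t) \<in> Q"
    and "\<And>a' s' b' t'. \<lbrakk>(a', s') \<in> P; (b', t') \<in> Q\<rbrakk> \<Longrightarrow> F a' s' b' t' = C"
  shows "(\<Union>(a', s')\<in>P. \<Union>(b', t')\<in>Q. F a' s' b' t') = C"
  using assms by fastforce

lemma UN_pair_constant:
  assumes "(a, s) \<in> P" "\<And>a' s'. (a', s') \<in> P \<Longrightarrow> F a' s' = C"
  shows "(\<Union>(a', s')\<in>P. F a' s') = C"
  using assms by fastforce

section \<open>Localisation at a multiplicative set\<close>

locale localization_ring = cring A for A (structure) +
  fixes S assumes S_sub: "S \<subseteq> carrier A" and S_one: "\<one> \<in> S"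
    and S_mult: "\<lbrakk>s \<in> S; t \<in> S\<rbrakk> \<Longrightarrow> s \<otimes> t \<in> S"
begin

abbreviation "fr \<equiv> loc_frac A S"

lemma S_carrier [simp]: "s \<in> S \<Longrightarrow> s \<in> carrier A"
  using S_sub by blast

lemma frac_mem_iff:
  assumes "a \<in> carrier A" "s \<in> S"
  shows "(b, t) \<in> fr a s \<longleftrightarrow> b \<in> carrier A \<and> t \<in> S \<and> (\<exists>u\<in>S. u \<otimes> (a \<otimes> t) = u \<otimes> (b \<otimes> s))"
proof -
  have "u \<otimes> (a \<otimes> t \<ominus> b \<otimes> s) = \<zero> \<longleftrightarrow> u \<otimes> (a \<otimes> t) = u \<otimes> (b \<otimes> s)"
    if "u \<in> S" "b \<in> carrier A" "t \<in> S" for u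
  proof -
    have "u \<otimes> (a \<otimes> t \<ominus> b \<otimes> s) = u \<otimes> (a \<otimes> t) \<ominus> u \<otimes> (b \<otimes> s)"
      using assms that by (simp add: minus_eq r_distr r_minus)
    then show ?thesis using assms that by simp
  qed
  then show ?thesis unfolding loc_frac_def by auto
qed

lemma frac_eq_iff:
  assumes a: "a \<in> carrier A" "s \<in> S" and b: "b \<in> carrier A" "t \<in> S"
  shows "fr a s = fr b t \<longleftrightarrow> (\<exists>u\<in>S. u \<otimes> (a \<otimes> t) = u \<otimes> (b \<otimes> s))"
proof
  assume "fr a s = fr b t"
  moreover have "(b, t) \<in> fr b t" using b S_one by (auto simp: frac_mem_iff)
  ultimately show "\<exists>u\<in>S. u \<otimes> (a \<otimes> t) = u \<otimes> (b \<otimes> s)" using frac_mem_iff[OF a] by auto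
next
  \<comment> \<open>Transitivity of equality of fractions. The multiplier
    \<open>u \<otimes> v \<otimes> t\<close> contains the middle denominator \<open>t\<close>, which
    cannot be cancelled when \<open>S\<close> contains zero divisors.\<close>
  have tr: "\<exists>w\<in>S. w \<otimes> (a \<otimes> r) = w \<otimes> (c \<otimes> s)"
    if "a \<in> carrier A" "s \<in> S" "b \<in> carrier A" "t \<in> S" "c \<in> carrier A" "r \<in> S"
      and u: "u \<in> S" "u \<otimes> (a \<otimes> t) = u \<otimes> (b \<otimes> s)" and v: "v \<in> S" "v \<otimes> (b \<otimes> r) = v \<otimes> (c \<otimes> t)"
    for a s b t c r u v
  proof
    have C: "s \<in> carrier A" "t \<in> carrier A" "r \<in> carrier A" "u \<in> carrier A" "v \<in> carrier A" using that by auto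
    have "(u \<otimes> v \<otimes> t) \<otimes> (a \<otimes> r) = (v \<otimes> r) \<otimes> (u \<otimes> (a \<otimes> t))" using C that(1) by algebra
    also have "\<dots> = (u \<otimes> s) \<otimes> (v \<otimes> (b \<otimes> r))" unfolding u(2) using C that(3) by algebra
    also have "\<dots> = (u \<otimes> v \<otimes> t) \<otimes> (c \<otimes> s)" unfolding v(2) using C that(5) by algebra
    finally show "(u \<otimes> v \<otimes> t) \<otimes> (a \<otimes> r) = (u \<otimes> v \<otimes> t) \<otimes> (c \<otimes> s)" .
    show "u \<otimes> v \<otimes> t \<in> S" using that S_mult by blast
  qed
  assume "\<exists>u\<in>S. u \<otimes> (a \<otimes> t) = u \<otimes> (b \<otimes> s)"
  then obtain u where u: "u \<in> S" "u \<otimes> (a \<otimes> t) = u \<otimes> (b \<otimes> s)" by blast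
  show "fr a s = fr b t"
  proof (rule Set.set_eqI)
    fix z :: "'a \<times> 'a"
    obtain c r where z: "z = (c, r)" by (cases z)
    show "z \<in> fr a s \<longleftrightarrow> z \<in> fr b t"
      unfolding z frac_mem_iff[OF a] frac_mem_iff[OF b]
    proof (intro conj_cong refl iffI; elim bexE)
      fix v assume "c \<in> carrier A" "r \<in> S" "v \<in> S" "v \<otimes> (a \<otimes> r) = v \<otimes> (c \<otimes> s)"
      then show "\<exists>u\<in>S. u \<otimes> (b \<otimes> r) = u \<otimes> (c \<otimes> t)" using tr[OF b a _ _ u(1) u(2)[symmetric]] by blast
    next
      fix v assume "c \<in> carrier A" "r \<in> S" "v \<in> S" "v \<otimes> (b \<otimes> r) = v \<otimes> (c \<otimes> t)"
      then show "\<exists>u\<in>S. u \<otimes> (a \<otimes> r) = u \<otimes> (c \<otimes> s)" using tr[OF a b _ _ u] by blast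
    qed
  qed
qed

lemma frac_eqI:
  "\<lbrakk>a \<in> carrier A; s \<in> S; b \<in> carrier A; t \<in> S; a \<otimes> t = b \<otimes> s\<rbrakk> \<Longrightarrow> fr a s = fr b t"
  using S_one by (subst frac_eq_iff) auto

abbreviation "L \<equiv> localization A S"

lemma L_carrier: "x \<in> carrier L \<longleftrightarrow> (\<exists>a s. a \<in> carrier A \<and> s \<in> S \<and> x = fr a s)"
  by (auto simp: localization_def)

lemma L_one: "\<one>\<^bsub>L\<^esub> = fr \<one> \<one>" and L_zero: "\<zero>\<^bsub>L\<^esub> = fr \<zero> \<one>"
  by (simp_all add: localization_def)

lemma frac_L: "\<lbrakk>a \<in> carrier A; s \<in> S\<rbrakk> \<Longrightarrow> fr a s \<in> carrier L"
  by (auto simp: L_carrier)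

lemma frac_self: "\<lbrakk>a \<in> carrier A; s \<in> S\<rbrakk> \<Longrightarrow> (a, s) \<in> fr a s"
  using S_one by (auto simp: frac_mem_iff)

lemma L_mult:
  assumes a: "a \<in> carrier A" "s \<in> S" and b: "b \<in> carrier A" "t \<in> S"
  shows "fr a s \<otimes>\<^bsub>L\<^esub> fr b t = fr (a \<otimes> b) (s \<otimes> t)"
proof -
  have "fr (a' \<otimes> b') (s' \<otimes> t') = fr (a \<otimes> b) (s \<otimes> t)"
    if "(a', s') \<in> fr a s" "(b', t') \<in> fr b t" for a' s' b' t'
  proof -
    from that obtain u v where C: "a' \<in> carrier A" "s' \<in> S" "b' \<in> carrier A" "t' \<in> S"
      and u: "u \<in> S" "u \<otimes> (a \<otimes> s') = u \<otimes> (a' \<otimes> s)" and v: "v \<in> S" "v \<otimes> (b \<otimes> t') = v \<otimes> (b' \<otimes> t)"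
      by (auto simp: frac_mem_iff a b)
    have C': "s' \<in> carrier A" "t' \<in> carrier A" "s \<in> carrier A" "t \<in> carrier A" "u \<in> carrier A" "v \<in> carrier A"
      using C a b u v by auto
    have "(u \<otimes> v) \<otimes> ((a' \<otimes> b') \<otimes> (s \<otimes> t)) = (u \<otimes> (a' \<otimes> s)) \<otimes> (v \<otimes> (b' \<otimes> t))"
      using C C' by algebra
    also have "\<dots> = (u \<otimes> v) \<otimes> ((a \<otimes> b) \<otimes> (s' \<otimes> t'))"
      unfolding u(2)[symmetric] v(2)[symmetric] using C' a b by algebra
    finally show ?thesis using C C' a b S_mult u v
      by (subst frac_eq_iff) (auto intro!: bexI[of _ "u \<otimes> v"])
  qed
  then show ?thesis unfolding localization_def
    by simp (rule UN_pairs_constant[OF frac_self[OF a] frac_self[OF b]], simp)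
qed

lemma L_add:
  assumes a: "a \<in> carrier A" "s \<in> S" and b: "b \<in> carrier A" "t \<in> S"
  shows "fr a s \<oplus>\<^bsub>L\<^esub> fr b t = fr (a \<otimes> t \<oplus> b \<otimes> s) (s \<otimes> t)"
proof -
  have "fr (a' \<otimes> t' \<oplus> b' \<otimes> s') (s' \<otimes> t') = fr (a \<otimes> t \<oplus> b \<otimes> s) (s \<otimes> t)"
    if "(a', s') \<in> fr a s" "(b', t') \<in> fr b t" for a' s' b' t'
  proof -
    from that obtain u v where C: "a' \<in> carrier A" "s' \<in> S" "b' \<in> carrier A" "t' \<in> S"
      and u: "u \<in> S" "u \<otimes> (a \<otimes> s') = u \<otimes> (a' \<otimes> s)" and v: "v \<in> S" "v \<otimes> (b \<otimes> t') = v \<otimes> (b' \<otimes> t)"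
      by (auto simp: frac_mem_iff a b)
    have C': "s' \<in> carrier A" "t' \<in> carrier A" "s \<in> carrier A" "t \<in> carrier A" "u \<in> carrier A" "v \<in> carrier A"
      using C a b u v by auto
    have "(u \<otimes> v) \<otimes> ((a' \<otimes> t' \<oplus> b' \<otimes> s') \<otimes> (s \<otimes> t))
        = (u \<otimes> (a' \<otimes> s)) \<otimes> (v \<otimes> t \<otimes> t') \<oplus> (v \<otimes> (b' \<otimes> t)) \<otimes> (u \<otimes> s \<otimes> s')"
      using C C' by algebra
    also have "\<dots> = (u \<otimes> v) \<otimes> ((a \<otimes> t \<oplus> b \<otimes> s) \<otimes> (s' \<otimes> t'))"
      unfolding u(2)[symmetric] v(2)[symmetric] using C' a b by algebra
    finally show ?thesis using C C' a b S_mult u v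
      by (subst frac_eq_iff) (auto intro!: bexI[of _ "u \<otimes> v"])
  qed
  then show ?thesis unfolding localization_def
    by simp (rule UN_pairs_constant[OF frac_self[OF a] frac_self[OF b]], simp)
qed

lemma cring_L: "cring L"
proof (rule cringI)
  show "abelian_group L"
  proof (rule abelian_groupI)
    fix x y assume "x \<in> carrier L" "y \<in> carrier L"
    then obtain a s b t where *: "a \<in> carrier A" "s \<in> S" "x = fr a s" "b \<in> carrier A" "t \<in> S" "y = fr b t"
      by (auto simp: L_carrier)
    show "x \<oplus>\<^bsub>L\<^esub> y \<in> carrier L" using * S_mult by (simp add: L_add frac_L)
    show "x \<oplus>\<^bsub>L\<^esub> y = y \<oplus>\<^bsub>L\<^esub> x" using * by (simp add: L_add m_comm a_comm)
    fix z assume "z \<in> carrier L"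
    then obtain c r where **: "c \<in> carrier A" "r \<in> S" "z = fr c r" by (auto simp: L_carrier)
    have C: "s \<in> carrier A" "t \<in> carrier A" "r \<in> carrier A" using * ** by auto
    have "(a \<otimes> t \<oplus> b \<otimes> s) \<otimes> r \<oplus> c \<otimes> (s \<otimes> t) = a \<otimes> (t \<otimes> r) \<oplus> (b \<otimes> r \<oplus> c \<otimes> t) \<otimes> s"
      using * ** C by algebra
    then show "x \<oplus>\<^bsub>L\<^esub> y \<oplus>\<^bsub>L\<^esub> z = x \<oplus>\<^bsub>L\<^esub> (y \<oplus>\<^bsub>L\<^esub> z)"
      using * ** C S_mult by (simp add: L_add m_assoc)
  next
    show "\<zero>\<^bsub>L\<^esub> \<in> carrier L" using S_one by (simp add: L_zero frac_L)
    fix x assume "x \<in> carrier L"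
    then obtain a s where *: "a \<in> carrier A" "s \<in> S" "x = fr a s" by (auto simp: L_carrier)
    show "\<zero>\<^bsub>L\<^esub> \<oplus>\<^bsub>L\<^esub> x = x" using * S_one by (simp add: L_zero L_add)
    have "fr (\<ominus> a) s \<oplus>\<^bsub>L\<^esub> x = fr (\<ominus> a \<otimes> s \<oplus> a \<otimes> s) (s \<otimes> s)" using * by (simp add: L_add)
    also have "\<dots> = \<zero>\<^bsub>L\<^esub>"
      unfolding L_zero using * S_one S_mult by (intro frac_eqI) (auto simp: l_minus l_neg)
    finally show "\<exists>y\<in>carrier L. y \<oplus>\<^bsub>L\<^esub> x = \<zero>\<^bsub>L\<^esub>" using * frac_L by blast
  qed
  show "comm_monoid L"
  proof (rule comm_monoidI)
    show "\<one>\<^bsub>L\<^esub> \<in> carrier L" using S_one by (simp add: L_one frac_L)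
  next
    fix x y assume "x \<in> carrier L" "y \<in> carrier L"
    then obtain a s b t where *: "a \<in> carrier A" "s \<in> S" "x = fr a s" "b \<in> carrier A" "t \<in> S" "y = fr b t"
      by (auto simp: L_carrier)
    show "x \<otimes>\<^bsub>L\<^esub> y \<in> carrier L" using * S_mult by (simp add: L_mult frac_L)
    show "x \<otimes>\<^bsub>L\<^esub> y = y \<otimes>\<^bsub>L\<^esub> x" using * by (simp add: L_mult m_comm)
    fix z assume "z \<in> carrier L"
    then obtain c r where **: "c \<in> carrier A" "r \<in> S" "z = fr c r" by (auto simp: L_carrier)
    show "x \<otimes>\<^bsub>L\<^esub> y \<otimes>\<^bsub>L\<^esub> z = x \<otimes>\<^bsub>L\<^esub> (y \<otimes>\<^bsub>L\<^esub> z)"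
      using * ** S_mult by (simp add: L_mult m_assoc)
  next
    fix x assume "x \<in> carrier L"
    then obtain a s where *: "a \<in> carrier A" "s \<in> S" "x = fr a s" by (auto simp: L_carrier)
    then show "\<one>\<^bsub>L\<^esub> \<otimes>\<^bsub>L\<^esub> x = x" using S_one by (simp add: L_one L_mult)
  qed
  fix x y z assume "x \<in> carrier L" "y \<in> carrier L" "z \<in> carrier L"
  then obtain a s b t c r where *: "a \<in> carrier A" "s \<in> S" "x = fr a s" "b \<in> carrier A" "t \<in> S" "y = fr b t"
    "c \<in> carrier A" "r \<in> S" "z = fr c r"
    by (auto simp: L_carrier)
  have C: "s \<in> carrier A" "t \<in> carrier A" "r \<in> carrier A" using * by auto
  have "(x \<oplus>\<^bsub>L\<^esub> y) \<otimes>\<^bsub>L\<^esub> z = fr ((a \<otimes> t \<oplus> b \<otimes> s) \<otimes> c) (s \<otimes> t \<otimes> r)"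
    using * S_mult by (simp add: L_add L_mult)
  also have "\<dots> = fr ((a \<otimes> c) \<otimes> (t \<otimes> r) \<oplus> (b \<otimes> c) \<otimes> (s \<otimes> r)) (s \<otimes> r \<otimes> (t \<otimes> r))"
  proof (rule frac_eqI)
    show "(a \<otimes> t \<oplus> b \<otimes> s) \<otimes> c \<otimes> (s \<otimes> r \<otimes> (t \<otimes> r))
        = (a \<otimes> c \<otimes> (t \<otimes> r) \<oplus> b \<otimes> c \<otimes> (s \<otimes> r)) \<otimes> (s \<otimes> t \<otimes> r)" using * C by algebra
  qed (use * S_mult in auto)
  also have "\<dots> = x \<otimes>\<^bsub>L\<^esub> z \<oplus>\<^bsub>L\<^esub> y \<otimes>\<^bsub>L\<^esub> z" using * S_mult by (simp add: L_add L_mult)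
  finally show "(x \<oplus>\<^bsub>L\<^esub> y) \<otimes>\<^bsub>L\<^esub> z = x \<otimes>\<^bsub>L\<^esub> z \<oplus>\<^bsub>L\<^esub> y \<otimes>\<^bsub>L\<^esub> z" .
qed

end

section \<open>Stalks and the maps between them\<close>

context sheaf_of_rings
begin

abbreviation "T \<equiv> pts \<XX>"
abbreviation "\<O> \<equiv> sections \<XX>"

lemma restr_closed [simp]:
  "\<lbrakk>openin T U; openin T V; V \<subseteq> U; s \<in> carrier (\<O> U)\<rbrakk> \<Longrightarrow> restr \<XX> U V s \<in> carrier (\<O> V)"
  using restr_hom ring_hom_closed by metis

lemma germ_mem:
  "(V, t) \<in> germ \<XX> x U s \<longleftrightarrow> openin T V \<and> x \<in> V \<and> t \<in> carrier (\<O> V) \<and>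
     (\<exists>W. openin T W \<and> x \<in> W \<and> W \<subseteq> U \<inter> V \<and> restr \<XX> U W s = restr \<XX> V W t)"
  by (simp add: germ_def)

definition local_section :: "'a \<Rightarrow> 'a set \<Rightarrow> 'b \<Rightarrow> bool" where
  "local_section x U s \<longleftrightarrow> openin T U \<and> x \<in> U \<and> s \<in> carrier (\<O> U)"

lemma germ_self: "local_section x U s \<Longrightarrow> (U, s) \<in> germ \<XX> x U s"
  by (auto simp: germ_mem local_section_def)

lemma germ_eq_iff:
  assumes U: "local_section x U s" and V: "local_section x V t"
  shows "germ \<XX> x U s = germ \<XX> x V t \<longleftrightarrow>
    (\<exists>W. openin T W \<and> x \<in> W \<and> W \<subseteq> U \<inter> V \<and> restr \<XX> U W s = restr \<XX> V W t)"
proof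
  assume "germ \<XX> x U s = germ \<XX> x V t"
  then have "(V, t) \<in> germ \<XX> x U s" using germ_self[OF V] by simp
  then show "\<exists>W. openin T W \<and> x \<in> W \<and> W \<subseteq> U \<inter> V \<and> restr \<XX> U W s = restr \<XX> V W t"
    by (simp add: germ_mem)
next
  have tr: "\<exists>W. openin T W \<and> x \<in> W \<and> W \<subseteq> U \<inter> N \<and> restr \<XX> U W s = restr \<XX> N W r"
    if "local_section x U s" "local_section x V t" "local_section x N r"
      and W: "openin T W" "x \<in> W" "W \<subseteq> U \<inter> V" "restr \<XX> U W s = restr \<XX> V W t"
      and W': "openin T W'" "x \<in> W'" "W' \<subseteq> V \<inter> N" "restr \<XX> V W' t = restr \<XX> N W' r" for U s V t N r W W'
  proof (intro exI conjI)
    have o: "openin T U" "openin T V" "openin T N" "s \<in> carrier (\<O> U)" "t \<in> carrier (\<O> V)" "r \<in> carrier (\<O> N)"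
      using that(1-3) by (auto simp: local_section_def)
    show oW: "openin T (W \<inter> W')" using W W' by blast
    have "restr \<XX> U (W \<inter> W') s = restr \<XX> W (W \<inter> W') (restr \<XX> U W s)"
      using restr_trans[OF o(1) W(1) oW _ _ o(4)] W by auto
    also have "\<dots> = restr \<XX> V (W \<inter> W') t"
      unfolding W(4) using restr_trans[OF o(2) W(1) oW _ _ o(5)] W by auto
    also have "\<dots> = restr \<XX> W' (W \<inter> W') (restr \<XX> V W' t)"
      using restr_trans[OF o(2) W'(1) oW _ _ o(5)] W' by auto
    also have "\<dots> = restr \<XX> N (W \<inter> W') r"
      unfolding W'(4) using restr_trans[OF o(3) W'(1) oW _ _ o(6)] W' by auto
    finally show "restr \<XX> U (W \<inter> W') s = restr \<XX> N (W \<inter> W') r" .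
  qed (use W W' in auto)
  assume "\<exists>W. openin T W \<and> x \<in> W \<and> W \<subseteq> U \<inter> V \<and> restr \<XX> U W s = restr \<XX> V W t"
  then obtain W where W: "openin T W" "x \<in> W" "W \<subseteq> U \<inter> V" "restr \<XX> U W s = restr \<XX> V W t" by blast
  show "germ \<XX> x U s = germ \<XX> x V t"
  proof (rule Set.set_eqI)
    fix z :: "'a set \<times> 'b"
    obtain N r where z: "z = (N, r)" by (cases z)
    have "local_section x N r \<Longrightarrow> (N, r) \<in> germ \<XX> x U s \<longleftrightarrow> (N, r) \<in> germ \<XX> x V t"
      unfolding germ_mem
      using tr[OF U V _ W, of N r] tr[OF V U _ W(1,2) _ W(4)[symmetric], of N r] W(3) by (metis Int_commute)
    moreover have "local_section x N r" if "(N, r) \<in> germ \<XX> x U s \<or> (N, r) \<in> germ \<XX> x V t"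
      using that by (auto simp: local_section_def germ_mem)
    ultimately show "z \<in> germ \<XX> x U s \<longleftrightarrow> z \<in> germ \<XX> x V t" unfolding z by blast
  qed
qed

lemma germ_mem_section: "(V, t) \<in> germ \<XX> x U s \<Longrightarrow> local_section x V t"
  by (simp add: germ_mem local_section_def)

lemma germ_restr:
  assumes "local_section x U s" "openin T V" "x \<in> V" "V \<subseteq> U"
  shows "germ \<XX> x V (restr \<XX> U V s) = germ \<XX> x U s" "local_section x V (restr \<XX> U V s)"
proof -
  have o: "openin T U" "s \<in> carrier (\<O> U)" using assms by (auto simp: local_section_def)
  show l: "local_section x V (restr \<XX> U V s)" using assms o by (simp add: local_section_def)
  show "germ \<XX> x V (restr \<XX> U V s) = germ \<XX> x U s"
    using germ_eq_iff[OF l assms(1)] assms o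
    by (metis Int_lower1 inf.order_iff restr_closed restr_id)
qed

lemma stalk_carrier: "P \<in> carrier (stalk \<XX> x) \<longleftrightarrow> (\<exists>U s. local_section x U s \<and> P = germ \<XX> x U s)"
  by (auto simp: stalk_def local_section_def)

lemma germ_common:
  assumes "local_section x U s" "local_section x V t"
  obtains W s' t' where "local_section x W s'" "local_section x W t'" "germ \<XX> x U s = germ \<XX> x W s'"
    "germ \<XX> x V t = germ \<XX> x W t'" "W \<subseteq> U" "W \<subseteq> V"
proof -
  have "openin T (U \<inter> V)" "x \<in> U \<inter> V" using assms by (auto simp: local_section_def)
  then show ?thesis
    using that germ_restr[OF assms(1), of "U \<inter> V"] germ_restr[OF assms(2), of "U \<inter> V"] by (metis Int_lower1 Int_lower2)
qed

lemma local_section_mult: "\<lbrakk>local_section x U s; local_section x U t\<rbrakk> \<Longrightarrow> local_section x U (s \<otimes>\<^bsub>\<O> U\<^esub> t)"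
  and local_section_add: "\<lbrakk>local_section x U s; local_section x U t\<rbrakk> \<Longrightarrow> local_section x U (s \<oplus>\<^bsub>\<O> U\<^esub> t)"
  and local_section_one: "\<lbrakk>openin T U; x \<in> U\<rbrakk> \<Longrightarrow> local_section x U \<one>\<^bsub>\<O> U\<^esub>"
  using sections_cring unfolding local_section_def
  by (auto intro: cring.cring_simprules simp: cring.cring_simprules)

text \<open>Treats addition and multiplication together: any binary operation on sections that
  commutes with restriction descends to germs, since two choices of representatives agree on a
  common smaller neighbourhood.\<close>

lemma germ_op:
  assumes op: "\<And>U s t. \<lbrakk>openin T U; s \<in> carrier (\<O> U); t \<in> carrier (\<O> U)\<rbrakk> \<Longrightarrow> op U s t \<in> carrier (\<O> U)"
    and res: "\<And>U V s t. \<lbrakk>openin T U; openin T V; V \<subseteq> U; s \<in> carrier (\<O> U); t \<in> carrier (\<O> U)\<rbrakk>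
       \<Longrightarrow> restr \<XX> U V (op U s t) = op V (restr \<XX> U V s) (restr \<XX> U V t)"
    and s: "local_section x U s" and t: "local_section x U t"
  shows "(\<Union>(V, s')\<in>germ \<XX> x U s. \<Union>(W, t')\<in>germ \<XX> x U t.
       germ \<XX> x (V \<inter> W) (op (V \<inter> W) (restr \<XX> V (V \<inter> W) s') (restr \<XX> W (V \<inter> W) t'))) = germ \<XX> x U (op U s t)"
proof -
  have "germ \<XX> x (V \<inter> W) (op (V \<inter> W) (restr \<XX> V (V \<inter> W) s') (restr \<XX> W (V \<inter> W) t')) = germ \<XX> x U (op U s t)"
    if m: "(V, s') \<in> germ \<XX> x U s" "(W, t') \<in> germ \<XX> x U t" for V s' W t'
  proof -
    note l = germ_mem_section[OF m(1)] germ_mem_section[OF m(2)]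
    have o: "openin T U" "openin T V" "openin T W" "openin T (V \<inter> W)" "x \<in> V \<inter> W" "x \<in> U"
      "s \<in> carrier (\<O> U)" "t \<in> carrier (\<O> U)" "s' \<in> carrier (\<O> V)" "t' \<in> carrier (\<O> W)"
      using l s t by (auto simp: local_section_def)
    obtain M where M: "openin T M" "x \<in> M" "M \<subseteq> U" "M \<subseteq> V" "restr \<XX> U M s = restr \<XX> V M s'"
      using m(1) unfolding germ_mem by (metis le_inf_iff)
    obtain N where N: "openin T N" "x \<in> N" "N \<subseteq> U" "N \<subseteq> W" "restr \<XX> U N t = restr \<XX> W N t'"
      using m(2) unfolding germ_mem by (metis le_inf_iff)
    let ?Q = "M \<inter> N"
    have Q: "openin T ?Q" "x \<in> ?Q" "?Q \<subseteq> U" "?Q \<subseteq> V \<inter> W" "?Q \<subseteq> M" "?Q \<subseteq> N" "?Q \<subseteq> V" "?Q \<subseteq> W" using M N by auto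
    have s': "restr \<XX> U ?Q s = restr \<XX> V ?Q s'"
      using restr_trans[OF o(1) M(1) Q(1,5) M(3) o(7)] restr_trans[OF o(2) M(1) Q(1,5) M(4) o(9)] M(5) by simp
    have t': "restr \<XX> U ?Q t = restr \<XX> W ?Q t'"
      using restr_trans[OF o(1) N(1) Q(1,6) N(3) o(8)] restr_trans[OF o(3) N(1) Q(1,6) N(4) o(10)] N(5) by simp
    let ?vs = "restr \<XX> V (V \<inter> W) s'" and ?wt = "restr \<XX> W (V \<inter> W) t'"
    have vw: "?vs \<in> carrier (\<O> (V \<inter> W))" "?wt \<in> carrier (\<O> (V \<inter> W))" using o by auto
    have "restr \<XX> (V \<inter> W) ?Q (op (V \<inter> W) ?vs ?wt) = op ?Q (restr \<XX> (V \<inter> W) ?Q ?vs) (restr \<XX> (V \<inter> W) ?Q ?wt)"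
      using res[OF o(4) Q(1,4) vw] .
    also have "restr \<XX> (V \<inter> W) ?Q ?vs = restr \<XX> V ?Q s'" using restr_trans[OF o(2,4) Q(1,4) _ o(9)] by simp
    also have "restr \<XX> (V \<inter> W) ?Q ?wt = restr \<XX> W ?Q t'" using restr_trans[OF o(3,4) Q(1,4) _ o(10)] by simp
    also have "op ?Q (restr \<XX> V ?Q s') (restr \<XX> W ?Q t') = restr \<XX> U ?Q (op U s t)"
      using res[OF o(1) Q(1,3) o(7,8)] s' t' by simp
    finally have "restr \<XX> (V \<inter> W) ?Q (op (V \<inter> W) ?vs ?wt) = restr \<XX> U ?Q (op U s t)" .
    moreover have "local_section x (V \<inter> W) (op (V \<inter> W) ?vs ?wt)" "local_section x U (op U s t)"
      using op o vw by (auto simp: local_section_def)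
    ultimately show ?thesis using Q by (subst germ_eq_iff) auto
  qed
  then show ?thesis by (intro UN_pairs_constant[OF germ_self[OF s] germ_self[OF t]])
qed

lemma stalk_mult:
  assumes "local_section x U s" "local_section x U t"
  shows "germ \<XX> x U s \<otimes>\<^bsub>stalk \<XX> x\<^esub> germ \<XX> x U t = germ \<XX> x U (s \<otimes>\<^bsub>\<O> U\<^esub> t)"
  unfolding stalk_def
  using germ_op[of "\<lambda>U s t. s \<otimes>\<^bsub>\<O> U\<^esub> t", OF _ _ assms] restr_hom sections_cring
  by (simp add: ring_hom_mult cring.cring_simprules)

lemma stalk_add:
  assumes "local_section x U s" "local_section x U t"
  shows "germ \<XX> x U s \<oplus>\<^bsub>stalk \<XX> x\<^esub> germ \<XX> x U t = germ \<XX> x U (s \<oplus>\<^bsub>\<O> U\<^esub> t)"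
  unfolding stalk_def
  using germ_op[of "\<lambda>U s t. s \<oplus>\<^bsub>\<O> U\<^esub> t", OF _ _ assms] restr_hom sections_cring
  by (simp add: ring_hom_add cring.cring_simprules)

lemma stalk_one:
  assumes "openin T U" "x \<in> U" shows "\<one>\<^bsub>stalk \<XX> x\<^esub> = germ \<XX> x U \<one>\<^bsub>\<O> U\<^esub>"
proof -
  have U: "U \<subseteq> topspace T" using assms openin_subset by blast
  have "restr \<XX> (topspace T) U \<one>\<^bsub>\<O> (topspace T)\<^esub> = \<one>\<^bsub>\<O> U\<^esub>"
    using restr_hom[OF _ assms(1) U] by (simp add: ring_hom_one)
  then show ?thesis
    using germ_restr(1)[OF local_section_one[of "topspace T" x] assms U] U assms
    by (auto simp: stalk_def)
qed

text \<open>Equivalently, \<open>x\<close> lies in the closure of \<open>y\<close>, see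
  \<open>in_closure_iff\<close>. The form with neighbourhoods is what the stalk map from
  \<open>x\<close> to \<open>y\<close> needs.\<close>

definition generalizes :: "'a \<Rightarrow> 'a \<Rightarrow> bool" where
  "generalizes y x \<longleftrightarrow> (\<forall>N. openin T N \<and> x \<in> N \<longrightarrow> y \<in> N)"

lemma cospecialize_germ:
  assumes "local_section x U s" and sp: "generalizes y x"
  shows "cospecialize \<XX> y (germ \<XX> x U s) = germ \<XX> y U s" "local_section y U s"
proof -
  show l: "local_section y U s" using assms by (simp add: local_section_def generalizes_def)
  have "germ \<XX> y V t = germ \<XX> y U s" if "(V, t) \<in> germ \<XX> x U s" for V t
  proof -
    have "local_section y V t" using germ_mem_section[OF that] sp by (simp add: local_section_def generalizes_def)
    then show ?thesis using that sp l by (subst germ_eq_iff) (auto simp: germ_mem generalizes_def)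
  qed
  then show "cospecialize \<XX> y (germ \<XX> x U s) = germ \<XX> y U s"
    unfolding cospecialize_def by (rule UN_pair_constant[OF germ_self[OF assms(1)]])
qed

lemma cospecialize_hom:
  assumes sp: "generalizes y x" and x: "x \<in> topspace T"
  shows "cospecialize \<XX> y \<in> ring_hom (stalk \<XX> x) (stalk \<XX> y)"
proof (rule ring_hom_memI)
  fix P assume "P \<in> carrier (stalk \<XX> x)"
  then obtain U s where P: "local_section x U s" "P = germ \<XX> x U s" by (auto simp: stalk_carrier)
  show "cospecialize \<XX> y P \<in> carrier (stalk \<XX> y)"
    unfolding stalk_carrier P(2) using cospecialize_germ[OF P(1) sp] by blast
  fix Q assume "Q \<in> carrier (stalk \<XX> x)"
  then obtain V t where Q: "local_section x V t" "Q = germ \<XX> x V t" by (auto simp: stalk_carrier)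
  obtain W s' t' where W: "local_section x W s'" "local_section x W t'" "P = germ \<XX> x W s'" "Q = germ \<XX> x W t'"
    unfolding P(2) Q(2) by (rule germ_common[OF P(1) Q(1)])
  note c = cospecialize_germ[OF W(1) sp] cospecialize_germ[OF W(2) sp]
  show "cospecialize \<XX> y (P \<otimes>\<^bsub>stalk \<XX> x\<^esub> Q) = cospecialize \<XX> y P \<otimes>\<^bsub>stalk \<XX> y\<^esub> cospecialize \<XX> y Q"
    unfolding W(3,4) c(1,3) stalk_mult[OF W(1,2)] stalk_mult[OF c(2,4)]
    by (rule cospecialize_germ(1)[OF local_section_mult[OF W(1,2)] sp])
  show "cospecialize \<XX> y (P \<oplus>\<^bsub>stalk \<XX> x\<^esub> Q) = cospecialize \<XX> y P \<oplus>\<^bsub>stalk \<XX> y\<^esub> cospecialize \<XX> y Q"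
    unfolding W(3,4) c(1,3) stalk_add[OF W(1,2)] stalk_add[OF c(2,4)]
    by (rule cospecialize_germ(1)[OF local_section_add[OF W(1,2)] sp])
next
  have y: "y \<in> topspace T" using sp x by (auto simp: generalizes_def)
  show "cospecialize \<XX> y \<one>\<^bsub>stalk \<XX> x\<^esub> = \<one>\<^bsub>stalk \<XX> y\<^esub>"
    unfolding stalk_one[OF openin_topspace x] stalk_one[OF openin_topspace y]
    by (rule cospecialize_germ(1)[OF local_section_one[OF openin_topspace x] sp])
qed

end

section \<open>Affine charts\<close>

context cring
begin

text \<open>The function \<open>topology\<close> yields the intended open sets only once they are
  known to form a topology. Primality gives intersections by \<open>I \<inter> J\<close>; a union
  comes from the ideal generated by all ideals whose open sets belong to the family.\<close>

lemma openin_zariski: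
  "openin (zariski R) V \<longleftrightarrow> (\<exists>I. ideal I R \<and> V = {p. primeideal p R \<and> \<not> I \<subseteq> p})"
proof -
  let ?N = "\<lambda>I. {p. primeideal p R \<and> \<not> I \<subseteq> p}"
  have "istopology (\<lambda>V. \<exists>I. ideal I R \<and> V = ?N I)"
    unfolding istopology_def
  proof (intro conjI allI impI)
    fix V W assume "\<exists>I. ideal I R \<and> V = ?N I" "\<exists>I. ideal I R \<and> W = ?N I"
    then obtain I J where IJ: "ideal I R" "V = ?N I" "ideal J R" "W = ?N J" by blast
    have "?N I \<inter> ?N J = ?N (I \<inter> J)"
    proof (intro equalityI subsetI)
      fix p assume p: "p \<in> ?N I \<inter> ?N J"
      then obtain a b where ab: "a \<in> I" "a \<notin> p" "b \<in> J" "b \<notin> p" by blast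
      have C: "a \<in> carrier R" "b \<in> carrier R"
        using ideal.Icarr[OF IJ(1) ab(1)] ideal.Icarr[OF IJ(3) ab(3)] by auto
      have "a \<otimes> b \<in> I \<inter> J"
        using ideal.I_r_closed[OF IJ(1) ab(1) C(2)] ideal.I_l_closed[OF IJ(3) ab(3) C(1)] by blast
      moreover have "a \<otimes> b \<notin> p" using primeideal.I_prime[of p R a b] p ab(2,4) C by blast
      ultimately show "p \<in> ?N (I \<inter> J)" using p by blast
    qed blast
    then show "\<exists>I. ideal I R \<and> V \<inter> W = ?N I"
      using i_intersect[OF IJ(1,3)] unfolding IJ(2,4) by blast
  next
    fix \<K> assume K: "\<forall>V\<in>\<K>. \<exists>I. ideal I R \<and> V = ?N I"
    let ?S = "\<Union>{I. ideal I R \<and> ?N I \<in> \<K>}"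
    have S: "?S \<subseteq> carrier R" using ideal.Icarr by fastforce
    have J: "ideal (Idl ?S) R" by (rule genideal_ideal[OF S])
    have sub: "Idl ?S \<subseteq> p \<longleftrightarrow> ?S \<subseteq> p" if "primeideal p R" for p
      using genideal_self[OF S] genideal_minimal[OF primeideal.axioms(1)[OF that]] by blast
    have "\<Union>\<K> = ?N (Idl ?S)"
    proof (intro equalityI subsetI)
      fix p assume "p \<in> \<Union>\<K>"
      then obtain V where V: "V \<in> \<K>" "p \<in> V" by blast
      then obtain I where I: "ideal I R" "V = ?N I" using K by blast
      then have p: "primeideal p R" "\<not> I \<subseteq> p" using V by auto
      have "I \<subseteq> ?S" using I V by blast
      then have "\<not> Idl ?S \<subseteq> p" using sub[OF p(1)] p(2) by blast
      then show "p \<in> ?N (Idl ?S)" using p by blast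
    next
      fix p assume "p \<in> ?N (Idl ?S)"
      then have p: "primeideal p R" "\<not> ?S \<subseteq> p" using sub by blast+
      then obtain I where "ideal I R" "?N I \<in> \<K>" "\<not> I \<subseteq> p" by blast
      then show "p \<in> \<Union>\<K>" using p by blast
    qed
    then show "\<exists>I. ideal I R \<and> \<Union>\<K> = ?N I" using J by blast
  qed
  then show ?thesis unfolding zariski_def by (simp add: topology_inverse')
qed

lemma topspace_zariski: "topspace (zariski R) = {p. primeideal p R}"
proof
  show "topspace (zariski R) \<subseteq> {p. primeideal p R}"
    using openin_topspace[of "zariski R"] unfolding openin_zariski by blast
  have "\<not> carrier R \<subseteq> p" if "primeideal p R" for p
    using primeideal.I_notcarr[OF that] ideal.Icarr[OF primeideal.axioms(1)[OF that]] by blast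
  then have "openin (zariski R) {p. primeideal p R}"
    unfolding openin_zariski by (intro exI[of _ "carrier R"]) (auto simp: oneideal)
  then show "{p. primeideal p R} \<subseteq> topspace (zariski R)" by (rule openin_subset)
qed

lemma openin_basic: assumes "s \<in> carrier R" shows "openin (zariski R) {p. primeideal p R \<and> s \<notin> p}"
proof -
  have "PIdl s \<subseteq> p \<longleftrightarrow> s \<in> p" if "primeideal p R" for p
    using cgenideal_self[OF assms] cgenideal_minimal[OF primeideal.axioms(1)[OF that]] by blast
  then have "{p. primeideal p R \<and> s \<notin> p} = {p. primeideal p R \<and> \<not> PIdl s \<subseteq> p}" by blast
  then show ?thesis unfolding openin_zariski using cgenideal_ideal[OF assms] by blast
qed

lemma localization_ring_prime:
  assumes "primeideal p R" shows "localization_ring R (carrier R - p)"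
proof (unfold_locales)
  interpret primeideal p R by (rule assms)
  show "\<one> \<in> carrier R - p" using one_imp_carrier I_notcarr by auto
  show "s \<otimes> t \<in> carrier R - p" if "s \<in> carrier R - p" "t \<in> carrier R - p" for s t
    using that I_prime by auto
qed blast

end

section \<open>From isomorphisms with a spectrum to charts\<close>

context sheaf_of_rings
begin

text \<open>An affine chart with coordinate ring \<open>A\<close>, reduced to the identification of \<open>U\<close> with the set of
  primes of \<open>A\<close> and to the maps \<open>A \<rightarrow> \<O>\<^sub>x\<close>, which make \<open>\<O>\<^sub>x\<close> a localisation of \<open>A\<close> at \<open>p x\<close>.\<close>

definition chart :: "'a set \<Rightarrow> 'b ring \<Rightarrow> ('a \<Rightarrow> 'b set) \<Rightarrow> ('a \<Rightarrow> 'b \<Rightarrow> ('a set \<times> 'b) set) \<Rightarrow> bool" where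
  "chart U A p \<psi> \<longleftrightarrow>
     openin T U \<and> cring A \<and> bij_betw p U {q. primeideal q A} \<and>
     (\<forall>s\<in>carrier A. openin T {x \<in> U. s \<notin> p x}) \<and>
     (\<forall>N x. openin T N \<and> N \<subseteq> U \<and> x \<in> N \<longrightarrow> (\<exists>s\<in>carrier A - p x. \<forall>y\<in>U. s \<notin> p y \<longrightarrow> y \<in> N)) \<and>
     (\<forall>x\<in>U. \<forall>y\<in>U. generalizes y x \<longleftrightarrow> p y \<subseteq> p x) \<and>
     (\<forall>x\<in>U. \<psi> x \<in> ring_hom A (stalk \<XX> x) \<and>
        (\<forall>s\<in>carrier A - p x. \<exists>v\<in>carrier (stalk \<XX> x). v \<otimes>\<^bsub>stalk \<XX> x\<^esub> \<psi> x s = \<one>\<^bsub>stalk \<XX> x\<^esub>) \<and>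
        (\<forall>g\<in>carrier (stalk \<XX> x). \<exists>a\<in>carrier A. \<exists>s\<in>carrier A - p x. g \<otimes>\<^bsub>stalk \<XX> x\<^esub> \<psi> x s = \<psi> x a) \<and>
        (\<forall>a\<in>carrier A. \<psi> x a = \<psi> x \<zero>\<^bsub>A\<^esub> \<longrightarrow> (\<exists>s\<in>carrier A - p x. s \<otimes>\<^bsub>A\<^esub> a = \<zero>\<^bsub>A\<^esub>))) \<and>
     (\<forall>x\<in>U. \<forall>y\<in>U. generalizes y x \<longrightarrow> (\<forall>a\<in>carrier A. cospecialize \<XX> y (\<psi> x a) = \<psi> y a))"

end

text \<open>The data of an isomorphism from the open subspace to the spectrum, with the map on
  sections directed from the spectrum to the scheme.\<close>

locale spec_chart = sheaf_of_rings \<XX> + A: cring A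
  for \<XX> :: "('a, 'b) ringed_space" and A :: "'b ring" +
  fixes U :: "'a set" and f :: "'a \<Rightarrow> 'b set" and \<phi> :: "'b set set \<Rightarrow> ('b set \<Rightarrow> ('b \<times> 'b) set) \<Rightarrow> 'b"
  assumes U: "openin T U"
    and homeo: "homeomorphic_map (subtopology T U) (zariski A) f"
    and iso: "openin (zariski A) V \<Longrightarrow> \<phi> V \<in> ring_iso (Spec_sections A V) (\<O> {x \<in> U. f x \<in> V})"
    and nat: "\<lbrakk>openin (zariski A) V; openin (zariski A) W; W \<subseteq> V; s \<in> carrier (Spec_sections A V)\<rbrakk>
      \<Longrightarrow> \<phi> W (restrict s W) = restr \<XX> {x \<in> U. f x \<in> V} {x \<in> U. f x \<in> W} (\<phi> V s)"
begin

abbreviation "Z \<equiv> zariski A"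
abbreviation "pre V \<equiv> {x \<in> U. f x \<in> V}"

lemma U_top: "topspace (subtopology T U) = U"
  using U openin_subset by (auto simp: topspace_subtopology)

lemma f_bij: "bij_betw f U {q. primeideal q A}"
  using homeomorphic_imp_surjective_map[OF homeo]
    homeomorphic_imp_injective_map[OF homeo]
  unfolding U_top A.topspace_zariski bij_betw_def by blast

lemma f_prime: "x \<in> U \<Longrightarrow> primeideal (f x) A"
  using bij_betwE[OF f_bij] by blast

lemma open_prime: "openin Z V \<Longrightarrow> q \<in> V \<Longrightarrow> primeideal q A"
  using openin_subset[of Z V] A.topspace_zariski by blast

lemma pre_open: assumes "openin Z V" shows "openin T (pre V)"
proof -
  have "openin (subtopology T U) {x \<in> topspace (subtopology T U). f x \<in> V}"
    using openin_continuous_map_preimage[OF homeomorphic_imp_continuous_map[OF homeo] assms] .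
  then show ?thesis unfolding U_top using openin_trans_full[OF _ U] by blast
qed

lemma open_pre:
  assumes N: "openin T N" "N \<subseteq> U" shows "openin Z (f ` N)" "N = pre (f ` N)"
proof -
  have "openin (subtopology T U) N" using N U by (simp add: openin_open_subtopology)
  then show "openin Z (f ` N)"
    using homeomorphic_imp_open_map[OF homeo] unfolding open_map_def by blast
  show "N = pre (f ` N)" using f_bij N(2) unfolding bij_betw_def inj_on_def by blast
qed

lemma loc: "primeideal q A \<Longrightarrow> localization_ring A (carrier A - q)"
  by (rule A.localization_ring_prime)

definition sec :: "'b set set \<Rightarrow> 'b \<Rightarrow> 'b \<Rightarrow> 'b set \<Rightarrow> ('b \<times> 'b) set" where
  "sec V a g = (\<lambda>q\<in>V. loc_frac A (carrier A - q) a g)"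

definition den :: "'b set set \<Rightarrow> 'b \<Rightarrow> bool" where
  "den V g \<longleftrightarrow> g \<in> carrier A \<and> (\<forall>q\<in>V. g \<notin> q)"

lemma den_one: "openin Z V \<Longrightarrow> den V \<one>\<^bsub>A\<^esub>"
  using open_prime loc localization_ring.S_one unfolding den_def by fastforce

lemma sec_carrier:
  assumes V: "openin Z V" and a: "a \<in> carrier A" and g: "den V g"
  shows "sec V a g \<in> carrier (Spec_sections A V)"
proof -
  have "loc_frac A (carrier A - q) a g \<in> carrier (local_at A q)" if "q \<in> V" for q
    using localization_ring.frac_L[OF loc[OF open_prime[OF V that]] a] g that
    unfolding local_at_def den_def by simp
  then have "sec V a g \<in> (\<Pi>\<^sub>E q\<in>V. carrier (local_at A q))" unfolding sec_def by auto
  moreover have "\<forall>q\<in>V. g \<notin> q \<and> sec V a g q = loc_frac A (carrier A - q) a g"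
    using g by (auto simp: sec_def den_def)
  moreover have "\<exists>W. openin Z W \<and> q \<in> W \<and> W \<subseteq> V \<and> (\<exists>a'\<in>carrier A. \<exists>g'\<in>carrier A. \<forall>q\<in>W.
      g' \<notin> q \<and> sec V a g q = loc_frac A (carrier A - q) a' g')" if "q \<in> V" for q
    using calculation(2) V a g that unfolding den_def by (intro exI[of _ V]) blast
  ultimately show ?thesis unfolding Spec_sections_def by simp
qed

lemma sec_mult:
  assumes V: "openin Z V" and a: "a \<in> carrier A" "den V g" and b: "b \<in> carrier A" "den V h"
  shows "sec V a g \<otimes>\<^bsub>Spec_sections A V\<^esub> sec V b h = sec V (a \<otimes>\<^bsub>A\<^esub> b) (g \<otimes>\<^bsub>A\<^esub> h)"
proof -
  have "loc_frac A (carrier A - q) a g \<otimes>\<^bsub>local_at A q\<^esub> loc_frac A (carrier A - q) b h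
      = loc_frac A (carrier A - q) (a \<otimes>\<^bsub>A\<^esub> b) (g \<otimes>\<^bsub>A\<^esub> h)" if "q \<in> V" for q
    using localization_ring.L_mult[OF loc[OF open_prime[OF V that]] a(1) _ b(1)] a b that
    unfolding local_at_def den_def by simp
  then show ?thesis unfolding Spec_sections_def sec_def by (simp cong: restrict_cong)
qed

lemma sec_add:
  assumes V: "openin Z V" and a: "a \<in> carrier A" and b: "b \<in> carrier A"
  shows "sec V a \<one>\<^bsub>A\<^esub> \<oplus>\<^bsub>Spec_sections A V\<^esub> sec V b \<one>\<^bsub>A\<^esub> = sec V (a \<oplus>\<^bsub>A\<^esub> b) \<one>\<^bsub>A\<^esub>"
proof -
  have "loc_frac A (carrier A - q) a \<one>\<^bsub>A\<^esub> \<oplus>\<^bsub>local_at A q\<^esub> loc_frac A (carrier A - q) b \<one>\<^bsub>A\<^esub>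
      = loc_frac A (carrier A - q) (a \<oplus>\<^bsub>A\<^esub> b) \<one>\<^bsub>A\<^esub>" if "q \<in> V" for q
    using localization_ring.L_add[OF loc[OF open_prime[OF V that]] a _ b] den_one[OF V] that a b
    unfolding local_at_def den_def by simp
  then show ?thesis unfolding Spec_sections_def sec_def by (simp cong: restrict_cong)
qed

lemma sec_eqI:
  assumes V: "openin Z V" and a: "a \<in> carrier A" "den V g" and b: "b \<in> carrier A" "den V h"
    and eq: "a \<otimes>\<^bsub>A\<^esub> h = b \<otimes>\<^bsub>A\<^esub> g"
  shows "sec V a g = sec V b h"
  unfolding sec_def
proof (rule restrict_ext)
  fix q assume q: "q \<in> V"
  show "loc_frac A (carrier A - q) a g = loc_frac A (carrier A - q) b h"
    by (rule localization_ring.frac_eqI[OF loc[OF open_prime[OF V q]]])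
      (use a b q eq in \<open>auto simp: den_def\<close>)
qed

lemma sec_one: "openin Z V \<Longrightarrow> \<one>\<^bsub>Spec_sections A V\<^esub> = sec V \<one>\<^bsub>A\<^esub> \<one>\<^bsub>A\<^esub>"
  using localization_ring.L_one[OF loc[OF open_prime]]
  unfolding Spec_sections_def sec_def local_at_def by (auto intro!: restrict_ext)

definition ev :: "'b set set \<Rightarrow> 'b \<Rightarrow> 'b \<Rightarrow> 'b" where "ev V a g = \<phi> V (sec V a g)"

lemma phi: "openin Z V \<Longrightarrow> \<phi> V \<in> ring_hom (Spec_sections A V) (\<O> (pre V))"
    "openin Z V \<Longrightarrow> bij_betw (\<phi> V) (carrier (Spec_sections A V)) (carrier (\<O> (pre V)))"
  using iso unfolding ring_iso_def by auto

lemma ev_section: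
  assumes "openin Z V" "a \<in> carrier A" "den V g" "x \<in> U" "f x \<in> V"
  shows "local_section x (pre V) (ev V a g)"
  using pre_open[OF assms(1)] ring_hom_closed[OF phi(1)[OF assms(1)] sec_carrier[OF assms(1-3)]] assms(4,5)
  by (simp add: local_section_def ev_def)

lemma ev_restr:
  assumes V: "openin Z V" "openin Z W" "W \<subseteq> V" and a: "a \<in> carrier A" "den V g" and x: "x \<in> U" "f x \<in> W"
  shows "germ \<XX> x (pre V) (ev V a g) = germ \<XX> x (pre W) (ev W a g)"
proof -
  have "restrict (sec V a g) W = sec W a g" using V(3) by (auto simp: sec_def restrict_def fun_eq_iff)
  then have "ev W a g = restr \<XX> (pre V) (pre W) (ev V a g)"
    using nat[OF V sec_carrier[OF V(1) a]] by (simp add: ev_def)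
  moreover have "f x \<in> V" using x V by blast
  ultimately show ?thesis
    using germ_restr(1)[OF ev_section[OF V(1) a x(1)] pre_open[OF V(2)]] x V(3) by auto
qed

text \<open>The germ of the global section \<open>a/1\<close>. By \<open>psi\<close>, any open set
  around the point gives the same germ.\<close>

definition \<psi> :: "'a \<Rightarrow> 'b \<Rightarrow> ('a set \<times> 'b) set" where
  "\<psi> x a = germ \<XX> x (pre (topspace Z)) (ev (topspace Z) a \<one>\<^bsub>A\<^esub>)"

lemma psi:
  assumes "openin Z V" "a \<in> carrier A" "x \<in> U" "f x \<in> V"
  shows "\<psi> x a = germ \<XX> x (pre V) (ev V a \<one>\<^bsub>A\<^esub>)"
  unfolding \<psi>_def
  by (rule ev_restr) (use assms openin_subset den_one[OF openin_topspace] in auto)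

lemma germ_ev_mult:
  assumes V: "openin Z V" and a: "a \<in> carrier A" "den V g" and b: "b \<in> carrier A" "den V h" and x: "x \<in> U" "f x \<in> V"
  shows "germ \<XX> x (pre V) (ev V a g) \<otimes>\<^bsub>stalk \<XX> x\<^esub> germ \<XX> x (pre V) (ev V b h)
    = germ \<XX> x (pre V) (ev V (a \<otimes>\<^bsub>A\<^esub> b) (g \<otimes>\<^bsub>A\<^esub> h))"
  unfolding stalk_mult[OF ev_section[OF V a x] ev_section[OF V b x]]
  using ring_hom_mult[OF phi(1)[OF V] sec_carrier[OF V a] sec_carrier[OF V b]] sec_mult[OF V a b]
  by (simp add: ev_def)

lemma f_top: "x \<in> U \<Longrightarrow> f x \<in> topspace Z"
  using f_prime A.topspace_zariski by auto

lemma psi_hom: assumes x: "x \<in> U" shows "\<psi> x \<in> ring_hom A (stalk \<XX> x)"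
proof (rule ring_hom_memI)
  note V = openin_topspace[of Z] and t = f_top[OF x] and d = den_one[OF openin_topspace[of Z]]
  fix a assume a: "a \<in> carrier A"
  show "\<psi> x a \<in> carrier (stalk \<XX> x)"
    unfolding \<psi>_def stalk_carrier using ev_section[OF V a d x t] by blast
  fix b assume b: "b \<in> carrier A"
  show "\<psi> x (a \<otimes>\<^bsub>A\<^esub> b) = \<psi> x a \<otimes>\<^bsub>stalk \<XX> x\<^esub> \<psi> x b"
    unfolding \<psi>_def germ_ev_mult[OF V a d b d x t] by simp
  show "\<psi> x (a \<oplus>\<^bsub>A\<^esub> b) = \<psi> x a \<oplus>\<^bsub>stalk \<XX> x\<^esub> \<psi> x b"
    unfolding \<psi>_def stalk_add[OF ev_section[OF V a d x t] ev_section[OF V b d x t]]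
    using ring_hom_add[OF phi(1)[OF V] sec_carrier[OF V a d] sec_carrier[OF V b d]] sec_add[OF V a b]
    by (simp add: ev_def)
next
  note V = openin_topspace[of Z]
  have "\<phi> (topspace Z) (sec (topspace Z) \<one>\<^bsub>A\<^esub> \<one>\<^bsub>A\<^esub>) = \<one>\<^bsub>\<O> (pre (topspace Z))\<^esub>"
    using ring_hom_one[OF phi(1)[OF V]] sec_one[OF V] by simp
  then show "\<psi> x \<one>\<^bsub>A\<^esub> = \<one>\<^bsub>stalk \<XX> x\<^esub>"
    unfolding \<psi>_def ev_def using stalk_one[OF pre_open[OF V], of x] x f_top by simp
qed

text \<open>Expresses that the germ is \<open>a/g\<close> without dividing: multiplied by the image
  of \<open>g\<close>, it becomes the image of \<open>a\<close>.\<close>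

lemma germ_ev:
  assumes V: "openin Z V" and a: "a \<in> carrier A" "den V g" and x: "x \<in> U" "f x \<in> V"
  shows "germ \<XX> x (pre V) (ev V a g) \<otimes>\<^bsub>stalk \<XX> x\<^esub> \<psi> x g = \<psi> x a"
proof -
  have g: "g \<in> carrier A" using a by (simp add: den_def)
  have "sec V (a \<otimes>\<^bsub>A\<^esub> g) (g \<otimes>\<^bsub>A\<^esub> \<one>\<^bsub>A\<^esub>) = sec V a \<one>\<^bsub>A\<^esub>"
    using a g den_one[OF V] by (intro sec_eqI[OF V]) auto
  then have "ev V (a \<otimes>\<^bsub>A\<^esub> g) (g \<otimes>\<^bsub>A\<^esub> \<one>\<^bsub>A\<^esub>) = ev V a \<one>\<^bsub>A\<^esub>" by (simp only: ev_def)
  then show ?thesis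
    unfolding psi[OF V g x] psi[OF V a(1) x] germ_ev_mult[OF V a g den_one[OF V] x] by (rule arg_cong)
qed

lemma Spec_section_local:
  assumes "\<sigma> \<in> carrier (Spec_sections A V)" "q \<in> V"
  obtains W a g where "openin Z W" "q \<in> W" "W \<subseteq> V" "a \<in> carrier A" "g \<in> carrier A"
    "\<forall>q\<in>W. g \<notin> q \<and> \<sigma> q = loc_frac A (carrier A - q) a g"
  using assms unfolding Spec_sections_def by simp blast

text \<open>A germ is shrunk into the chart and carried to the spectrum, where by definition
  sections are locally fractions.\<close>

lemma stalk_fraction:
  assumes x: "x \<in> U" and P: "P \<in> carrier (stalk \<XX> x)"
  shows "\<exists>a\<in>carrier A. \<exists>g\<in>carrier A - f x. P \<otimes>\<^bsub>stalk \<XX> x\<^esub> \<psi> x g = \<psi> x a"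
proof -
  obtain N s where N: "local_section x N s" "P = germ \<XX> x N s" using P stalk_carrier by auto
  let ?N = "N \<inter> U" let ?V = "f ` ?N"
  have oN: "openin T ?N" "?N \<subseteq> U" "x \<in> ?N" using N U x by (auto simp: local_section_def)
  note V = open_pre[OF oN(1,2)]
  define s' where "s' = restr \<XX> N ?N s"
  have s': "germ \<XX> x ?N s' = P" "local_section x ?N s'"
    using germ_restr[OF N(1) oN(1,3)] N(2) by (auto simp: s'_def)
  then have "s' \<in> carrier (\<O> (pre ?V))" using V(2) by (metis local_section_def)
  then obtain \<sigma> where \<sigma>: "\<sigma> \<in> carrier (Spec_sections A ?V)" "s' = \<phi> ?V \<sigma>"
    using phi(2)[OF V(1)] unfolding bij_betw_def by blast
  have fx: "f x \<in> ?V" using oN by blast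
  then obtain W a g where W: "openin Z W" "f x \<in> W" "W \<subseteq> ?V" "a \<in> carrier A" "g \<in> carrier A"
    "\<forall>q\<in>W. g \<notin> q \<and> \<sigma> q = loc_frac A (carrier A - q) a g"
    using Spec_section_local[OF \<sigma>(1)] by metis
  have "restrict \<sigma> W = sec W a g" using W(6) by (auto simp: sec_def intro!: restrict_ext)
  then have "ev W a g = restr \<XX> (pre ?V) (pre W) (\<phi> ?V \<sigma>)"
    using nat[OF V(1) W(1,3) \<sigma>(1)] by (simp add: ev_def)
  then have "ev W a g = restr \<XX> ?N (pre W) s'" using V(2) \<sigma>(2) by simp
  moreover have "pre W \<subseteq> ?N" using W(3) V(2) by blast
  ultimately have "germ \<XX> x (pre W) (ev W a g) = P"
    using germ_restr(1)[OF s'(2) pre_open[OF W(1)]] s'(1) x W(2) by auto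
  moreover have "den W g" using W by (simp add: den_def)
  ultimately show ?thesis using germ_ev[OF W(1,4) _ x W(2)] W(2,4,5,6) by blast
qed

lemma psi_unit:
  assumes x: "x \<in> U" and g: "g \<in> carrier A - f x"
  shows "\<exists>v\<in>carrier (stalk \<XX> x). v \<otimes>\<^bsub>stalk \<XX> x\<^esub> \<psi> x g = \<one>\<^bsub>stalk \<XX> x\<^esub>"
proof -
  let ?V = "{q. primeideal q A \<and> g \<notin> q}"
  have V: "openin Z ?V" using A.openin_basic g by blast
  have d: "den ?V g" "f x \<in> ?V" using g f_prime[OF x] by (auto simp: den_def)
  have "germ \<XX> x (pre ?V) (ev ?V \<one>\<^bsub>A\<^esub> g) \<in> carrier (stalk \<XX> x)"
    unfolding stalk_carrier using ev_section[OF V A.one_closed d(1) x d(2)] by blast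
  moreover have "\<psi> x \<one>\<^bsub>A\<^esub> = \<one>\<^bsub>stalk \<XX> x\<^esub>" using ring_hom_one[OF psi_hom[OF x]] .
  ultimately show ?thesis using germ_ev[OF V A.one_closed d(1) x d(2)] by auto
qed

text \<open>Equality of germs means equality on a neighbourhood; injectivity of
  \<open>\<phi>\<close> carries it back to the spectrum, where evaluation at the point
  \<open>f x\<close> gives an equality of fractions and hence an annihilator outside
  \<open>f x\<close>.\<close>

lemma psi_zero:
  assumes x: "x \<in> U" and a: "a \<in> carrier A" and eq: "\<psi> x a = \<psi> x \<zero>\<^bsub>A\<^esub>"
  shows "\<exists>s\<in>carrier A - f x. s \<otimes>\<^bsub>A\<^esub> a = \<zero>\<^bsub>A\<^esub>"
proof -
  let ?V = "topspace Z"
  note V = openin_topspace[of Z] and t = f_top[OF x]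
  note d = den_one[OF V]
  obtain W where W: "openin T W" "x \<in> W" "W \<subseteq> pre ?V"
    "restr \<XX> (pre ?V) W (ev ?V a \<one>\<^bsub>A\<^esub>) = restr \<XX> (pre ?V) W (ev ?V \<zero>\<^bsub>A\<^esub> \<one>\<^bsub>A\<^esub>)"
    using eq unfolding \<psi>_def germ_eq_iff[OF ev_section[OF V a d x t] ev_section[OF V A.zero_closed d x t]] by auto
  have "W \<subseteq> U" using W by blast
  note fW = open_pre[OF W(1) this]
  have sub: "f ` W \<subseteq> ?V" using openin_subset[OF fW(1)] .
  have rs: "restrict (sec ?V b \<one>\<^bsub>A\<^esub>) (f ` W) = sec (f ` W) b \<one>\<^bsub>A\<^esub>" for b
    using sub by (auto simp: sec_def restrict_def fun_eq_iff)
  have ev: "ev (f ` W) b \<one>\<^bsub>A\<^esub> = restr \<XX> (pre ?V) W (ev ?V b \<one>\<^bsub>A\<^esub>)" if "b \<in> carrier A" for b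
    using nat[OF V fW(1) sub sec_carrier[OF V that d]] fW(2) rs by (simp add: ev_def)
  have "ev (f ` W) a \<one>\<^bsub>A\<^esub> = ev (f ` W) \<zero>\<^bsub>A\<^esub> \<one>\<^bsub>A\<^esub>" using W(4) ev[OF a] ev[OF A.zero_closed] by simp
  then have eqs: "sec (f ` W) a \<one>\<^bsub>A\<^esub> = sec (f ` W) \<zero>\<^bsub>A\<^esub> \<one>\<^bsub>A\<^esub>"
    using phi(2)[OF fW(1)] sec_carrier[OF fW(1) a den_one[OF fW(1)]]
      sec_carrier[OF fW(1) A.zero_closed den_one[OF fW(1)]]
    unfolding bij_betw_def inj_on_def ev_def by blast
  have fx: "f x \<in> f ` W" using W by blast
  have "loc_frac A (carrier A - f x) a \<one>\<^bsub>A\<^esub> = loc_frac A (carrier A - f x) \<zero>\<^bsub>A\<^esub> \<one>\<^bsub>A\<^esub>"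
    using fun_cong[OF eqs, of "f x"] fx unfolding sec_def by (simp only: restrict_apply')
  moreover have "\<one>\<^bsub>A\<^esub> \<in> carrier A - f x" using localization_ring.S_one[OF loc[OF f_prime[OF x]]] .
  ultimately obtain u where u: "u \<in> carrier A - f x" "u \<otimes>\<^bsub>A\<^esub> (a \<otimes>\<^bsub>A\<^esub> \<one>\<^bsub>A\<^esub>) = u \<otimes>\<^bsub>A\<^esub> (\<zero>\<^bsub>A\<^esub> \<otimes>\<^bsub>A\<^esub> \<one>\<^bsub>A\<^esub>)"
    using localization_ring.frac_eq_iff[OF loc[OF f_prime[OF x]] a _ A.zero_closed] by blast
  then show ?thesis using a by auto
qed

text \<open>The complement of an open set in the spectrum consists of the primes containing some
  ideal, so it is stable under enlarging the prime; conversely the basic open set of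
  \<open>a\<close> separates two primes as soon as \<open>a\<close> lies in one only.\<close>

lemma f_specialization:
  assumes xy: "x \<in> U" "y \<in> U" shows "generalizes y x \<longleftrightarrow> f y \<subseteq> f x"
proof
  assume g: "generalizes y x"
  show "f y \<subseteq> f x"
  proof
    fix a assume a: "a \<in> f y"
    then have aA: "a \<in> carrier A" using ideal.Icarr[OF primeideal.axioms(1)[OF f_prime[OF xy(2)]]] by blast
    show "a \<in> f x"
    proof (rule ccontr)
      assume "a \<notin> f x"
      then have "x \<in> pre {q. primeideal q A \<and> a \<notin> q}" using xy f_prime by auto
      then have "y \<in> pre {q. primeideal q A \<and> a \<notin> q}"
        using g pre_open[OF A.openin_basic[OF aA]] unfolding generalizes_def by blast
      then show False using a by auto
    qed
  qed
next
  assume sub: "f y \<subseteq> f x"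
  show "generalizes y x" unfolding generalizes_def
  proof (intro allI impI, elim conjE)
    fix N assume N: "openin T N" "x \<in> N"
    have "openin T (N \<inter> U)" "N \<inter> U \<subseteq> U" using N U by auto
    note V = open_pre[OF this]
    obtain I where I: "f ` (N \<inter> U) = {p. primeideal p A \<and> \<not> I \<subseteq> p}"
      using V(1) unfolding A.openin_zariski by blast
    have "f x \<in> f ` (N \<inter> U)" using N xy by blast
    then have "f y \<in> f ` (N \<inter> U)" unfolding I using sub f_prime[OF xy(2)] by blast
    then have "y \<in> N \<inter> U" using V(2) xy(2) by blast
    then show "y \<in> N" by blast
  qed
qed

lemma chart: "chart U A f \<psi>"
  unfolding chart_def
proof (intro conjI ballI impI allI)
  fix N x assume N: "openin T N \<and> N \<subseteq> U \<and> x \<in> N"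
  then have "openin T N" "N \<subseteq> U" by auto
  note V = open_pre[OF this]
  obtain I where I: "ideal I A" "f ` N = {q. primeideal q A \<and> \<not> I \<subseteq> q}"
    using V(1) unfolding A.openin_zariski by blast
  have "f x \<in> f ` N" using N by blast
  then obtain s where s: "s \<in> I" "s \<notin> f x" unfolding I(2) by blast
  have "y \<in> N" if "y \<in> U" "s \<notin> f y" for y
  proof -
    have "f y \<in> f ` N" unfolding I(2) using that s f_prime by blast
    then show ?thesis using V(2) that(1) by blast
  qed
  then show "\<exists>s\<in>carrier A - f x. \<forall>y\<in>U. s \<notin> f y \<longrightarrow> y \<in> N" using s ideal.Icarr[OF I(1)] by blast
next
  show "openin T {x \<in> U. s \<notin> f x}" if "s \<in> carrier A" for s
  proof -
    have "{x \<in> U. s \<notin> f x} = pre {q. primeideal q A \<and> s \<notin> q}" using f_prime by auto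
    then show ?thesis using pre_open[OF A.openin_basic[OF that]] by simp
  qed
  fix x assume x: "x \<in> U"
  show "\<psi> x \<in> ring_hom A (stalk \<XX> x)" by (rule psi_hom[OF x])
  show "\<exists>v\<in>carrier (stalk \<XX> x). v \<otimes>\<^bsub>stalk \<XX> x\<^esub> \<psi> x s = \<one>\<^bsub>stalk \<XX> x\<^esub>" if "s \<in> carrier A - f x" for s
    by (rule psi_unit[OF x that])
  show "\<exists>a\<in>carrier A. \<exists>s\<in>carrier A - f x. g \<otimes>\<^bsub>stalk \<XX> x\<^esub> \<psi> x s = \<psi> x a" if "g \<in> carrier (stalk \<XX> x)" for g
    by (rule stalk_fraction[OF x that])
  show "\<exists>s\<in>carrier A - f x. s \<otimes>\<^bsub>A\<^esub> a = \<zero>\<^bsub>A\<^esub>" if "a \<in> carrier A" "\<psi> x a = \<psi> x \<zero>\<^bsub>A\<^esub>" for a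
    by (rule psi_zero[OF x that])
  fix y assume y: "y \<in> U"
  show "generalizes y x \<longleftrightarrow> f y \<subseteq> f x" by (rule f_specialization[OF x y])
  show "cospecialize \<XX> y (\<psi> x a) = \<psi> y a" if "generalizes y x" "a \<in> carrier A" for a
    unfolding \<psi>_def
    by (rule cospecialize_germ(1)[OF ev_section[OF openin_topspace that(2) den_one[OF openin_topspace] x f_top[OF x]] that(1)])
qed (rule U A.cring_axioms f_bij)+

end

lemma (in sheaf_of_rings) affine_open_chart:
  assumes "affine_open \<XX> U A" shows "\<exists>p \<psi>. chart U A p \<psi>"
proof -
  have U: "openin T U" and A: "cring A" using assms by (auto simp: affine_open_def)
  then have top: "topspace (subtopology T U) = U" using openin_subset by (auto simp: topspace_subtopology)
  have simps: "pts (open_subspace \<XX> U) = subtopology T U" "sections (open_subspace \<XX> U) = \<O>"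
    "restr (open_subspace \<XX> U) = restr \<XX>" "pts (Spec A) = zariski A" "sections (Spec A) = Spec_sections A"
    "restr (Spec A) = (\<lambda>V W s. restrict s W)"
    by (simp_all add: open_subspace_def Spec_def)
  have "isomorphic_ringed_spaces (open_subspace \<XX> U) (Spec A)" using assms by (simp add: affine_open_def)
  from this[unfolded isomorphic_ringed_spaces_def simps top]
  obtain f \<phi> where f: "homeomorphic_map (subtopology T U) (zariski A) f"
    and iso: "\<forall>V. openin (zariski A) V \<longrightarrow> \<phi> V \<in> ring_iso (Spec_sections A V) (\<O> {x \<in> U. f x \<in> V})"
    and nat: "\<forall>V W. openin (zariski A) V \<and> openin (zariski A) W \<and> W \<subseteq> V \<longrightarrow>
      (\<forall>s\<in>carrier (Spec_sections A V).
        \<phi> W (restrict s W) = restr \<XX> {x \<in> U. f x \<in> V} {x \<in> U. f x \<in> W} (\<phi> V s))"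
    by (elim exE conjE) (rule that)
  interpret A: cring A by (rule A)
  interpret spec_chart \<XX> A U f \<phi>
    by unfold_locales (use U f iso nat in auto)
  show ?thesis using chart by blast
qed

section \<open>Discrete valuation rings\<close>

text \<open>In a Noetherian ring a nonempty chain of ideals contains its union, so Zorn's lemma
  applies inside the family \<open>F\<close> itself.\<close>

lemma (in noetherian_ring) exists_maximal_ideal_in:
  assumes "F \<noteq> {}" "\<And>I. I \<in> F \<Longrightarrow> ideal I R"
  shows "\<exists>M\<in>F. \<forall>I\<in>F. M \<subseteq> I \<longrightarrow> I = M"
proof (rule subset_Zorn)
  fix C assume C: "subset.chain F C"
  show "\<exists>U\<in>F. \<forall>X\<in>C. X \<subseteq> U"
  proof (cases "C = {}")
    case True
    then show ?thesis using assms(1) by blast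
  next
    case False
    have CF: "C \<subseteq> F" using C by (simp add: pred_on.chain_def)
    have "subset.chain {I. ideal I R} C" using C assms(2) unfolding pred_on.chain_def by blast
    then have "\<Union>C \<in> C" using ideal_chain_is_trivial[OF False] by blast
    then show ?thesis using CF by blast
  qed
qed

lemma (in cring) mem_PIdl_iff:
  assumes "a \<in> carrier R" shows "b \<in> PIdl a \<longleftrightarrow> a divides b"
proof -
  have "b \<in> PIdl a \<longleftrightarrow> (\<exists>x\<in>carrier R. b = x \<otimes> a)" by (auto simp: cgenideal_def)
  also have "\<dots> \<longleftrightarrow> (\<exists>x\<in>carrier R. b = a \<otimes> x)"
    by (rule bex_cong[OF refl]) (simp add: m_comm assms)
  finally show ?thesis by (auto simp: factor_def)
qed

text \<open>The colon ideal \<open>(a : b)\<close>. The case where \<open>a\<close> is zero gives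
  annihilators.\<close>

lemma (in cring) ideal_colon:
  assumes "a \<in> carrier R" "b \<in> carrier R" shows "ideal {c \<in> carrier R. a divides c \<otimes> b} R"
proof (rule idealI)
  show "ring R" by (rule ring_axioms)
  show "subgroup {c \<in> carrier R. a divides c \<otimes> b} (add_monoid R)"
  proof (rule add.subgroupI)
    show "{c \<in> carrier R. a divides c \<otimes> b} \<noteq> {}"
      using assms divides_zero[OF assms(1)] by (auto intro!: exI[of _ \<zero>])
    fix c assume "c \<in> {c \<in> carrier R. a divides c \<otimes> b}"
    then obtain d where d: "c \<in> carrier R" "d \<in> carrier R" "c \<otimes> b = a \<otimes> d" by (auto elim: dividesE)
    have "(\<ominus> c) \<otimes> b = a \<otimes> (\<ominus> d)" using d assms by (simp add: l_minus r_minus)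
    then have "a divides (\<ominus> c) \<otimes> b" using d by (metis a_inv_closed dividesI)
    then show "\<ominus> c \<in> {c \<in> carrier R. a divides c \<otimes> b}" using d by simp
    fix c' assume "c' \<in> {c \<in> carrier R. a divides c \<otimes> b}"
    then obtain d' where d': "c' \<in> carrier R" "d' \<in> carrier R" "c' \<otimes> b = a \<otimes> d'" by (auto elim: dividesE)
    have "(c \<oplus> c') \<otimes> b = a \<otimes> (d \<oplus> d')" using d d' assms by (simp add: l_distr r_distr)
    then have "a divides (c \<oplus> c') \<otimes> b" using d d' by (metis a_closed dividesI)
    then show "c \<oplus> c' \<in> {c \<in> carrier R. a divides c \<otimes> b}" using d d' by simp
  qed blast
  fix c x assume "c \<in> {c \<in> carrier R. a divides c \<otimes> b}" and x: "x \<in> carrier R"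
  then obtain d where d: "c \<in> carrier R" "d \<in> carrier R" "c \<otimes> b = a \<otimes> d" by (auto elim: dividesE)
  have "(x \<otimes> c) \<otimes> b = x \<otimes> (c \<otimes> b)" using d(1) x assms by (simp add: m_assoc)
  also have "\<dots> = a \<otimes> (x \<otimes> d)" unfolding d(3) using d(2) x assms by (simp add: m_lcomm)
  finally have "a divides (x \<otimes> c) \<otimes> b" using d x by (metis m_closed dividesI)
  then show "x \<otimes> c \<in> {c \<in> carrier R. a divides c \<otimes> b}" "c \<otimes> x \<in> {c \<in> carrier R. a divides c \<otimes> b}"
    using d x m_comm by auto
qed

lemma (in domain) localization_ring_nonzero: "localization_ring R (carrier R - {\<zero>})"
  by unfold_locales (auto simp: integral_iff)

text \<open>The list of primes together with \<open>nonzero\<close> encodes dimension one. The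
  results below amount to saying that such a ring is a discrete valuation ring.\<close>

locale one_dimensional_normal = noetherian_domain B for B (structure) +
  assumes normal: "integrally_closed_domain B" and local: "local_ring B"
    and primes: "primeideal J B \<Longrightarrow> J = {\<zero>} \<or> J = the_maximal_ideal B"
    and nonzero: "the_maximal_ideal B \<noteq> {\<zero>}"
begin

abbreviation "M \<equiv> the_maximal_ideal B"

lemma M_maximal: "maximalideal M B" and M_unique: "maximalideal J B \<Longrightarrow> J = M"
proof -
  have ex: "\<exists>!M. maximalideal M B" using local by (simp add: local_ring_def)
  show "maximalideal M B" unfolding the_maximal_ideal_def by (rule theI'[OF ex])
  then show "maximalideal J B \<Longrightarrow> J = M" using ex by blast
qed

lemma M_ideal: "ideal M B" using M_maximal by (simp add: maximalideal_def)

lemma M_carrier: "m \<in> M \<Longrightarrow> m \<in> carrier B" using ideal.Icarr[OF M_ideal] .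

text \<open>A nonunit generates a proper ideal; a maximal proper ideal above it exists by the
  Noetherian property and equals \<open>M\<close> since the ring is local.\<close>

lemma M_iff: assumes "a \<in> carrier B" shows "a \<in> M \<longleftrightarrow> a \<notin> Units B"
proof
  assume "a \<in> M"
  show "a \<notin> Units B"
  proof
    assume u: "a \<in> Units B"
    then have "\<one> \<in> M" using ideal.I_l_closed[OF M_ideal \<open>a \<in> M\<close>, of "inv a"] by simp
    then show False using ideal.one_imp_carrier[OF M_ideal] maximalideal.I_notcarr[OF M_maximal] by simp
  qed
next
  assume nu: "a \<notin> Units B"
  define F where "F = {I. ideal I B \<and> a \<in> I \<and> I \<noteq> carrier B}"
  have "PIdl a \<in> F"
    using cgenideal_ideal[OF assms] cgenideal_self[OF assms] ideal_eq_carrier_iff[OF assms] nu by (auto simp: F_def)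
  moreover have "ideal I B" if "I \<in> F" for I using that by (simp add: F_def)
  ultimately obtain J where J: "J \<in> F" "\<forall>I\<in>F. J \<subseteq> I \<longrightarrow> I = J"
    using exists_maximal_ideal_in[of F] by blast
  then have J': "ideal J B" "a \<in> J" "J \<noteq> carrier B" by (simp_all add: F_def)
  have "maximalideal J B"
  proof (rule maximalidealI[OF J'(1)])
    show "carrier B \<noteq> J" using J'(3) by blast
    fix I assume I: "ideal I B" "J \<subseteq> I"
    have "I \<noteq> carrier B \<Longrightarrow> I \<in> F" using I J'(2) by (auto simp: F_def)
    then show "I = J \<or> I = carrier B" using J(2) I(2) by blast
  qed
  then have "J = M" by (rule M_unique)
  then show "a \<in> M" using J'(2) by simp
qed

text \<open>\<open>M\<close> is an associated prime of every nonzero \<open>a \<in> M\<close>: a maximal annihilator ideal \<open>(a : b)\<close> is prime.\<close>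

lemma colon_is_M:
  assumes a: "a \<in> M" "a \<noteq> \<zero>"
  obtains b where "b \<in> carrier B" "\<not> a divides b" "\<And>m. m \<in> M \<Longrightarrow> a divides m \<otimes> b"
proof -
  have aB: "a \<in> carrier B" using a M_carrier by blast
  let ?I = "\<lambda>b. {c \<in> carrier B. a divides c \<otimes> b}"
  define F where "F = ?I ` {b \<in> carrier B. \<not> a divides b}"
  have "\<not> a divides \<one>" using a M_iff aB divides_one by simp
  then have "F \<noteq> {}" by (auto simp: F_def)
  moreover have "ideal I B" if "I \<in> F" for I using that ideal_colon[OF aB] by (auto simp: F_def)
  ultimately obtain P where P: "P \<in> F" "\<forall>I\<in>F. P \<subseteq> I \<longrightarrow> I = P"
    using exists_maximal_ideal_in[of F] by blast
  then obtain b where b: "b \<in> carrier B" "\<not> a divides b" "P = ?I b" by (auto simp: F_def)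
  have "primeideal P B"
  proof (rule primeidealI)
    show "ideal P B" unfolding b(3) by (rule ideal_colon[OF aB b(1)])
    show "cring B" by (rule cring_axioms)
    have "\<one> \<notin> P" using b by simp
    then show "carrier B \<noteq> P" by auto
    fix c d assume cd: "c \<in> carrier B" "d \<in> carrier B" "c \<otimes> d \<in> P"
    show "c \<in> P \<or> d \<in> P"
    proof (rule disjCI)
      assume "d \<notin> P"
      then have nd: "\<not> a divides d \<otimes> b" using cd b by simp
      \<comment> \<open>Passing from \<open>b\<close> to \<open>d \<otimes> b\<close> enlarges the
        colon ideal; maximality of \<open>P\<close> forces equality, and \<open>c\<close> lies in
        the larger one.\<close>
      have "P \<subseteq> ?I (d \<otimes> b)"
      proof
        fix x assume "x \<in> P"
        then have x: "x \<in> carrier B" "a divides x \<otimes> b" by (auto simp: b(3))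
        have "x \<otimes> (d \<otimes> b) = (x \<otimes> b) \<otimes> d" using x(1) cd b by (simp add: m_ac)
        then have "a divides x \<otimes> (d \<otimes> b)" using x cd b aB by (simp add: divides_prod_r)
        then show "x \<in> ?I (d \<otimes> b)" using x by simp
      qed
      moreover have "?I (d \<otimes> b) \<in> F" using nd cd b by (auto simp: F_def)
      ultimately have eq: "?I (d \<otimes> b) = P" using P(2) by blast
      have "a divides (c \<otimes> d) \<otimes> b" using cd(3) by (simp add: b(3))
      then have "a divides c \<otimes> (d \<otimes> b)" using cd(1,2) b(1) by (simp add: m_assoc)
      then show "c \<in> P" using cd(1) eq by blast
    qed
  qed
  moreover have "a \<in> P" using aB b by (auto simp: b(3))
  ultimately have "P = M" using primes a by blast
  then show ?thesis using that b by blast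
qed

text \<open>If \<open>(b/a) M \<subseteq> M\<close> then \<open>a (b/a)\<^sup>n\<close> lies in \<open>M\<close> for all \<open>n\<close>, so \<open>b/a\<close> is almost integral, hence integral.\<close>

lemma almost_integral:
  assumes a: "a \<in> M" "a \<noteq> \<zero>" and b: "b \<in> carrier B"
    and stable: "\<And>m. m \<in> M \<Longrightarrow> \<exists>m'\<in>M. m \<otimes> b = a \<otimes> m'"
  shows "a divides b"
proof -
  have aB: "a \<in> carrier B" using a M_carrier by blast
  \<comment> \<open>Multiplication by \<open>b/a\<close> on \<open>M\<close>, expressed without
    fractions; the iterates \<open>d n\<close> below represent \<open>a (b/a)^n\<close>.\<close>
  define g where "g m = (SOME m'. m' \<in> M \<and> m \<otimes> b = a \<otimes> m')" for m
  have g: "g m \<in> M \<and> m \<otimes> b = a \<otimes> g m" if "m \<in> M" for m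
    unfolding g_def by (rule someI_ex) (use stable[OF that] in blast)
  define d where "d n = (g ^^ n) a" for n
  have dM: "d n \<in> M" for n by (induction n) (use a g in \<open>auto simp: d_def\<close>)
  then have dB: "d n \<in> carrier B" for n using M_carrier by blast
  have d0: "d 0 = a" by (simp add: d_def)
  have dS: "d n \<otimes> b = a \<otimes> d (Suc n)" for n using g[OF dM[of n]] by (simp add: d_def)
  \<comment> \<open>The ideal generated by \<open>d 0, ..., d (n - 1)\<close>. The chain of these
    ideals becomes stationary, which makes some \<open>d N\<close> a combination of its
    predecessors.\<close>
  define J where "J n = {\<Oplus>i\<in>{..<n}. c i \<otimes> d i |c. \<forall>i. c i \<in> carrier B}" for n :: nat
  have fs: "(\<Oplus>i\<in>{..<n}. c i \<otimes> d i) \<in> carrier B" if "\<forall>i. c i \<in> carrier B" for n :: nat and c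
    using that dB by (intro finsum_closed) auto
  have J_ideal: "ideal (J n) B" for n
  proof (rule idealI)
    show "ring B" by (rule ring_axioms)
    show "subgroup (J n) (add_monoid B)"
    proof (rule add.subgroupI)
      show "J n \<subseteq> carrier B" using fs by (auto simp: J_def)
      show "J n \<noteq> {}" by (auto simp: J_def intro!: exI[of _ "\<lambda>_. \<zero>"])
      fix x assume "x \<in> J n"
      then obtain c where c: "\<forall>i. c i \<in> carrier B" "x = (\<Oplus>i\<in>{..<n}. c i \<otimes> d i)" by (auto simp: J_def)
      have "\<ominus> x = (\<ominus> \<one>) \<otimes> x" using c fs by (simp add: l_minus)
      also have "\<dots> = (\<Oplus>i\<in>{..<n}. (\<ominus> \<one>) \<otimes> (c i \<otimes> d i))"
        unfolding c(2) by (rule finsum_rdistr) (use c dB in auto)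
      also have "\<dots> = (\<Oplus>i\<in>{..<n}. (\<ominus> c i) \<otimes> d i)"
        by (rule finsum_cong') (use c dB in \<open>auto simp: l_minus\<close>)
      finally show "\<ominus> x \<in> J n" using c by (auto simp: J_def intro!: exI[of _ "\<lambda>i. \<ominus> c i"])
      fix y assume "y \<in> J n"
      then obtain e where e: "\<forall>i. e i \<in> carrier B" "y = (\<Oplus>i\<in>{..<n}. e i \<otimes> d i)" by (auto simp: J_def)
      have "x \<oplus> y = (\<Oplus>i\<in>{..<n}. c i \<otimes> d i \<oplus> e i \<otimes> d i)"
        unfolding c(2) e(2) by (rule finsum_addf[symmetric]) (use c e dB in auto)
      also have "\<dots> = (\<Oplus>i\<in>{..<n}. (c i \<oplus> e i) \<otimes> d i)"
        by (rule finsum_cong') (use c e dB in \<open>auto simp: l_distr\<close>)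
      finally show "x \<oplus> y \<in> J n" using c e by (auto simp: J_def intro!: exI[of _ "\<lambda>i. c i \<oplus> e i"])
    qed
    fix x z assume "x \<in> J n" and z: "z \<in> carrier B"
    then obtain c where c: "\<forall>i. c i \<in> carrier B" "x = (\<Oplus>i\<in>{..<n}. c i \<otimes> d i)" by (auto simp: J_def)
    have "z \<otimes> x = (\<Oplus>i\<in>{..<n}. z \<otimes> (c i \<otimes> d i))"
      unfolding c(2) by (rule finsum_rdistr) (use c z dB in auto)
    also have "\<dots> = (\<Oplus>i\<in>{..<n}. (z \<otimes> c i) \<otimes> d i)"
      by (rule finsum_cong') (use c z dB in \<open>auto simp: m_assoc\<close>)
    finally show zx: "z \<otimes> x \<in> J n" using c z by (auto simp: J_def intro!: exI[of _ "\<lambda>i. z \<otimes> c i"])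
    have "x \<in> carrier B" using c fs by simp
    then show "x \<otimes> z \<in> J n" using zx z m_comm by simp
  qed
  have J_Suc: "J n \<subseteq> J (Suc n)" "d n \<in> J (Suc n)" for n
  proof -
    show "J n \<subseteq> J (Suc n)"
    proof
      fix x assume "x \<in> J n"
      then obtain c where c: "\<forall>i. c i \<in> carrier B" "x = (\<Oplus>i\<in>{..<n}. c i \<otimes> d i)" by (auto simp: J_def)
      let ?c = "c(n := \<zero>)"
      have "(\<Oplus>i\<in>{..<Suc n}. ?c i \<otimes> d i) = ?c n \<otimes> d n \<oplus> (\<Oplus>i\<in>{..<n}. ?c i \<otimes> d i)"
        unfolding lessThan_Suc by (rule finsum_insert) (use c dB in auto)
      also have "(\<Oplus>i\<in>{..<n}. ?c i \<otimes> d i) = x"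
        unfolding c(2) by (rule finsum_cong') (use c dB in auto)
      finally have "x = (\<Oplus>i\<in>{..<Suc n}. ?c i \<otimes> d i)" using c fs[of c n] dB by simp
      then show "x \<in> J (Suc n)" unfolding J_def using c by (intro CollectI exI[of _ ?c]) auto
    qed
    let ?c = "\<lambda>i. if i = n then \<one> else \<zero>"
    have "(\<Oplus>i\<in>{..<Suc n}. ?c i \<otimes> d i) = ?c n \<otimes> d n \<oplus> (\<Oplus>i\<in>{..<n}. ?c i \<otimes> d i)"
      unfolding lessThan_Suc by (rule finsum_insert) (use dB in auto)
    also have "(\<Oplus>i\<in>{..<n}. ?c i \<otimes> d i) = \<zero>"
      by (rule add.finprod_one_eqI) (use dB in auto)
    finally have "d n = (\<Oplus>i\<in>{..<Suc n}. ?c i \<otimes> d i)" using dB by simp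
    then show "d n \<in> J (Suc n)" unfolding J_def by (intro CollectI exI[of _ ?c]) auto
  qed
  have mono: "J i \<subseteq> J j" if "i \<le> j" for i j using J_Suc(1) that by (rule lift_Suc_mono_le)
  have "\<exists>K\<in>range J. \<forall>I\<in>range J. K \<subseteq> I \<longrightarrow> I = K"
    by (rule exists_maximal_ideal_in) (use J_ideal in auto)
  then obtain N where "\<forall>I\<in>range J. J N \<subseteq> I \<longrightarrow> I = J N" by blast
  then have "J (Suc N) = J N" using J_Suc(1)[of N] by blast
  then have "d N \<in> J N" using J_Suc(2)[of N] by simp
  then obtain c where c: "\<forall>i. c i \<in> carrier B" "d N = (\<Oplus>i\<in>{..<N}. c i \<otimes> d i)" by (auto simp: J_def)
  interpret Q: localization_ring B "carrier B - {\<zero>}" by (rule localization_ring_nonzero)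
  let ?Q = "fraction_field B" let ?\<theta> = "to_fraction_field B"
  have Q: "?Q = Q.L" by (simp add: fraction_field_def)
  interpret QR: cring ?Q unfolding Q by (rule Q.cring_L)
  have \<theta>: "?\<theta> x = Q.fr x \<one>" for x by (simp add: to_fraction_field_def)
  have hom: "?\<theta> \<in> ring_hom B ?Q"
    by (rule ring_hom_memI) (auto simp: \<theta> Q Q.frac_L Q.L_mult Q.L_add Q.L_one)
  interpret h: ring_hom_cring B ?Q ?\<theta> by unfold_locales (rule hom)
  have mem: "x \<in> carrier B - {\<zero>} \<longleftrightarrow> x \<in> carrier B \<and> x \<noteq> \<zero>" for x by blast
  define x where "x = Q.fr b a"
  have xQ: "x \<in> carrier ?Q" unfolding x_def Q by (rule Q.frac_L) (use a aB b in auto)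
  have dx: "?\<theta> (d n) = ?\<theta> a \<otimes>\<^bsub>?Q\<^esub> x [^]\<^bsub>?Q\<^esub> n" for n
  proof (induction n)
    case 0
    then show ?case using aB d0 by simp
  next
    case (Suc n)
    have "?\<theta> (d n) \<otimes>\<^bsub>?Q\<^esub> x = Q.fr (d n \<otimes> b) (\<one> \<otimes> a)"
      unfolding \<theta> x_def Q by (rule Q.L_mult) (use dB b a aB in auto)
    also have "\<dots> = ?\<theta> (d (Suc n))"
      unfolding \<theta> by (rule Q.frac_eqI) (use dB b a aB dS[of n] in \<open>simp_all add: m_comm\<close>)
    finally have "?\<theta> (d (Suc n)) = ?\<theta> (d n) \<otimes>\<^bsub>?Q\<^esub> x" ..
    then show ?case using Suc aB xQ by (simp add: QR.m_assoc)
  qed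
  \<comment> \<open>The value at \<open>x = b/a\<close> of the monic polynomial read off from the
    relation for \<open>d N\<close>. The relation itself says that \<open>a\<close> times
    \<open>y\<close> is zero, and \<open>a\<close> is invertible in the fraction field.\<close>
  define y where "y = x [^]\<^bsub>?Q\<^esub> N \<oplus>\<^bsub>?Q\<^esub> (\<Oplus>\<^bsub>?Q\<^esub>i\<in>{..<N}. ?\<theta> (\<ominus> c i) \<otimes>\<^bsub>?Q\<^esub> x [^]\<^bsub>?Q\<^esub> i)"
  have cQ: "?\<theta> (c i) \<in> carrier ?Q" "?\<theta> (\<ominus> c i) \<in> carrier ?Q" for i using c by auto
  have sQ: "(\<Oplus>\<^bsub>?Q\<^esub>i\<in>{..<N}. ?\<theta> (\<ominus> c i) \<otimes>\<^bsub>?Q\<^esub> x [^]\<^bsub>?Q\<^esub> i) \<in> carrier ?Q"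
    using cQ xQ by (intro QR.finsum_closed) auto
  have "?\<theta> a \<otimes>\<^bsub>?Q\<^esub> (\<Oplus>\<^bsub>?Q\<^esub>i\<in>{..<N}. ?\<theta> (\<ominus> c i) \<otimes>\<^bsub>?Q\<^esub> x [^]\<^bsub>?Q\<^esub> i)
      = (\<Oplus>\<^bsub>?Q\<^esub>i\<in>{..<N}. ?\<theta> a \<otimes>\<^bsub>?Q\<^esub> (?\<theta> (\<ominus> c i) \<otimes>\<^bsub>?Q\<^esub> x [^]\<^bsub>?Q\<^esub> i))"
    by (rule QR.finsum_rdistr) (use cQ xQ aB in auto)
  also have "\<dots> = (\<Oplus>\<^bsub>?Q\<^esub>i\<in>{..<N}. (?\<theta> \<circ> (\<lambda>i. (\<ominus> c i) \<otimes> d i)) i)"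
  proof (rule QR.finsum_cong')
    fix i assume "i \<in> {..<N}"
    have "?\<theta> ((\<ominus> c i) \<otimes> d i) = ?\<theta> (\<ominus> c i) \<otimes>\<^bsub>?Q\<^esub> ?\<theta> (d i)"
      using c dB by (intro h.hom_mult) auto
    then show "?\<theta> a \<otimes>\<^bsub>?Q\<^esub> (?\<theta> (\<ominus> c i) \<otimes>\<^bsub>?Q\<^esub> x [^]\<^bsub>?Q\<^esub> i) = (?\<theta> \<circ> (\<lambda>i. (\<ominus> c i) \<otimes> d i)) i"
      unfolding comp_def dx[of i] using cQ[of i] xQ aB by (simp add: QR.m_lcomm)
  qed (use c dB in auto)
  also have "\<dots> = ?\<theta> (\<Oplus>i\<in>{..<N}. (\<ominus> c i) \<otimes> d i)"
    by (rule h.hom_finsum[symmetric]) (use c dB in auto)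
  finally have s: "?\<theta> a \<otimes>\<^bsub>?Q\<^esub> (\<Oplus>\<^bsub>?Q\<^esub>i\<in>{..<N}. ?\<theta> (\<ominus> c i) \<otimes>\<^bsub>?Q\<^esub> x [^]\<^bsub>?Q\<^esub> i)
      = ?\<theta> (\<Oplus>i\<in>{..<N}. (\<ominus> c i) \<otimes> d i)" .
  have neg: "d N \<oplus> (\<Oplus>i\<in>{..<N}. (\<ominus> c i) \<otimes> d i) = \<zero>"
  proof -
    have "d N \<oplus> (\<Oplus>i\<in>{..<N}. (\<ominus> c i) \<otimes> d i) = (\<Oplus>i\<in>{..<N}. c i \<otimes> d i \<oplus> (\<ominus> c i) \<otimes> d i)"
      unfolding c(2) by (rule finsum_addf[symmetric]) (use c dB in auto)
    also have "\<dots> = \<zero>" by (rule add.finprod_one_eqI) (use c dB in \<open>auto simp: l_minus r_neg\<close>)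
    finally show ?thesis .
  qed
  have "?\<theta> a \<otimes>\<^bsub>?Q\<^esub> y = ?\<theta> (d N) \<oplus>\<^bsub>?Q\<^esub> ?\<theta> (\<Oplus>i\<in>{..<N}. (\<ominus> c i) \<otimes> d i)"
    unfolding y_def s[symmetric] dx using aB xQ sQ by (simp add: QR.r_distr)
  also have "\<dots> = ?\<theta> (d N \<oplus> (\<Oplus>i\<in>{..<N}. (\<ominus> c i) \<otimes> d i))"
    by (rule h.hom_add[symmetric, OF dB fs]) (use c in simp)
  finally have ay: "?\<theta> a \<otimes>\<^bsub>?Q\<^esub> y = \<zero>\<^bsub>?Q\<^esub>" unfolding neg by simp
  have yQ: "y \<in> carrier ?Q" unfolding y_def using xQ sQ by simp
  have inva: "Q.fr \<one> a \<in> carrier ?Q" "Q.fr \<one> a \<otimes>\<^bsub>?Q\<^esub> ?\<theta> a = \<one>\<^bsub>?Q\<^esub>"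
  proof -
    show "Q.fr \<one> a \<in> carrier ?Q" unfolding Q by (rule Q.frac_L) (use a aB in auto)
    have "Q.fr \<one> a \<otimes>\<^bsub>?Q\<^esub> ?\<theta> a = Q.fr (\<one> \<otimes> a) (a \<otimes> \<one>)"
      unfolding \<theta> Q by (rule Q.L_mult) (use a aB in auto)
    also have "\<dots> = \<one>\<^bsub>?Q\<^esub>"
      unfolding Q Q.L_one by (rule Q.frac_eqI) (use a aB in auto)
    finally show "Q.fr \<one> a \<otimes>\<^bsub>?Q\<^esub> ?\<theta> a = \<one>\<^bsub>?Q\<^esub>" .
  qed
  have "y = (Q.fr \<one> a \<otimes>\<^bsub>?Q\<^esub> ?\<theta> a) \<otimes>\<^bsub>?Q\<^esub> y" using inva yQ by simp
  also have "\<dots> = Q.fr \<one> a \<otimes>\<^bsub>?Q\<^esub> (?\<theta> a \<otimes>\<^bsub>?Q\<^esub> y)" 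
    by (rule QR.m_assoc[OF inva(1) h.hom_closed[OF aB] yQ])
  also have "\<dots> = \<zero>\<^bsub>?Q\<^esub>" unfolding ay by (rule QR.r_null[OF inva(1)])
  finally have "y = \<zero>\<^bsub>?Q\<^esub>" .
  then have "integral_over B ?\<theta> ?Q x"
    unfolding integral_over_def y_def using c by (intro exI[of _ N] exI[of _ "\<lambda>i. \<ominus> c i"]) auto
  \<comment> \<open>Normality puts the integral element \<open>b/a\<close> into the ring, which is
    the claimed divisibility.\<close>
  then obtain e where e: "e \<in> carrier B" "x = ?\<theta> e"
    using normal xQ unfolding integrally_closed_domain_def by blast
  then obtain u where u: "u \<in> carrier B - {\<zero>}" "u \<otimes> (b \<otimes> \<one>) = u \<otimes> (e \<otimes> a)"
    unfolding x_def \<theta> using Q.frac_eq_iff[of b a e \<one>] a aB b by auto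
  then have "u \<otimes> b = u \<otimes> (e \<otimes> a)" using b by simp
  then have "b = e \<otimes> a" using m_lcancel[of u b "e \<otimes> a"] u(1) e(1) aB b by blast
  then have "b = a \<otimes> e" using m_comm e(1) aB by simp
  then show ?thesis using e by (metis dividesI)
qed

text \<open>With \<open>b\<close> from \<open>colon_is_M\<close>, the fraction \<open>b/a\<close>
  maps \<open>M\<close> into the ring. It does not map \<open>M\<close> into \<open>M\<close>, as
  otherwise \<open>almost_integral\<close> would make \<open>a\<close> divide \<open>b\<close>.
  Hence some \<open>m\<close> in \<open>M\<close> is sent to a unit \<open>z\<close>, and this
  \<open>m\<close> generates \<open>M\<close>.\<close>

lemma uniformizer: "\<exists>\<pi>\<in>carrier B. PIdl \<pi> = M \<and> \<pi> \<noteq> \<zero>"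
proof -
  have "\<zero> \<in> M" using additive_subgroup.zero_closed[OF ideal.axioms(1)[OF M_ideal]] .
  then obtain a where a: "a \<in> M" "a \<noteq> \<zero>" using nonzero by blast
  have aB: "a \<in> carrier B" using a M_carrier by blast
  obtain b where b: "b \<in> carrier B" "\<not> a divides b" "\<And>m. m \<in> M \<Longrightarrow> a divides m \<otimes> b"
    using colon_is_M[OF a] by blast
  have "\<not> (\<forall>m\<in>M. \<exists>m'\<in>M. m \<otimes> b = a \<otimes> m')" using almost_integral[OF a b(1)] b(2) by blast
  then obtain m where m: "m \<in> M" "\<And>m'. m' \<in> M \<Longrightarrow> m \<otimes> b \<noteq> a \<otimes> m'" by blast
  obtain z where z: "z \<in> carrier B" "m \<otimes> b = a \<otimes> z" using b(3)[OF m(1)] by (auto elim: dividesE)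
  then have zu: "z \<in> Units B" using m(2) M_iff by blast
  have mB: "m \<in> carrier B" using m M_carrier by blast
  have "PIdl m = M"
  proof
    show "PIdl m \<subseteq> M" by (rule cgenideal_minimal[OF M_ideal m(1)])
    show "M \<subseteq> PIdl m"
    proof
      fix y assume y: "y \<in> M"
      then have yB: "y \<in> carrier B" using M_carrier by blast
      obtain w where w: "w \<in> carrier B" "y \<otimes> b = a \<otimes> w" using b(3)[OF y] by (auto elim: dividesE)
      \<comment> \<open>Computes \<open>y b m\<close> in two ways. Since \<open>z\<close> is a unit,
        cancelling \<open>a\<close> exhibits \<open>y\<close> as a multiple of
        \<open>m\<close>.\<close>
      have "a \<otimes> (y \<otimes> z) = y \<otimes> (m \<otimes> b)" unfolding z(2) using aB yB z(1) by (simp add: m_lcomm)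
      also have "\<dots> = m \<otimes> (y \<otimes> b)" using yB mB b(1) by (simp add: m_lcomm)
      also have "\<dots> = a \<otimes> (m \<otimes> w)" unfolding w(2) using aB mB w(1) by (simp add: m_lcomm)
      finally have yz: "y \<otimes> z = m \<otimes> w" using a aB yB z(1) mB w(1) by (simp add: m_lcancel)
      have "y = (y \<otimes> z) \<otimes> inv z" using zu yB z(1) by (simp add: m_assoc)
      also have "\<dots> = m \<otimes> (w \<otimes> inv z)" unfolding yz using mB w(1) zu by (simp add: m_assoc)
      finally show "y \<in> PIdl m" using mem_PIdl_iff[OF mB] w zu by (metis Units_inv_closed dividesI m_closed)
    qed
  qed
  moreover have "m \<noteq> \<zero>"
  proof
    assume "m = \<zero>"
    then have "m \<otimes> b = a \<otimes> \<zero>" using aB b by simp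
    then show False using m(2) \<open>\<zero> \<in> M\<close> by blast
  qed
  ultimately show ?thesis using mB by blast
qed

text \<open>Choose a counterexample \<open>c\<close> with maximal principal ideal. It is not a unit,
  so it equals \<open>\<pi> \<otimes> d\<close> with \<open>d\<close> again a counterexample;
  maximality makes \<open>c\<close> and \<open>d\<close> generate the same ideal, and then
  \<open>\<pi>\<close> would be a unit.\<close>

lemma unit_times_power:
  assumes \<pi>: "\<pi> \<in> carrier B" "PIdl \<pi> = M" "\<pi> \<noteq> \<zero>" and b: "b \<in> carrier B" "b \<noteq> \<zero>"
  shows "\<exists>u\<in>Units B. \<exists>n::nat. b = u \<otimes> \<pi> [^] n"
proof (rule ccontr)
  assume neg: "\<not> ?thesis"
  define bad where "bad b \<longleftrightarrow> b \<in> carrier B \<and> b \<noteq> \<zero> \<and> \<not> (\<exists>u\<in>Units B. \<exists>n::nat. b = u \<otimes> \<pi> [^] n)" for b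
  define F where "F = (\<lambda>b. PIdl b) ` {b. bad b}"
  have "F \<noteq> {}" using neg b by (auto simp: F_def bad_def)
  moreover have "ideal I B" if "I \<in> F" for I using that cgenideal_ideal by (auto simp: F_def bad_def)
  ultimately obtain I where I: "I \<in> F" "\<forall>J\<in>F. I \<subseteq> J \<longrightarrow> J = I" using exists_maximal_ideal_in[of F] by blast
  then obtain c where c: "bad c" "I = PIdl c" by (auto simp: F_def)
  then have cB: "c \<in> carrier B" "c \<noteq> \<zero>" by (auto simp: bad_def)
  have "c \<notin> Units B"
  proof
    assume "c \<in> Units B"
    moreover have "c = c \<otimes> \<pi> [^] (0::nat)" using cB by simp
    ultimately show False using c(1) unfolding bad_def by blast
  qed
  then have "c \<in> PIdl \<pi>" using M_iff cB \<pi>(2) by simp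
  then obtain d where d: "d \<in> carrier B" "c = \<pi> \<otimes> d" using mem_PIdl_iff[OF \<pi>(1)] by (auto elim: dividesE)
  have "d \<noteq> \<zero>" using d cB \<pi>(1) by auto
  have "bad d"
  proof (rule ccontr)
    assume "\<not> bad d"
    then obtain u n where u: "u \<in> Units B" "d = u \<otimes> \<pi> [^] (n::nat)" using d \<open>d \<noteq> \<zero>\<close> by (auto simp: bad_def)
    have "c = u \<otimes> \<pi> [^] Suc n" unfolding d(2) u(2) using \<pi>(1) Units_closed[OF u(1)] by (simp add: m_ac)
    then show False using c(1) u(1) unfolding bad_def by blast
  qed
  moreover have "PIdl c \<subseteq> PIdl d"
    using to_contain_is_to_divide[OF d(1) cB(1)] d(2) \<pi>(1) m_comm[OF \<pi>(1) d(1)] by (metis dividesI)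
  ultimately have "PIdl d = PIdl c" using I c(2) by (auto simp: F_def)
  then have "c divides d" using to_contain_is_to_divide[OF cB(1) d(1)] by simp
  then obtain w where w: "w \<in> carrier B" "d = c \<otimes> w" by (auto elim: dividesE)
  have "c \<otimes> \<one> = c \<otimes> (\<pi> \<otimes> w)" using w d \<pi>(1) cB by (metis m_assoc m_comm m_lcomm r_one)
  then have "\<pi> \<otimes> w = \<one>" using cB \<pi>(1) w(1) by (metis m_closed m_lcancel one_closed)
  then have "\<pi> \<in> Units B" using \<pi>(1) w(1) m_comm unfolding Units_def by force
  moreover have "\<pi> \<in> M" using cgenideal_self[OF \<pi>(1)] \<pi>(2) by simp
  ultimately show False using M_iff \<pi>(1) by blast
qed

end

section \<open>The valuation of a discrete valuation ring\<close>

text \<open>Clears denominators: with the integer exponent written as a difference of natural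
  numbers, all computations with powers of a uniformizer can take place in the ring, where negative
  powers make no sense.\<close>

lemma (in field) int_pow_diff_iff:
  assumes x: "x \<in> carrier R" "x \<noteq> \<zero>" and v: "v \<in> carrier R" and k: "k \<in> carrier R"
  shows "k = v \<otimes> x [^] (int i - int j) \<longleftrightarrow> k \<otimes> x [^] j = v \<otimes> x [^] i"
proof -
  have xp: "x [^] n \<in> carrier R" "x [^] n \<noteq> \<zero>" for n :: nat
    using x by (induction n) (auto simp: integral_iff)
  show ?thesis
  proof (cases "j \<le> i")
    case True
    then have "int i - int j = int (i - j)" by simp
    then have "k = v \<otimes> x [^] (int i - int j) \<longleftrightarrow> k = v \<otimes> x [^] (i - j)" by (simp only: int_pow_int)
    also have "\<dots> \<longleftrightarrow> k \<otimes> x [^] j = (v \<otimes> x [^] (i - j)) \<otimes> x [^] j"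
      using k v xp m_rcancel[of "x [^] j" k "v \<otimes> x [^] (i - j)"] by auto
    also have "(v \<otimes> x [^] (i - j)) \<otimes> x [^] j = v \<otimes> x [^] i"
      using v xp x True by (simp add: m_assoc nat_pow_mult)
    finally show ?thesis .
  next
    case False
    let ?y = "x [^] (j - i)"
    have y: "?y \<in> Units R" using xp field_Units by blast
    have "int i - int j < 0" "nat (- (int i - int j)) = j - i" using False by auto
    then have "x [^] (int i - int j) = inv ?y" by (simp only: int_pow_def2 if_True)
    then have "k = v \<otimes> x [^] (int i - int j) \<longleftrightarrow> k = v \<otimes> inv ?y" by simp
    also have "\<dots> \<longleftrightarrow> k \<otimes> ?y = v"
    proof
      assume "k = v \<otimes> inv ?y"
      then have "k \<otimes> ?y = v \<otimes> (inv ?y \<otimes> ?y)" using v y xp by (simp add: m_assoc)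
      then show "k \<otimes> ?y = v" using v y by simp
    next
      assume "k \<otimes> ?y = v"
      then have "v \<otimes> inv ?y = (k \<otimes> ?y) \<otimes> inv ?y" by simp
      also have "\<dots> = k \<otimes> (?y \<otimes> inv ?y)" by (rule m_assoc[OF k xp(1) Units_inv_closed[OF y]])
      finally have "v \<otimes> inv ?y = k \<otimes> (?y \<otimes> inv ?y)" .
      then show "k = v \<otimes> inv ?y" using k y by simp
    qed
    also have "\<dots> \<longleftrightarrow> (k \<otimes> ?y) \<otimes> x [^] i = v \<otimes> x [^] i"
      using k v xp m_rcancel[of "x [^] i" "k \<otimes> ?y" v] by auto
    also have "(k \<otimes> ?y) \<otimes> x [^] i = k \<otimes> x [^] j"
      using k xp x False by (simp add: m_assoc nat_pow_mult)
    finally show ?thesis .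
  qed
qed

text \<open>The assumptions on \<open>\<iota>\<close> say that \<open>K\<close> is a fraction field
  of \<open>B\<close>. They are kept abstract since \<open>K\<close> will be the stalk at the
  generic point of the scheme.\<close>

locale dvr_valuation = one_dimensional_normal B + K: field K
  for B :: "('a, 'm) ring_scheme" (structure) and K :: "('k, 'n) ring_scheme" +
  fixes \<iota> :: "'a \<Rightarrow> 'k"
  assumes \<iota>_hom: "\<iota> \<in> ring_hom B K"
    and \<iota>_inj: "\<lbrakk>a \<in> carrier B; \<iota> a = \<zero>\<^bsub>K\<^esub>\<rbrakk> \<Longrightarrow> a = \<zero>"
    and \<iota>_frac: "k \<in> carrier K \<Longrightarrow> \<exists>a\<in>carrier B. \<exists>b\<in>carrier B - {\<zero>}. k \<otimes>\<^bsub>K\<^esub> \<iota> b = \<iota> a"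
begin

interpretation h: ring_hom_cring B K \<iota> by unfold_locales (rule \<iota>_hom)

lemma \<iota>_eqD: assumes "a \<in> carrier B" "b \<in> carrier B" "\<iota> a = \<iota> b" shows "a = b"
proof -
  have "\<iota> (a \<ominus> b) = \<iota> a \<ominus>\<^bsub>K\<^esub> \<iota> b" using assms by (simp add: minus_eq K.minus_eq)
  then have "\<iota> (a \<ominus> b) = \<zero>\<^bsub>K\<^esub>" using assms by simp
  then show ?thesis using \<iota>_inj[of "a \<ominus> b"] assms by simp
qed

lemma \<iota>_pow: "a \<in> carrier B \<Longrightarrow> \<iota> (a [^] (n::nat)) = \<iota> a [^]\<^bsub>K\<^esub> n"
  by (induction n) auto

lemma \<iota>_nonzero: "\<lbrakk>a \<in> carrier B; a \<noteq> \<zero>\<rbrakk> \<Longrightarrow> \<iota> a \<noteq> \<zero>\<^bsub>K\<^esub>"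
  using \<iota>_inj by blast

definition uniform :: "'a \<Rightarrow> bool" where
  "uniform \<pi> \<longleftrightarrow> \<pi> \<in> carrier B \<and> PIdl \<pi> = M"

lemma uniformD:
  assumes "uniform \<pi>" shows "\<pi> \<in> carrier B" "PIdl \<pi> = M" "\<pi> \<noteq> \<zero>" "\<pi> \<notin> Units B"
proof -
  show c: "\<pi> \<in> carrier B" "PIdl \<pi> = M" using assms by (auto simp: uniform_def)
  show "\<pi> \<noteq> \<zero>"
  proof
    assume "\<pi> = \<zero>"
    then have "M = {\<zero>}" using c(2) by (metis cgenideal_eq_genideal genideal_zero zero_closed)
    then show False using nonzero by blast
  qed
  show "\<pi> \<notin> Units B" using M_iff[OF c(1)] cgenideal_self[OF c(1)] c(2) by blast
qed

lemma pow_nonzero: "\<lbrakk>x \<in> carrier B; x \<noteq> \<zero>\<rbrakk> \<Longrightarrow> x [^] (n::nat) \<noteq> \<zero>"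
  by (induction n) (auto simp: integral_iff)

lemma unit_power_less:
  assumes \<pi>: "uniform \<pi>" and uv: "u \<in> Units B" "v \<in> Units B" and eq: "u \<otimes> \<pi> [^] (a::nat) = v \<otimes> \<pi> [^] (b::nat)"
  shows "\<not> a < b"
proof
  note pi = uniformD[OF \<pi>]
  note C = Units_closed[OF uv(1)] Units_closed[OF uv(2)]
  assume ab: "a < b"
  then have "\<pi> [^] b = \<pi> [^] (b - a) \<otimes> \<pi> [^] a" using pi(1) by (simp add: nat_pow_mult)
  then have "u \<otimes> \<pi> [^] a = (v \<otimes> \<pi> [^] (b - a)) \<otimes> \<pi> [^] a" using eq C pi(1) by (simp add: m_assoc)
  then have u: "u = v \<otimes> \<pi> [^] (b - a)"
    using m_rcancel[of "\<pi> [^] a" u "v \<otimes> \<pi> [^] (b - a)"] pow_nonzero[OF pi(1,3)] pi(1) C by simp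
  obtain m where m: "b - a = Suc m" using ab by (metis Suc_diff_Suc)
  have "u = \<pi> \<otimes> (v \<otimes> \<pi> [^] m)" using u C pi(1) unfolding m by (simp add: m_ac)
  then have "\<pi> divides u" using C pi(1) by (metis dividesI m_closed nat_pow_closed)
  then have "\<pi> \<in> Units B" using divides_unit[OF _ pi(1) uv(1)] by blast
  then show False using pi by blast
qed

lemma unit_power_unique:
  assumes "uniform \<pi>" "u \<in> Units B" "v \<in> Units B" "u \<otimes> \<pi> [^] (a::nat) = v \<otimes> \<pi> [^] (b::nat)"
  shows "a = b"
  using unit_power_less[OF assms(1-3) assms(4)] unit_power_less[OF assms(1,3,2) assms(4)[symmetric]] by simp

text \<open>The same formula as in \<open>ord_along\<close>. The uniformizer is quantified inside
  the description, so uniqueness includes independence of its choice.\<close>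

definition ordv :: "'k \<Rightarrow> int" where
  "ordv k = (THE n. \<exists>\<pi>\<in>carrier B. \<exists>u\<in>Units B. PIdl \<pi> = M \<and> k = \<iota> u \<otimes>\<^bsub>K\<^esub> (\<iota> \<pi> [^]\<^bsub>K\<^esub> (n::int)))"

lemma Units_pow: "u \<in> Units B \<Longrightarrow> u [^] (n::nat) \<in> Units B"
  by (induction n) auto

text \<open>Two uniformizers differ by a unit. Comparing the given representation with any other
  one, after clearing denominators, leaves an identity between powers of one uniformizer, whose
  exponents must agree.\<close>

lemma ordv_eq:
  assumes \<pi>: "uniform \<pi>" and k: "k \<in> carrier K" and u: "u \<in> Units B"
    and eq: "k \<otimes>\<^bsub>K\<^esub> \<iota> (\<pi> [^] j) = \<iota> (u \<otimes> \<pi> [^] i)"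
  shows "ordv k = int i - int j"
  unfolding ordv_def
proof (rule the_equality)
  note pi = uniformD[OF \<pi>]
  have uB: "u \<in> carrier B" using u by auto
  have "k \<otimes>\<^bsub>K\<^esub> \<iota> \<pi> [^]\<^bsub>K\<^esub> j = \<iota> u \<otimes>\<^bsub>K\<^esub> \<iota> \<pi> [^]\<^bsub>K\<^esub> i" using eq uB pi(1) by (simp add: \<iota>_pow)
  then have "k = \<iota> u \<otimes>\<^bsub>K\<^esub> (\<iota> \<pi> [^]\<^bsub>K\<^esub> (int i - int j))"
    using K.int_pow_diff_iff[of "\<iota> \<pi>" "\<iota> u" k i j] \<iota>_nonzero pi uB k by simp
  then show "\<exists>\<pi>\<in>carrier B. \<exists>u\<in>Units B. PIdl \<pi> = M \<and> k = \<iota> u \<otimes>\<^bsub>K\<^esub> (\<iota> \<pi> [^]\<^bsub>K\<^esub> (int i - int j))"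
    using pi u by blast
  fix n :: int
  assume "\<exists>\<pi>\<in>carrier B. \<exists>u\<in>Units B. PIdl \<pi> = M \<and> k = \<iota> u \<otimes>\<^bsub>K\<^esub> (\<iota> \<pi> [^]\<^bsub>K\<^esub> n)"
  then obtain \<rho> v where \<rho>: "uniform \<rho>" and v: "v \<in> Units B" and kv: "k = \<iota> v \<otimes>\<^bsub>K\<^esub> (\<iota> \<rho> [^]\<^bsub>K\<^esub> n)"
    by (auto simp: uniform_def)
  note rho = uniformD[OF \<rho>]
  \<comment> \<open>Positive and negative part of \<open>n\<close>, in order to use natural
    exponents.\<close>
  define i' j' where "i' = nat n" and "j' = nat (- n)"
  have n: "n = int i' - int j'" by (simp add: i'_def j'_def)
  have vB: "v \<in> carrier B" using v by auto
  have "k \<otimes>\<^bsub>K\<^esub> \<iota> \<rho> [^]\<^bsub>K\<^esub> j' = \<iota> v \<otimes>\<^bsub>K\<^esub> \<iota> \<rho> [^]\<^bsub>K\<^esub> i'"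
    using K.int_pow_diff_iff[of "\<iota> \<rho>" "\<iota> v" k i' j'] kv n \<iota>_nonzero rho vB k by simp
  then have eq': "k \<otimes>\<^bsub>K\<^esub> \<iota> (\<rho> [^] j') = \<iota> (v \<otimes> \<rho> [^] i')" using rho vB by (simp add: \<iota>_pow)
  have "\<rho> \<sim> \<pi>" using associated_iff_same_ideal[OF rho(1) pi(1)] rho pi by simp
  then obtain w where w: "w \<in> Units B" "\<rho> = w \<otimes> \<pi>" using ring_associated_iff[OF rho(1) pi(1)] by blast
  have wB: "w \<in> carrier B" using w by auto
  have rp: "\<rho> [^] m = w [^] m \<otimes> \<pi> [^] m" for m :: nat
    unfolding w(2) by (rule nat_pow_distrib[OF wB pi(1)])
  have p: "\<pi> [^] m \<in> carrier B" "\<rho> [^] m \<in> carrier B" "w [^] m \<in> carrier B" for m :: nat using pi rho wB by auto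
  have "\<iota> ((u \<otimes> \<pi> [^] i) \<otimes> \<rho> [^] j') = (k \<otimes>\<^bsub>K\<^esub> \<iota> (\<pi> [^] j)) \<otimes>\<^bsub>K\<^esub> \<iota> (\<rho> [^] j')"
    unfolding eq using uB p by (intro h.hom_mult) auto
  also have "\<dots> = (k \<otimes>\<^bsub>K\<^esub> \<iota> (\<rho> [^] j')) \<otimes>\<^bsub>K\<^esub> \<iota> (\<pi> [^] j)"
    using k h.hom_closed[OF p(1)] h.hom_closed[OF p(2)] by (simp add: K.m_ac)
  also have "\<dots> = \<iota> ((v \<otimes> \<rho> [^] i') \<otimes> \<pi> [^] j)"
    unfolding eq' using vB p by (intro h.hom_mult[symmetric]) auto
  finally have "(u \<otimes> \<pi> [^] i) \<otimes> \<rho> [^] j' = (v \<otimes> \<rho> [^] i') \<otimes> \<pi> [^] j"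
    using uB vB p by (intro \<iota>_eqD) auto
  moreover have "(u \<otimes> \<pi> [^] i) \<otimes> \<rho> [^] j' = (u \<otimes> w [^] j') \<otimes> (\<pi> [^] i \<otimes> \<pi> [^] j')"
    unfolding rp using uB p by (simp add: m_ac)
  moreover have "(v \<otimes> \<rho> [^] i') \<otimes> \<pi> [^] j = (v \<otimes> w [^] i') \<otimes> (\<pi> [^] i' \<otimes> \<pi> [^] j)"
    unfolding rp using vB p by (simp add: m_ac)
  ultimately have "(u \<otimes> w [^] j') \<otimes> \<pi> [^] (i + j') = (v \<otimes> w [^] i') \<otimes> \<pi> [^] (i' + j)"
    using pi(1) by (simp add: nat_pow_mult)
  then have "i + j' = i' + j"
    by (rule unit_power_unique[OF \<pi>, rotated 2]) (use u v w Units_pow in auto)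
  then show "n = int i - int j" unfolding n by linarith
qed

lemma ordv_exists:
  assumes \<pi>: "uniform \<pi>" and k: "k \<in> carrier K" "k \<noteq> \<zero>\<^bsub>K\<^esub>"
  obtains u i j where "u \<in> Units B" "k \<otimes>\<^bsub>K\<^esub> \<iota> (\<pi> [^] (j::nat)) = \<iota> (u \<otimes> \<pi> [^] (i::nat))" "ordv k = int i - int j"
proof -
  note pi = uniformD[OF \<pi>]
  obtain a b where ab: "a \<in> carrier B" "b \<in> carrier B" "b \<noteq> \<zero>" "k \<otimes>\<^bsub>K\<^esub> \<iota> b = \<iota> a"
    using \<iota>_frac[OF k(1)] by blast
  have "k \<otimes>\<^bsub>K\<^esub> \<iota> b \<noteq> \<zero>\<^bsub>K\<^esub>"
    using K.integral_iff[OF k(1) h.hom_closed[OF ab(2)]] k(2) \<iota>_nonzero[OF ab(2,3)] by blast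
  then have "\<iota> a \<noteq> \<zero>\<^bsub>K\<^esub>" by (simp add: ab(4))
  then have "a \<noteq> \<zero>" by auto
  obtain u i where u: "u \<in> Units B" "a = u \<otimes> \<pi> [^] (i::nat)"
    using unit_times_power[OF pi(1-3) ab(1) \<open>a \<noteq> \<zero>\<close>] by blast
  obtain v j where v: "v \<in> Units B" "b = v \<otimes> \<pi> [^] (j::nat)"
    using unit_times_power[OF pi(1-3) ab(2,3)] by blast
  have C: "u \<in> carrier B" "v \<in> carrier B" "inv v \<in> carrier B" "\<pi> [^] i \<in> carrier B" "\<pi> [^] j \<in> carrier B"
    using u v pi by auto
  have "\<pi> [^] j = inv v \<otimes> b" unfolding v(2) using C v(1) by (simp add: m_assoc[symmetric])
  then have "k \<otimes>\<^bsub>K\<^esub> \<iota> (\<pi> [^] j) = k \<otimes>\<^bsub>K\<^esub> (\<iota> (inv v) \<otimes>\<^bsub>K\<^esub> \<iota> b)" using C ab by simp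
  also have "\<dots> = \<iota> (inv v) \<otimes>\<^bsub>K\<^esub> (k \<otimes>\<^bsub>K\<^esub> \<iota> b)"
    by (rule K.m_lcomm) (use k C ab in auto)
  also have "\<dots> = \<iota> (inv v \<otimes> a)" unfolding ab(4) using C ab by simp
  also have "inv v \<otimes> a = (inv v \<otimes> u) \<otimes> \<pi> [^] i" unfolding u(2) using C by (simp add: m_assoc)
  finally have *: "k \<otimes>\<^bsub>K\<^esub> \<iota> (\<pi> [^] j) = \<iota> ((inv v \<otimes> u) \<otimes> \<pi> [^] i)" .
  have "inv v \<otimes> u \<in> Units B" using u v by simp
  then show ?thesis using that * ordv_eq[OF \<pi> k(1) _ *] by blast
qed

lemma uniform_exists: obtains \<pi> where "uniform \<pi>"
  using uniformizer by (auto simp: uniform_def)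

lemma ordv_valuation: "valuation K ordv"
  unfolding valuation_def
proof (intro ballI)
  fix k l assume "k \<in> carrier K - {\<zero>\<^bsub>K\<^esub>}" "l \<in> carrier K - {\<zero>\<^bsub>K\<^esub>}"
  then have k: "k \<in> carrier K" "k \<noteq> \<zero>\<^bsub>K\<^esub>" and l: "l \<in> carrier K" "l \<noteq> \<zero>\<^bsub>K\<^esub>" by auto
  obtain \<pi> where \<pi>: "uniform \<pi>" by (rule uniform_exists)
  note pi = uniformD[OF \<pi>]
  obtain u i j where u: "u \<in> Units B" "k \<otimes>\<^bsub>K\<^esub> \<iota> (\<pi> [^] (j::nat)) = \<iota> (u \<otimes> \<pi> [^] (i::nat))" "ordv k = int i - int j"
    using ordv_exists[OF \<pi> k] .
  obtain v i' j' where v: "v \<in> Units B" "l \<otimes>\<^bsub>K\<^esub> \<iota> (\<pi> [^] (j'::nat)) = \<iota> (v \<otimes> \<pi> [^] (i'::nat))" "ordv l = int i' - int j'"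
    using ordv_exists[OF \<pi> l] .
  have C: "u \<in> carrier B" "v \<in> carrier B" "\<pi> [^] m \<in> carrier B" for m :: nat
    using u v pi by auto
  note hc = h.hom_closed[OF C(3)]
  have pj: "\<iota> (\<pi> [^] (j + j')) = \<iota> (\<pi> [^] j) \<otimes>\<^bsub>K\<^esub> \<iota> (\<pi> [^] j')"
    using pi(1) C by (simp flip: nat_pow_mult)
  have "(k \<otimes>\<^bsub>K\<^esub> l) \<otimes>\<^bsub>K\<^esub> \<iota> (\<pi> [^] (j + j')) = (k \<otimes>\<^bsub>K\<^esub> \<iota> (\<pi> [^] j)) \<otimes>\<^bsub>K\<^esub> (l \<otimes>\<^bsub>K\<^esub> \<iota> (\<pi> [^] j'))"
    unfolding pj using k l hc by (simp add: K.m_ac)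
  also have "\<dots> = \<iota> ((u \<otimes> \<pi> [^] i) \<otimes> (v \<otimes> \<pi> [^] i'))" unfolding u(2) v(2) using C by simp
  also have "(u \<otimes> \<pi> [^] i) \<otimes> (v \<otimes> \<pi> [^] i') = (u \<otimes> v) \<otimes> (\<pi> [^] i \<otimes> \<pi> [^] i')" using C by (simp add: m_ac)
  also have "\<pi> [^] i \<otimes> \<pi> [^] i' = \<pi> [^] (i + i')" using pi(1) by (simp add: nat_pow_mult)
  finally have "ordv (k \<otimes>\<^bsub>K\<^esub> l) = int (i + i') - int (j + j')"
    using ordv_eq[OF \<pi>, of "k \<otimes>\<^bsub>K\<^esub> l" "u \<otimes> v"] k l u(1) v(1) by simp
  then have mult: "ordv (k \<otimes>\<^bsub>K\<^esub> l) = ordv k + ordv l" using u(3) v(3) by simp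
  have "min (ordv k) (ordv l) \<le> ordv (k \<oplus>\<^bsub>K\<^esub> l)" if nz: "k \<oplus>\<^bsub>K\<^esub> l \<noteq> \<zero>\<^bsub>K\<^esub>"
  proof -
    \<comment> \<open>The smaller of the two exponents after the denominators \<open>\<pi>^j\<close>
      and \<open>\<pi>^j'\<close> are cleared. The remaining factor \<open>e\<close> lies in the
      ring, so it contributes only a nonnegative power of \<open>\<pi>\<close>.\<close>
    define m where "m = min (i + j') (i' + j)"
    define e where "e = u \<otimes> \<pi> [^] (i + j' - m) \<oplus> v \<otimes> \<pi> [^] (i' + j - m)"
    have eB: "e \<in> carrier B" using C by (simp add: e_def)
    have split: "\<pi> [^] n = \<pi> [^] (n - m) \<otimes> \<pi> [^] m" if "m \<le> n" for n
      using that pi(1) by (simp add: nat_pow_mult)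
    have e: "e \<otimes> \<pi> [^] m = u \<otimes> \<pi> [^] (i + j') \<oplus> v \<otimes> \<pi> [^] (i' + j)"
      using split[of "i + j'"] split[of "i' + j"] C by (simp add: e_def m_def l_distr m_assoc)
    have "(k \<oplus>\<^bsub>K\<^esub> l) \<otimes>\<^bsub>K\<^esub> \<iota> (\<pi> [^] (j + j'))
        = (k \<otimes>\<^bsub>K\<^esub> \<iota> (\<pi> [^] j)) \<otimes>\<^bsub>K\<^esub> \<iota> (\<pi> [^] j') \<oplus>\<^bsub>K\<^esub> (l \<otimes>\<^bsub>K\<^esub> \<iota> (\<pi> [^] j')) \<otimes>\<^bsub>K\<^esub> \<iota> (\<pi> [^] j)"
      unfolding pj using k l hc by (simp add: K.l_distr K.m_ac)
    also have "\<dots> = \<iota> ((u \<otimes> \<pi> [^] i) \<otimes> \<pi> [^] j' \<oplus> (v \<otimes> \<pi> [^] i') \<otimes> \<pi> [^] j)"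
      unfolding u(2) v(2) using C by simp
    also have "(u \<otimes> \<pi> [^] i) \<otimes> \<pi> [^] j' \<oplus> (v \<otimes> \<pi> [^] i') \<otimes> \<pi> [^] j = e \<otimes> \<pi> [^] m"
      unfolding e using C pi(1) by (simp add: m_assoc nat_pow_mult)
    finally have eq: "(k \<oplus>\<^bsub>K\<^esub> l) \<otimes>\<^bsub>K\<^esub> \<iota> (\<pi> [^] (j + j')) = \<iota> (e \<otimes> \<pi> [^] m)" .
    have kl: "k \<oplus>\<^bsub>K\<^esub> l \<in> carrier K" using k l by simp
    have "\<iota> (\<pi> [^] (j + j')) \<noteq> \<zero>\<^bsub>K\<^esub>" using \<iota>_nonzero C pow_nonzero pi by blast
    then have "\<iota> (e \<otimes> \<pi> [^] m) \<noteq> \<zero>\<^bsub>K\<^esub>" unfolding eq[symmetric] using nz kl hc by (simp add: K.integral_iff)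
    then have "e \<noteq> \<zero>" using C by auto
    then obtain w t where w: "w \<in> Units B" "e = w \<otimes> \<pi> [^] (t::nat)"
      using unit_times_power[OF pi(1-3) eB] by blast
    have "e \<otimes> \<pi> [^] m = w \<otimes> \<pi> [^] (t + m)" unfolding w(2) using Units_closed[OF w(1)] C pi(1)
      by (simp add: m_assoc nat_pow_mult)
    then have "ordv (k \<oplus>\<^bsub>K\<^esub> l) = int (t + m) - int (j + j')"
      using ordv_eq[OF \<pi> kl w(1)] eq by simp
    then show ?thesis using u(3) v(3) by (simp add: m_def)
  qed
  then show "ordv (k \<otimes>\<^bsub>K\<^esub> l) = ordv k + ordv l \<and> (k \<oplus>\<^bsub>K\<^esub> l \<noteq> \<zero>\<^bsub>K\<^esub> \<longrightarrow> min (ordv k) (ordv l) \<le> ordv (k \<oplus>\<^bsub>K\<^esub> l))"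
    using mult by blast
qed

lemma ordv_zero:
  assumes k: "k \<in> carrier K" and ab: "a \<in> Units B" "b \<in> Units B" "k \<otimes>\<^bsub>K\<^esub> \<iota> b = \<iota> a"
  shows "ordv k = 0"
proof -
  obtain \<pi> where \<pi>: "uniform \<pi>" by (rule uniform_exists)
  have C: "a \<in> carrier B" "b \<in> carrier B" "inv b \<in> carrier B" using ab by auto
  have "(k \<otimes>\<^bsub>K\<^esub> \<iota> b) \<otimes>\<^bsub>K\<^esub> \<iota> (inv b) = k \<otimes>\<^bsub>K\<^esub> (\<iota> b \<otimes>\<^bsub>K\<^esub> \<iota> (inv b))"
    by (rule K.m_assoc) (use k C in auto)
  also have "\<iota> b \<otimes>\<^bsub>K\<^esub> \<iota> (inv b) = \<iota> (b \<otimes> inv b)" using C by simp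
  also have "k \<otimes>\<^bsub>K\<^esub> \<dots> = k" using k ab(2) by simp
  finally have "k = (k \<otimes>\<^bsub>K\<^esub> \<iota> b) \<otimes>\<^bsub>K\<^esub> \<iota> (inv b)" ..
  also have "\<dots> = \<iota> (a \<otimes> inv b)" unfolding ab(3) using C by simp
  finally have "k \<otimes>\<^bsub>K\<^esub> \<iota> (\<pi> [^] (0::nat)) = \<iota> ((a \<otimes> inv b) \<otimes> \<pi> [^] (0::nat))"
    using k C by simp
  then show ?thesis using ordv_eq[OF \<pi> k, of "a \<otimes> inv b" 0 0] ab by simp
qed

end

section \<open>Stalks of a chart\<close>

text \<open>Noetherian induction: a maximal ideal \<open>I\<close> without such a set is proper and
  not prime, so some product \<open>a \<otimes> b\<close> lies in it while neither factor does.
  Every prime over \<open>I\<close> contains \<open>a\<close> or \<open>b\<close>, and the sets for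
  the two larger ideals combine. The primes in \<open>F\<close> need only lie below all others;
  minimality of each is not demanded.\<close>

lemma (in noetherian_ring) finite_minimal_primes:
  assumes cr: "cring R" and J: "ideal J R"
  shows "\<exists>F. finite F \<and> (\<forall>q\<in>F. primeideal q R \<and> J \<subseteq> q) \<and> (\<forall>q. primeideal q R \<and> J \<subseteq> q \<longrightarrow> (\<exists>q'\<in>F. q' \<subseteq> q))"
proof (rule ccontr)
  interpret cring R by (rule cr)
  define good where "good J F \<longleftrightarrow> finite F \<and> (\<forall>q\<in>F. primeideal q R \<and> J \<subseteq> q) \<and>
      (\<forall>q. primeideal q R \<and> J \<subseteq> q \<longrightarrow> (\<exists>q'\<in>F. q' \<subseteq> q))" for J F
  define S where "S = {J. ideal J R \<and> \<not> (\<exists>F. good J F)}"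
  assume "\<not> ?thesis"
  then have "J \<in> S" using J by (simp add: S_def good_def)
  then have "S \<noteq> {}" by blast
  moreover have "ideal I R" if "I \<in> S" for I using that by (simp add: S_def)
  ultimately obtain I where I: "I \<in> S" "\<forall>I'\<in>S. I \<subseteq> I' \<longrightarrow> I' = I" using exists_maximal_ideal_in[of S] by blast
  then have iI: "ideal I R" and nI: "\<And>F. \<not> good I F" by (simp_all add: S_def)
  have "\<not> primeideal I R"
  proof
    assume "primeideal I R"
    then have "good I {I}" by (simp add: good_def)
    then show False using nI by blast
  qed
  moreover have "carrier R \<noteq> I"
  proof
    assume c: "carrier R = I"
    have "\<not> (primeideal q R \<and> I \<subseteq> q)" for q
      using primeideal.I_notcarr[of q R] ideal.Icarr[OF primeideal.axioms(1), of q R] c by blast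
    then have "good I {}" by (simp add: good_def)
    then show False using nI by blast
  qed
  ultimately obtain a b where ab: "a \<in> carrier R" "b \<in> carrier R" "a \<otimes> b \<in> I" "a \<notin> I" "b \<notin> I"
    using primeidealI[OF iI cr] by blast
  have ext: "\<exists>F. good (Idl (insert c I)) F" "I \<subseteq> Idl (insert c I)" "c \<in> Idl (insert c I)"
    "\<And>q. primeideal q R \<Longrightarrow> I \<subseteq> q \<Longrightarrow> c \<in> q \<Longrightarrow> Idl (insert c I) \<subseteq> q"
    if c: "c \<in> carrier R" "c \<notin> I" for c
  proof -
    have sub: "insert c I \<subseteq> carrier R" using c ideal.Icarr[OF iI] by blast
    note self = genideal_self[OF sub]
    show "I \<subseteq> Idl (insert c I)" "c \<in> Idl (insert c I)" using self by auto
    show "Idl (insert c I) \<subseteq> q" if "primeideal q R" "I \<subseteq> q" "c \<in> q" for q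
      using genideal_minimal[OF primeideal.axioms(1)[OF that(1)]] that by blast
    have "Idl (insert c I) \<noteq> I" using self c by blast
    then have "Idl (insert c I) \<notin> S" using I(2) self by blast
    then show "\<exists>F. good (Idl (insert c I)) F" using genideal_ideal[OF sub] by (simp add: S_def)
  qed
  obtain F G where FG: "good (Idl (insert a I)) F" "good (Idl (insert b I)) G"
    using ext(1) ab by blast
  have "good I (F \<union> G)" unfolding good_def
  proof (intro conjI allI impI)
    show "finite (F \<union> G)" using FG by (simp add: good_def)
    have F: "primeideal q R" "I \<subseteq> q" if "q \<in> F" for q
    proof -
      have "primeideal q R" "Idl (insert a I) \<subseteq> q" using FG(1) that unfolding good_def by auto
      then show "primeideal q R" "I \<subseteq> q" using ext(2)[OF ab(1,4)] by auto
    qed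
    have G: "primeideal q R" "I \<subseteq> q" if "q \<in> G" for q
    proof -
      have "primeideal q R" "Idl (insert b I) \<subseteq> q" using FG(2) that unfolding good_def by auto
      then show "primeideal q R" "I \<subseteq> q" using ext(2)[OF ab(2,5)] by auto
    qed
    show "\<forall>q\<in>F \<union> G. primeideal q R \<and> I \<subseteq> q"
    proof
      fix q assume "q \<in> F \<union> G"
      then show "primeideal q R \<and> I \<subseteq> q" using F[of q] G[of q] by (elim UnE) simp_all
    qed
    fix q assume q: "primeideal q R \<and> I \<subseteq> q"
    then have "a \<in> q \<or> b \<in> q" using primeideal.I_prime[of q R a b] ab(1-3) by (meson subsetD)
    then consider "Idl (insert a I) \<subseteq> q" | "Idl (insert b I) \<subseteq> q"
      using ext(4)[OF ab(1,4), of q] ext(4)[OF ab(2,5), of q] q by (elim disjE) simp_all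
    then show "\<exists>q'\<in>F \<union> G. q' \<subseteq> q"
    proof cases
      case 1
      then have "\<exists>q'\<in>F. q' \<subseteq> q" using FG(1) q unfolding good_def by simp
      then show ?thesis by blast
    next
      case 2
      then have "\<exists>q'\<in>G. q' \<subseteq> q" using FG(2) q unfolding good_def by simp
      then show ?thesis by blast
    qed
  qed
  then show False using nI by blast
qed

text \<open>Normality enters here through the stalks being domains; integral closedness is brought
  in for the stalks at prime divisors.\<close>

locale normal_chart = sheaf_of_rings \<XX> for \<XX> :: "('a, 'b) ringed_space" +
  fixes U :: "'a set" and A :: "'b ring" and p :: "'a \<Rightarrow> 'b set" and \<psi> :: "'a \<Rightarrow> 'b \<Rightarrow> ('a set \<times> 'b) set"
  assumes chart: "chart U A p \<psi>" and noetherian_A: "noetherian_ring A"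
    and stalk_domain: "x \<in> U \<Longrightarrow> domain (stalk \<XX> x)"
begin

abbreviation "stk \<equiv> stalk \<XX>"

sublocale A: cring A using chart by (simp add: chart_def)
sublocale AN: noetherian_ring A by (rule noetherian_A)

lemma U: "openin T U" and p_bij: "bij_betw p U {q. primeideal q A}"
  using chart by (simp_all add: chart_def)

lemma p_prime: "x \<in> U \<Longrightarrow> primeideal (p x) A"
  using bij_betwE[OF p_bij] by blast

lemma p_inj: "\<lbrakk>x \<in> U; y \<in> U; p x = p y\<rbrakk> \<Longrightarrow> x = y"
  using p_bij unfolding bij_betw_def inj_on_def by blast

lemma p_surj: assumes "primeideal q A" shows "\<exists>x\<in>U. p x = q"
proof -
  have "q \<in> p ` U" unfolding bij_betw_imp_surj_on[OF p_bij] using assms by simp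
  then show ?thesis by blast
qed

lemma p_carrier: "x \<in> U \<Longrightarrow> p x \<subseteq> carrier A"
  using ideal.Icarr[OF primeideal.axioms(1)[OF p_prime]] by blast

lemma basic_open: "s \<in> carrier A \<Longrightarrow> openin T {x \<in> U. s \<notin> p x}"
  using chart by (simp add: chart_def)

lemma basic_nbhd:
  assumes "openin T N" "N \<subseteq> U" "x \<in> N"
  obtains s where "s \<in> carrier A" "s \<notin> p x" "\<And>y. \<lbrakk>y \<in> U; s \<notin> p y\<rbrakk> \<Longrightarrow> y \<in> N"
proof -
  have "\<exists>s\<in>carrier A - p x. \<forall>y\<in>U. s \<notin> p y \<longrightarrow> y \<in> N"
    using chart assms unfolding chart_def by blast
  then show ?thesis using that by blast
qed

lemma generalizes_iff: "\<lbrakk>x \<in> U; y \<in> U\<rbrakk> \<Longrightarrow> generalizes y x \<longleftrightarrow> p y \<subseteq> p x"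
  using chart unfolding chart_def by blast

lemma psi_hom: "x \<in> U \<Longrightarrow> \<psi> x \<in> ring_hom A (stk x)"
  using chart unfolding chart_def by blast

lemma cospecialize_psi: "\<lbrakk>x \<in> U; y \<in> U; generalizes y x; a \<in> carrier A\<rbrakk> \<Longrightarrow> cospecialize \<XX> y (\<psi> x a) = \<psi> y a"
  using chart unfolding chart_def by blast

lemma generalization_in: "\<lbrakk>x \<in> U; generalizes y x\<rbrakk> \<Longrightarrow> y \<in> U"
  using U unfolding generalizes_def by blast

lemma prime_mult: "\<lbrakk>x \<in> U; a \<in> carrier A; b \<in> carrier A; a \<otimes>\<^bsub>A\<^esub> b \<in> p x\<rbrakk> \<Longrightarrow> a \<in> p x \<or> b \<in> p x"
  by (rule primeideal.I_prime[OF p_prime])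

lemma one_notin: assumes "x \<in> U" shows "\<one>\<^bsub>A\<^esub> \<notin> p x"
  using ideal.one_imp_carrier[OF primeideal.axioms(1)[OF p_prime[OF assms]]] primeideal.I_notcarr[OF p_prime[OF assms]]
  by auto

lemma zero_in: assumes "x \<in> U" shows "\<zero>\<^bsub>A\<^esub> \<in> p x"
  using additive_subgroup.zero_closed[OF ideal.axioms(1)[OF primeideal.axioms(1)[OF p_prime[OF assms]]]] .

context fixes x assumes x: "x \<in> U"
begin

interpretation S: domain "stk x" by (rule stalk_domain[OF x])
interpretation h: ring_hom_cring A "stk x" "\<psi> x" by unfold_locales (rule psi_hom[OF x])

lemma psi_closed: "a \<in> carrier A \<Longrightarrow> \<psi> x a \<in> carrier (stk x)" by simp

lemma psi_Units: assumes "s \<in> carrier A" "s \<notin> p x" shows "\<psi> x s \<in> Units (stk x)"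
proof -
  have "\<exists>v\<in>carrier (stk x). v \<otimes>\<^bsub>stk x\<^esub> \<psi> x s = \<one>\<^bsub>stk x\<^esub>"
    using chart x assms unfolding chart_def by blast
  then obtain v where v: "v \<in> carrier (stk x)" "v \<otimes>\<^bsub>stk x\<^esub> \<psi> x s = \<one>\<^bsub>stk x\<^esub>" by blast
  then have "\<psi> x s \<otimes>\<^bsub>stk x\<^esub> v = \<one>\<^bsub>stk x\<^esub>" using S.m_comm[of v "\<psi> x s"] assms by simp
  then show ?thesis using v assms unfolding Units_def by blast
qed

lemma fraction:
  assumes "P \<in> carrier (stk x)"
  obtains a s where "a \<in> carrier A" "s \<in> carrier A" "s \<notin> p x" "P \<otimes>\<^bsub>stk x\<^esub> \<psi> x s = \<psi> x a"
proof -
  have "\<exists>a\<in>carrier A. \<exists>s\<in>carrier A - p x. P \<otimes>\<^bsub>stk x\<^esub> \<psi> x s = \<psi> x a"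
    using chart x assms unfolding chart_def by blast
  then show ?thesis using that by blast
qed

lemma psi_zero_annihilated: "\<lbrakk>a \<in> carrier A; \<psi> x a = \<zero>\<^bsub>stk x\<^esub>\<rbrakk> \<Longrightarrow> \<exists>s\<in>carrier A - p x. s \<otimes>\<^bsub>A\<^esub> a = \<zero>\<^bsub>A\<^esub>"
proof -
  assume a: "a \<in> carrier A" "\<psi> x a = \<zero>\<^bsub>stk x\<^esub>"
  then have "\<psi> x a = \<psi> x \<zero>\<^bsub>A\<^esub>" by simp
  then show ?thesis using chart x a(1) unfolding chart_def by blast
qed

lemma psi_Units_nonzero: "\<lbrakk>s \<in> carrier A; s \<notin> p x\<rbrakk> \<Longrightarrow> \<psi> x s \<noteq> \<zero>\<^bsub>stk x\<^esub>"
  using psi_Units S.Units_r_inv_ex S.zero_not_one by force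

text \<open>The kernel of the map from the coordinate ring to the stalk. It is prime because the
  stalk is a domain, and will be the prime of the generic point.\<close>

definition "ker = {a \<in> carrier A. \<psi> x a = \<zero>\<^bsub>stk x\<^esub>}"

lemma ker_sub: "ker \<subseteq> p x"
proof
  fix a assume "a \<in> ker"
  then have a: "a \<in> carrier A" "\<psi> x a = \<zero>\<^bsub>stk x\<^esub>" by (auto simp: ker_def)
  then obtain s where "s \<in> carrier A - p x" "s \<otimes>\<^bsub>A\<^esub> a = \<zero>\<^bsub>A\<^esub>" using psi_zero_annihilated by blast
  then show "a \<in> p x" using prime_mult[OF x _ a(1), of s] zero_in[OF x] by auto
qed

lemma preimage_ideal: assumes J: "ideal J (stk x)" shows "ideal {a \<in> carrier A. \<psi> x a \<in> J} A"
proof (rule idealI)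
  interpret J: ideal J "stk x" by (rule J)
  show "ring A" by (rule A.ring_axioms)
  show "subgroup {a \<in> carrier A. \<psi> x a \<in> J} (add_monoid A)"
    by (rule A.add.subgroupI) (auto intro!: exI[of _ "\<zero>\<^bsub>A\<^esub>"])
qed (use ideal.I_l_closed[OF J] ideal.I_r_closed[OF J] in auto)

lemma preimage_prime: assumes J: "primeideal J (stk x)"
  shows "primeideal {a \<in> carrier A. \<psi> x a \<in> J} A" "{a \<in> carrier A. \<psi> x a \<in> J} \<subseteq> p x"
proof -
  interpret J: primeideal J "stk x" by (rule J)
  have n1: "\<one>\<^bsub>stk x\<^esub> \<notin> J" using J.one_imp_carrier J.I_notcarr by auto
  show "primeideal {a \<in> carrier A. \<psi> x a \<in> J} A"
  proof (rule primeidealI)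
    show "ideal {a \<in> carrier A. \<psi> x a \<in> J} A" by (rule preimage_ideal) (rule J.ideal_axioms)
    show "cring A" by (rule A.cring_axioms)
    have "\<one>\<^bsub>A\<^esub> \<notin> {a \<in> carrier A. \<psi> x a \<in> J}" using n1 by simp
    then show "carrier A \<noteq> {a \<in> carrier A. \<psi> x a \<in> J}" using A.one_closed by blast
    show "a \<in> {a \<in> carrier A. \<psi> x a \<in> J} \<or> b \<in> {a \<in> carrier A. \<psi> x a \<in> J}"
      if "a \<in> carrier A" "b \<in> carrier A" "a \<otimes>\<^bsub>A\<^esub> b \<in> {a \<in> carrier A. \<psi> x a \<in> J}" for a b
      using that J.I_prime[of "\<psi> x a" "\<psi> x b"] by auto
  qed
  show "{a \<in> carrier A. \<psi> x a \<in> J} \<subseteq> p x"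
  proof clarify
    fix a assume a: "a \<in> carrier A" "\<psi> x a \<in> J"
    show "a \<in> p x"
    proof (rule ccontr)
      assume "a \<notin> p x"
      then have u: "\<psi> x a \<in> Units (stk x)" using psi_Units a by blast
      then have "inv\<^bsub>stk x\<^esub> \<psi> x a \<otimes>\<^bsub>stk x\<^esub> \<psi> x a \<in> J" using J.I_l_closed a by blast
      then show False using n1 u by simp
    qed
  qed
qed

lemma ker_prime: "primeideal ker A"
proof -
  have "primeideal {\<zero>\<^bsub>stk x\<^esub>} (stk x)" by (rule S.zeroprimeideal)
  from preimage_prime(1)[OF this] show ?thesis by (simp add: ker_def)
qed

text \<open>If the inverse of the image of \<open>a\<close> is \<open>b/s\<close>, then
  \<open>a b - s\<close> is in the kernel and hence in \<open>p x\<close>; so \<open>s\<close> is in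
  \<open>p x\<close> too, a contradiction.\<close>

lemma psi_nonunit: assumes "a \<in> p x" shows "\<psi> x a \<notin> Units (stk x)"
proof
  assume u: "\<psi> x a \<in> Units (stk x)"
  have a: "a \<in> carrier A" using assms p_carrier[OF x] by blast
  obtain v where v: "v \<in> carrier (stk x)" "\<psi> x a \<otimes>\<^bsub>stk x\<^esub> v = \<one>\<^bsub>stk x\<^esub>" using S.Units_r_inv_ex[OF u] by blast
  obtain b s where bs: "b \<in> carrier A" "s \<in> carrier A" "s \<notin> p x" "v \<otimes>\<^bsub>stk x\<^esub> \<psi> x s = \<psi> x b" using fraction[OF v(1)] .
  have "\<psi> x (a \<otimes>\<^bsub>A\<^esub> b) = \<psi> x a \<otimes>\<^bsub>stk x\<^esub> (v \<otimes>\<^bsub>stk x\<^esub> \<psi> x s)" using a bs by simp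
  also have "\<dots> = \<psi> x s" using v a bs(2) by (simp add: S.m_assoc[symmetric])
  finally have "\<psi> x (a \<otimes>\<^bsub>A\<^esub> b) \<ominus>\<^bsub>stk x\<^esub> \<psi> x s = \<zero>\<^bsub>stk x\<^esub>" using bs(2) by simp
  then have "a \<otimes>\<^bsub>A\<^esub> b \<ominus>\<^bsub>A\<^esub> s \<in> ker" using a bs by (simp add: ker_def A.minus_eq S.minus_eq)
  then have d: "a \<otimes>\<^bsub>A\<^esub> b \<ominus>\<^bsub>A\<^esub> s \<in> p x" using ker_sub by blast
  interpret P: primeideal "p x" A by (rule p_prime[OF x])
  have abp: "a \<otimes>\<^bsub>A\<^esub> b \<in> p x" using P.I_r_closed[OF assms bs(1)] .
  have "a \<otimes>\<^bsub>A\<^esub> b \<ominus>\<^bsub>A\<^esub> (a \<otimes>\<^bsub>A\<^esub> b \<ominus>\<^bsub>A\<^esub> s) \<in> p x"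
    unfolding A.minus_eq[of _ "a \<otimes>\<^bsub>A\<^esub> b \<ominus>\<^bsub>A\<^esub> s"] using abp d P.a_closed P.a_inv_closed by simp
  moreover have "a \<otimes>\<^bsub>A\<^esub> b \<ominus>\<^bsub>A\<^esub> (a \<otimes>\<^bsub>A\<^esub> b \<ominus>\<^bsub>A\<^esub> s) = s" using a bs by algebra
  ultimately show False using bs by simp
qed

text \<open>As \<open>A\<close> is Noetherian, a single \<open>s \<notin> p x\<close> kills the kernel, so on \<open>D(s)\<close> that kernel lies in every prime.\<close>

lemma generic_nbhd:
  obtains V g where "openin T V" "x \<in> V" "V \<subseteq> U" "g \<in> V" "p g = ker" "\<And>y. y \<in> V \<Longrightarrow> generalizes g y"
proof -
  obtain F where F: "F \<subseteq> carrier A" "finite F" "ker = Idl\<^bsub>A\<^esub> F"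
    using AN.finetely_gen[OF primeideal.axioms(1)[OF ker_prime]] by blast
  have Fk: "F \<subseteq> ker" using A.genideal_self[OF F(1)] F(3) by simp
  have "\<exists>s\<in>carrier A - p x. \<forall>a\<in>F. s \<otimes>\<^bsub>A\<^esub> a = \<zero>\<^bsub>A\<^esub>"
    using F(2) Fk
  proof (induction F rule: finite_induct)
    case empty
    then show ?case using one_notin[OF x] by auto
  next
    case (insert a F)
    then obtain s where s: "s \<in> carrier A" "s \<notin> p x" "\<forall>a\<in>F. s \<otimes>\<^bsub>A\<^esub> a = \<zero>\<^bsub>A\<^esub>" by auto
    have a: "a \<in> carrier A" "\<psi> x a = \<zero>\<^bsub>stk x\<^esub>" using insert.prems by (auto simp: ker_def)
    then obtain t where t: "t \<in> carrier A" "t \<notin> p x" "t \<otimes>\<^bsub>A\<^esub> a = \<zero>\<^bsub>A\<^esub>" using psi_zero_annihilated by blast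
    have FA: "b \<in> carrier A" if "b \<in> F" for b using insert.prems that by (auto simp: ker_def)
    have "(t \<otimes>\<^bsub>A\<^esub> s) \<otimes>\<^bsub>A\<^esub> b = \<zero>\<^bsub>A\<^esub>" if "b \<in> F" for b
      using s(3) that s(1) t(1) FA[OF that] by (simp add: A.m_assoc)
    moreover have "(t \<otimes>\<^bsub>A\<^esub> s) \<otimes>\<^bsub>A\<^esub> a = s \<otimes>\<^bsub>A\<^esub> (t \<otimes>\<^bsub>A\<^esub> a)" using s(1) t(1) a(1) by (simp add: A.m_ac)
    moreover have "t \<otimes>\<^bsub>A\<^esub> s \<notin> p x" using prime_mult[OF x t(1) s(1)] s(2) t(2) by blast
    ultimately show ?case using s(1) t by (intro bexI[of _ "t \<otimes>\<^bsub>A\<^esub> s"]) auto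
  qed
  then obtain s where s: "s \<in> carrier A" "s \<notin> p x" "\<And>a. a \<in> F \<Longrightarrow> s \<otimes>\<^bsub>A\<^esub> a = \<zero>\<^bsub>A\<^esub>" by blast
  \<comment> \<open>The annihilator of \<open>s\<close>, written as a colon ideal of zero. It
    contains the generators of the kernel, hence all of it.\<close>
  have "ideal {c \<in> carrier A. \<zero>\<^bsub>A\<^esub> divides\<^bsub>A\<^esub> c \<otimes>\<^bsub>A\<^esub> s} A" by (rule A.ideal_colon[OF A.zero_closed s(1)])
  moreover have "F \<subseteq> {c \<in> carrier A. \<zero>\<^bsub>A\<^esub> divides\<^bsub>A\<^esub> c \<otimes>\<^bsub>A\<^esub> s}"
  proof
    fix a assume a: "a \<in> F"
    then have "a \<in> carrier A" using F(1) by blast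
    then show "a \<in> {c \<in> carrier A. \<zero>\<^bsub>A\<^esub> divides\<^bsub>A\<^esub> c \<otimes>\<^bsub>A\<^esub> s}"
      using s(3)[OF a] A.m_comm[of a s] s(1) by (simp add: A.zero_divides)
  qed
  ultimately have "ker \<subseteq> {c \<in> carrier A. \<zero>\<^bsub>A\<^esub> divides\<^bsub>A\<^esub> c \<otimes>\<^bsub>A\<^esub> s}"
    unfolding F(3) by (rule A.genideal_minimal)
  then have kill: "a \<otimes>\<^bsub>A\<^esub> s = \<zero>\<^bsub>A\<^esub>" "a \<in> carrier A" if "a \<in> ker" for a using that by (auto simp: A.zero_divides)
  obtain g where g: "g \<in> U" "p g = ker" using p_surj[OF ker_prime] by blast
  let ?V = "{y \<in> U. s \<notin> p y}"
  have "g \<in> ?V" using g s(2) ker_sub by blast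
  moreover have "generalizes g y" if "y \<in> ?V" for y
  proof -
    have "a \<in> p y" if "a \<in> ker" for a
      using prime_mult[of y a s] kill[OF that] zero_in \<open>y \<in> ?V\<close> s(1) by auto
    then show ?thesis using generalizes_iff[of y g] g that by blast
  qed
  ultimately show ?thesis using that[of ?V g] basic_open[OF s(1)] x s(2) g(2) by blast
qed

text \<open>An element of \<open>J\<close> is a fraction \<open>a/s\<close> with \<open>a\<close> in
  the preimage of \<open>J\<close>, so generators of the preimage generate \<open>J\<close>.\<close>

lemma stalk_noetherian: "noetherian_ring (stk x)"
proof (rule S.noetherian_ringI)
  fix J assume J: "ideal J (stk x)"
  interpret J: ideal J "stk x" by (rule J)
  let ?I = "{a \<in> carrier A. \<psi> x a \<in> J}"
  obtain F where F: "F \<subseteq> carrier A" "finite F" "?I = Idl\<^bsub>A\<^esub> F"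
    using AN.finetely_gen[OF preimage_ideal[OF J]] by blast
  let ?G = "\<psi> x ` F"
  have G: "?G \<subseteq> carrier (stk x)" using F by auto
  have "Idl\<^bsub>stk x\<^esub> ?G = J"
  proof
    have "F \<subseteq> ?I" using A.genideal_self[OF F(1)] F(3) by simp
    then show "Idl\<^bsub>stk x\<^esub> ?G \<subseteq> J" by (intro S.genideal_minimal[OF J]) auto
    have iG: "ideal (Idl\<^bsub>stk x\<^esub> ?G) (stk x)" by (rule S.genideal_ideal[OF G])
    have "F \<subseteq> {a \<in> carrier A. \<psi> x a \<in> Idl\<^bsub>stk x\<^esub> ?G}" using F(1) S.genideal_self[OF G] by blast
    then have sub: "?I \<subseteq> {a \<in> carrier A. \<psi> x a \<in> Idl\<^bsub>stk x\<^esub> ?G}"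
      unfolding F(3) by (rule A.genideal_minimal[OF preimage_ideal[OF iG]])
    show "J \<subseteq> Idl\<^bsub>stk x\<^esub> ?G"
    proof
      fix P assume P: "P \<in> J"
      then have PO: "P \<in> carrier (stk x)" by simp
      obtain a s where as: "a \<in> carrier A" "s \<in> carrier A" "s \<notin> p x" "P \<otimes>\<^bsub>stk x\<^esub> \<psi> x s = \<psi> x a" using fraction[OF PO] .
      have "\<psi> x a \<in> J" using J.I_r_closed[OF P psi_closed[OF as(2)]] as(4) by simp
      then have aG: "\<psi> x a \<in> Idl\<^bsub>stk x\<^esub> ?G" using sub as(1) by blast
      have u: "\<psi> x s \<in> Units (stk x)" using psi_Units as by blast
      have "\<psi> x a \<otimes>\<^bsub>stk x\<^esub> inv\<^bsub>stk x\<^esub> \<psi> x s \<in> Idl\<^bsub>stk x\<^esub> ?G" using ideal.I_r_closed[OF iG aG] u by simp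
      moreover have "\<psi> x a \<otimes>\<^bsub>stk x\<^esub> inv\<^bsub>stk x\<^esub> \<psi> x s = P"
        unfolding as(4)[symmetric] using PO u psi_closed[OF as(2)] by (simp add: S.m_assoc)
      ultimately show "P \<in> Idl\<^bsub>stk x\<^esub> ?G" by simp
    qed
  qed
  then show "\<exists>G\<subseteq>carrier (stk x). finite G \<and> J = Idl\<^bsub>stk x\<^esub> G" using G F(2) by blast
qed

text \<open>Lower end of the correspondence with the primes of \<open>A\<close> inside
  \<open>p x\<close>: the numerator of an element of \<open>J\<close> lies in the kernel, so the
  element is zero.\<close>

lemma prime_contained_zero:
  assumes J: "primeideal J (stk x)" and z: "{a \<in> carrier A. \<psi> x a \<in> J} \<subseteq> ker" shows "J = {\<zero>\<^bsub>stk x\<^esub>}"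
proof -
  interpret J: primeideal J "stk x" by (rule J)
  have "P = \<zero>\<^bsub>stk x\<^esub>" if P: "P \<in> J" for P
  proof -
    have PO: "P \<in> carrier (stk x)" using P by simp
    obtain a s where as: "a \<in> carrier A" "s \<in> carrier A" "s \<notin> p x" "P \<otimes>\<^bsub>stk x\<^esub> \<psi> x s = \<psi> x a" using fraction[OF PO] .
    have "\<psi> x a \<in> J" using J.I_r_closed[OF P psi_closed[OF as(2)]] as(4) by simp
    then have "\<psi> x a = \<zero>\<^bsub>stk x\<^esub>" using z as(1) by (auto simp: ker_def)
    then show ?thesis
      using S.integral[of P "\<psi> x s"] as PO psi_Units_nonzero[OF as(2,3)] by auto
  qed
  then show ?thesis using J.zero_closed by blast
qed

text \<open>Upper end of the same correspondence: an element outside \<open>J\<close> has a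
  numerator outside \<open>p x\<close> and is a unit, so no proper ideal is larger than
  \<open>J\<close>.\<close>

lemma prime_contains_maximal:
  assumes J: "primeideal J (stk x)" and z: "p x \<subseteq> {a \<in> carrier A. \<psi> x a \<in> J}" shows "maximalideal J (stk x)"
proof -
  interpret J: primeideal J "stk x" by (rule J)
  have units: "P \<in> Units (stk x)" if PO: "P \<in> carrier (stk x)" "P \<notin> J" for P
  proof -
    obtain a s where as: "a \<in> carrier A" "s \<in> carrier A" "s \<notin> p x" "P \<otimes>\<^bsub>stk x\<^esub> \<psi> x s = \<psi> x a" using fraction[OF PO(1)] .
    have u: "\<psi> x s \<in> Units (stk x)" using psi_Units as by blast
    have P: "P = \<psi> x a \<otimes>\<^bsub>stk x\<^esub> inv\<^bsub>stk x\<^esub> \<psi> x s"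
      unfolding as(4)[symmetric] using PO u psi_closed[OF as(2)] by (simp add: S.m_assoc)
    have "a \<notin> p x"
    proof
      assume "a \<in> p x"
      then have "\<psi> x a \<in> J" using z by blast
      then have "P \<in> J" using J.I_r_closed[of "\<psi> x a" "inv\<^bsub>stk x\<^esub> \<psi> x s"] u P by simp
      then show False using PO by blast
    qed
    then have "\<psi> x a \<in> Units (stk x)" using psi_Units as by blast
    then show ?thesis using P u by simp
  qed
  show ?thesis
  proof (rule maximalidealI[OF J.ideal_axioms J.I_notcarr])
    fix I assume I: "ideal I (stk x)" "J \<subseteq> I"
    show "I = J \<or> I = carrier (stk x)"
    proof (rule disjCI)
      assume "I \<noteq> carrier (stk x)"
      then have n1: "\<one>\<^bsub>stk x\<^esub> \<notin> I" using ideal.one_imp_carrier[OF I(1)] by blast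
      have "P \<in> J" if P: "P \<in> I" for P
      proof (rule ccontr)
        assume "P \<notin> J"
        moreover have "P \<in> carrier (stk x)" using ideal.Icarr[OF I(1) P] .
        ultimately have "P \<in> Units (stk x)" using units by blast
        then have "inv\<^bsub>stk x\<^esub> P \<otimes>\<^bsub>stk x\<^esub> P \<in> I" using ideal.I_l_closed[OF I(1) P] by blast
        then show False using n1 \<open>P \<in> Units (stk x)\<close> by simp
      qed
      then show "I = J" using I(2) by blast
    qed
  qed
qed

end

lemma field_at_generic:
  assumes g: "g \<in> U" and z: "p g \<subseteq> ker g" shows "field (stk g)"
proof -
  interpret S: domain "stk g" by (rule stalk_domain[OF g])
  show ?thesis
  proof (rule S.cring_fieldI)
    have "P \<in> Units (stk g)" if P: "P \<in> carrier (stk g)" "P \<noteq> \<zero>\<^bsub>stk g\<^esub>" for P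
    proof -
      obtain a s where as: "a \<in> carrier A" "s \<in> carrier A" "s \<notin> p g" "P \<otimes>\<^bsub>stk g\<^esub> \<psi> g s = \<psi> g a"
        using fraction[OF g P(1)] .
      have "\<psi> g a \<noteq> \<zero>\<^bsub>stk g\<^esub>"
        using S.integral[of P "\<psi> g s"] P psi_closed[OF g as(2)] psi_Units_nonzero[OF g as(2,3)] as(4) by auto
      then have "a \<notin> p g" using z ker_def[OF g] by blast
      then have u: "\<psi> g a \<in> Units (stk g)" using psi_Units[OF g as(1)] by blast
      have us: "\<psi> g s \<in> Units (stk g)" using psi_Units[OF g as(2,3)] .
      have "P = \<psi> g a \<otimes>\<^bsub>stk g\<^esub> inv\<^bsub>stk g\<^esub> \<psi> g s"
        unfolding as(4)[symmetric] using P us psi_closed[OF g as(2)] by (simp add: S.m_assoc)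
      then show ?thesis using u us by simp
    qed
    moreover have "\<zero>\<^bsub>stk g\<^esub> \<notin> Units (stk g)" using S.Units_r_inv_ex S.zero_not_one by force
    ultimately show "Units (stk g) = carrier (stk g) - {\<zero>\<^bsub>stk g\<^esub>}" using S.Units_closed by blast
  qed
qed

end

section \<open>Prime divisors\<close>

context sheaf_of_rings
begin

lemma in_closure_iff: "x \<in> topspace T \<Longrightarrow> x \<in> T closure_of {y} \<longleftrightarrow> generalizes y x"
  unfolding in_closure_of generalizes_def by blast

lemma closure_irreducible:
  assumes "y \<in> topspace T" shows "closedin T (T closure_of {y})" "irreducible_subset T (T closure_of {y})"
proof -
  show "closedin T (T closure_of {y})" by simp
  have y: "y \<in> T closure_of {y}" using in_closure_iff[OF assms] by (simp add: generalizes_def)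
  have min: "T closure_of {y} \<subseteq> F" if "closedin T F" "y \<in> F" for F
    using closure_of_minimal[of "{y}" F T] that by blast
  show "irreducible_subset T (T closure_of {y})"
    unfolding irreducible_subset_def
  proof (intro conjI allI impI)
    show "T closure_of {y} \<subseteq> topspace T" by (rule closure_of_subset_topspace)
    show "T closure_of {y} \<noteq> {}" using y by blast
    fix F G assume FG: "closedin T F \<and> closedin T G \<and> T closure_of {y} \<subseteq> F \<union> G"
    then have "y \<in> F \<or> y \<in> G" using y by blast
    then show "T closure_of {y} \<subseteq> F \<or> T closure_of {y} \<subseteq> G" using min FG by blast
  qed
qed

end

lemma codim_ge:
  assumes "\<forall>i\<le>n. closedin T (c i) \<and> irreducible_subset T (c i)" "\<forall>i<n. c i \<subset> c (Suc i)" "c 0 = Z"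
  shows "enat n \<le> codim T Z"
  unfolding codim_def by (rule Sup_upper) (use assms in blast)

lemma codim_one_proper:
  assumes "codim T Z = 1" shows "Z \<noteq> topspace T"
proof
  assume Z: "Z = topspace T"
  have "codim T Z \<le> 0"
    unfolding codim_def
  proof (rule Sup_least)
    fix e assume "e \<in> {enat n |n. \<exists>c. c 0 = Z \<and> (\<forall>i\<le>n. closedin T (c i) \<and> irreducible_subset T (c i)) \<and>
                         (\<forall>i<n. c i \<subset> c (Suc i))}"
    then obtain n c where e: "e = enat n" and c: "\<forall>i\<le>n. closedin T (c i) \<and> irreducible_subset T (c i)" "\<forall>i<n. c i \<subset> c (Suc i)" "c 0 = Z" by blast
    have "n = 0"
    proof (rule ccontr)
      assume "n \<noteq> 0"
      then have "Z \<subset> c 1" "c 1 \<subseteq> topspace T" using c closedin_subset[of T "c 1"] by auto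
      then show False using Z by blast
    qed
    then show "e \<le> 0" by (simp add: e zero_enat_def)
  qed
  then show False using assms by simp
qed

text \<open>A third set strictly between \<open>Z\<close> and \<open>X\<close> would complete a
  chain of length two above \<open>Z\<close>.\<close>

lemma codim_one_between:
  assumes "codim T Z = 1" "closedin T Z" "irreducible_subset T Z" "closedin T Y" "irreducible_subset T Y"
    "closedin T X" "irreducible_subset T X" "Z \<subseteq> Y" "Y \<subseteq> X"
  shows "Y = Z \<or> Y = X"
proof (rule ccontr)
  assume n: "\<not> ?thesis"
  define c where "c i = (if i = 0 then Z else if i = 1 then Y else X)" for i :: nat
  have i3: "i = 0 \<or> i = 1 \<or> i = 2" if "i \<le> 2" for i :: nat using that by auto
  have "enat 2 \<le> codim T Z"
  proof (rule codim_ge)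
    show "\<forall>i\<le>2. closedin T (c i) \<and> irreducible_subset T (c i)" using i3 assms by (auto simp: c_def)
    have "i = 0 \<or> i = 1" if "i < 2" for i :: nat using that by auto
    then show "\<forall>i<2. c i \<subset> c (Suc i)" using assms n by (auto simp: c_def)
  qed (simp add: c_def)
  then show False using assms(1) by (simp add: one_enat_def)
qed

section \<open>Generic points, the function field and orders along prime divisors\<close>

context Connected_Normal_Noetherian_Scheme
begin

lemma normal_chart_at:
  assumes "x \<in> topspace T" obtains U A p \<psi> where "x \<in> U" "normal_chart \<XX> U A p \<psi>"
proof -
  obtain U A where UA: "x \<in> U" "affine_open \<XX> U A" "noetherian_ring A" using locally_noetherian assms by blast
  obtain p \<psi> where c: "chart U A p \<psi>" using affine_open_chart UA by blast
  have "U \<subseteq> topspace T" using UA(2) openin_subset by (auto simp: affine_open_def)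
  then have "domain (stalk \<XX> y)" if "y \<in> U" for y
    using stalk_normal[of y] that by (auto simp: integrally_closed_domain_def)
  then have "normal_chart \<XX> U A p \<psi>"
    unfolding normal_chart_def normal_chart_axioms_def using sheaf_of_rings_axioms c UA(3) by blast
  then show ?thesis using that UA by blast
qed

lemma T0:
  assumes x: "x \<in> topspace T" and "generalizes x y" "generalizes y x" shows "x = y"
proof -
  obtain U A p \<psi> where XU: "x \<in> U" "normal_chart \<XX> U A p \<psi>" by (rule normal_chart_at[OF x])
  interpret normal_chart \<XX> U A p \<psi> by (rule XU(2))
  have y: "y \<in> U" using generalization_in[OF XU(1) assms(3)] .
  have "p x = p y" using generalizes_iff[OF y XU(1)] generalizes_iff[OF XU(1) y] assms by blast
  then show ?thesis using p_inj XU(1) y by blast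
qed

lemma generalizes_top: "\<lbrakk>generalizes y x; x \<in> topspace T\<rbrakk> \<Longrightarrow> y \<in> topspace T"
  unfolding generalizes_def by blast

lemma closure_inj:
  assumes "x \<in> topspace T" "y \<in> topspace T" "T closure_of {x} = T closure_of {y}" shows "x = y"
proof (rule T0[OF assms(1)])
  have "x \<in> T closure_of {x}" "y \<in> T closure_of {y}"
    using in_closure_iff assms(1,2) by (simp_all add: generalizes_def)
  then show "generalizes x y" "generalizes y x" using assms in_closure_iff by auto
qed

lemma generic_point_eq:
  assumes "x \<in> topspace T" "T closure_of {x} = Z" shows "generic_point T Z = x"
  unfolding generic_point_def by (rule the_equality) (use assms closure_inj in auto)

text \<open>Every point has a neighbourhood with a generic point of its own. Where two such
  neighbourhoods meet, their generic points coincide, so the assignment is locally constant, and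
  connectedness makes it constant.\<close>

lemma ex_generic: "\<exists>\<eta>\<in>topspace T. \<forall>x\<in>topspace T. generalizes \<eta> x"
proof -
  have "\<exists>V g. openin T V \<and> x \<in> V \<and> g \<in> V \<and> (\<forall>y\<in>V. generalizes g y)" if x: "x \<in> topspace T" for x
  proof -
    obtain U A p \<psi> where XU: "x \<in> U" "normal_chart \<XX> U A p \<psi>" by (rule normal_chart_at[OF x])
    interpret normal_chart \<XX> U A p \<psi> by (rule XU(2))
    show ?thesis by (rule generic_nbhd[OF XU(1)]) blast
  qed
  then obtain V g where V: "\<And>x. x \<in> topspace T \<Longrightarrow> openin T (V x)" "\<And>x. x \<in> topspace T \<Longrightarrow> x \<in> V x"
    "\<And>x. x \<in> topspace T \<Longrightarrow> g x \<in> V x" "\<And>x y. x \<in> topspace T \<Longrightarrow> y \<in> V x \<Longrightarrow> generalizes (g x) y"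
    by metis
  have top: "V x \<subseteq> topspace T" if "x \<in> topspace T" for x using openin_subset[OF V(1)[OF that]] .
  \<comment> \<open>Both generic points generalize the common point \<open>z\<close>, so each lies
    in the other's neighbourhood; they generalize each other and are equal by
    \<open>T0\<close>.\<close>
  have meet: "g x = g y" if x: "x \<in> topspace T" and y: "y \<in> topspace T" and z: "z \<in> V x" "z \<in> V y" for x y z
  proof (rule T0)
    have "generalizes (g x) z" "generalizes (g y) z" using V(4)[OF x z(1)] V(4)[OF y z(2)] .
    then have "g x \<in> V y" "g y \<in> V x" using V(1) x y z unfolding generalizes_def by blast+
    then show "generalizes (g x) (g y)" "generalizes (g y) (g x)" using V(4) x y by blast+
    show "g x \<in> topspace T" using V(3) top x by blast
  qed
  obtain x0 where x0: "x0 \<in> topspace T" using connected(2) by blast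
  let ?S = "{x \<in> topspace T. g x = g x0}" and ?S' = "{x \<in> topspace T. g x \<noteq> g x0}"
  have "?S = \<Union>(V ` ?S)"
  proof
    show "?S \<subseteq> \<Union>(V ` ?S)" using V(2) by blast
    show "\<Union>(V ` ?S) \<subseteq> ?S"
    proof
      fix y assume "y \<in> \<Union>(V ` ?S)"
      then obtain x where x: "x \<in> topspace T" "g x = g x0" "y \<in> V x" by blast
      then have y: "y \<in> topspace T" using top by blast
      then have "g y = g x" using meet[OF y x(1) V(2)[OF y] x(3)] by simp
      then show "y \<in> ?S" using x y by simp
    qed
  qed
  moreover have "?S' = \<Union>(V ` ?S')"
  proof
    show "?S' \<subseteq> \<Union>(V ` ?S')" using V(2) by blast
    show "\<Union>(V ` ?S') \<subseteq> ?S'"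
    proof
      fix y assume "y \<in> \<Union>(V ` ?S')"
      then obtain x where x: "x \<in> topspace T" "g x \<noteq> g x0" "y \<in> V x" by blast
      then have y: "y \<in> topspace T" using top by blast
      then have "g y = g x" using meet[OF y x(1) V(2)[OF y] x(3)] by simp
      then show "y \<in> ?S'" using x y by simp
    qed
  qed
  moreover have "openin T (\<Union>(V ` ?S))" "openin T (\<Union>(V ` ?S'))" using V(1) by (auto intro!: openin_Union)
  ultimately have op: "openin T ?S" "openin T ?S'" by simp_all
  have "?S' = {}"
  proof (rule ccontr)
    assume "?S' \<noteq> {}"
    moreover have "?S \<noteq> {}" "topspace T \<subseteq> ?S \<union> ?S'" "?S \<inter> ?S' = {}" using x0 by auto
    ultimately show False using connected(1) op unfolding connected_space_def by blast
  qed
  then have all: "g x = g x0" if "x \<in> topspace T" for x using that by blast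
  show ?thesis
  proof
    show "g x0 \<in> topspace T" using V(3) top x0 by blast
    show "\<forall>x\<in>topspace T. generalizes (g x0) x" using V(4,2) all by metis
  qed
qed

definition \<eta> :: 'a where "\<eta> = generic_point T (topspace T)"

lemma eta_top: "\<eta> \<in> topspace T" and eta_generalizes: "x \<in> topspace T \<Longrightarrow> generalizes \<eta> x"
  and eta_closure: "T closure_of {\<eta>} = topspace T"
proof -
  obtain h where h: "h \<in> topspace T" "\<forall>x\<in>topspace T. generalizes h x" using ex_generic by blast
  have cl: "T closure_of {h} = topspace T"
  proof
    show "T closure_of {h} \<subseteq> topspace T" by (rule closure_of_subset_topspace)
    show "topspace T \<subseteq> T closure_of {h}"
    proof
      fix x assume x: "x \<in> topspace T"
      then show "x \<in> T closure_of {h}" using in_closure_iff[OF x, of h] h(2) by simp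
    qed
  qed
  have "\<eta> = h" unfolding \<eta>_def by (rule generic_point_eq[OF h(1) cl])
  then show "\<eta> \<in> topspace T" "x \<in> topspace T \<Longrightarrow> generalizes \<eta> x" "T closure_of {\<eta>} = topspace T"
    using h cl by simp_all
qed

abbreviation "KK \<equiv> stalk \<XX> \<eta>"

lemma function_field_eq: "function_field \<XX> = KK"
  by (simp add: function_field_def \<eta>_def)

context
  fixes U A p \<psi> assumes ch: "normal_chart \<XX> U A p \<psi>"
begin

interpretation normal_chart \<XX> U A p \<psi> by (rule ch)

lemma U_top: "U \<subseteq> topspace T" using openin_subset[OF U] .

lemma eta_in: "x \<in> U \<Longrightarrow> \<eta> \<in> U"
  using generalization_in eta_generalizes U_top by blast

lemma p_eta: "x \<in> U \<Longrightarrow> p \<eta> \<subseteq> p x"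
  using generalizes_iff[of x \<eta>] eta_in eta_generalizes U_top by blast

text \<open>Elements of the kernel at \<open>x\<close> are annihilated by some \<open>s\<close>
  outside \<open>p x\<close>, hence outside \<open>p \<eta>\<close>, so they lie in
  \<open>p \<eta>\<close>. The reverse inclusion uses that the kernel is the prime of some point of
  the chart, which \<open>\<eta>\<close> generalizes.\<close>

lemma ker_eq: assumes x: "x \<in> U" shows "ker x = p \<eta>"
proof
  obtain V g where g: "V \<subseteq> U" "g \<in> V" "p g = ker x" "\<And>y. y \<in> V \<Longrightarrow> generalizes g y" by (rule generic_nbhd[OF x]) blast
  have gU: "g \<in> U" using g by blast
  show "p \<eta> \<subseteq> ker x" using p_eta[OF gU] g(3) by simp
  show "ker x \<subseteq> p \<eta>"
  proof
    fix a assume "a \<in> ker x"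
    then have a: "a \<in> carrier A" "\<psi> x a = \<zero>\<^bsub>stk x\<^esub>" by (auto simp: ker_def[OF x])
    then obtain s where s: "s \<in> carrier A" "s \<notin> p x" "s \<otimes>\<^bsub>A\<^esub> a = \<zero>\<^bsub>A\<^esub>" using psi_zero_annihilated[OF x] by blast
    then have "s \<otimes>\<^bsub>A\<^esub> a \<in> p \<eta>" using zero_in[OF eta_in[OF x]] by simp
    then show "a \<in> p \<eta>" using prime_mult[OF eta_in[OF x] s(1) a(1)] s(2) p_eta[OF x] by blast
  qed
qed

lemma psi_zero_iff: assumes "x \<in> U" "a \<in> carrier A" shows "\<psi> x a = \<zero>\<^bsub>stk x\<^esub> \<longleftrightarrow> a \<in> p \<eta>"
  using ker_eq[OF assms(1)] ker_def[OF assms(1)] assms(2) by blast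

lemma field_KK_chart: "x \<in> U \<Longrightarrow> field KK"
  using field_at_generic[OF eta_in] ker_eq[OF eta_in] eta_in by simp

lemma cosp_inj:
  assumes x: "x \<in> U" and P: "P \<in> carrier (stk x)" "cospecialize \<XX> \<eta> P = \<zero>\<^bsub>KK\<^esub>" shows "P = \<zero>\<^bsub>stk x\<^esub>"
proof -
  interpret S: domain "stk x" by (rule stalk_domain[OF x])
  interpret K: domain KK by (rule stalk_domain[OF eta_in[OF x]])
  have gx: "generalizes \<eta> x" and xt: "x \<in> topspace T" using eta_generalizes x U_top by auto
  obtain a s where as: "a \<in> carrier A" "s \<in> carrier A" "s \<notin> p x" "P \<otimes>\<^bsub>stk x\<^esub> \<psi> x s = \<psi> x a" using fraction[OF x P(1)] .
  have "\<psi> \<eta> a = cospecialize \<XX> \<eta> (P \<otimes>\<^bsub>stk x\<^esub> \<psi> x s)"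
    unfolding as(4) by (rule cospecialize_psi[OF x eta_in[OF x] gx as(1), symmetric])
  also have "\<dots> = cospecialize \<XX> \<eta> P \<otimes>\<^bsub>KK\<^esub> cospecialize \<XX> \<eta> (\<psi> x s)"
    by (rule ring_hom_mult[OF cospecialize_hom[OF gx xt] P(1) psi_closed[OF x as(2)]])
  also have "\<dots> = \<zero>\<^bsub>KK\<^esub>"
    unfolding P(2) cospecialize_psi[OF x eta_in[OF x] gx as(2)] by (rule K.l_null[OF psi_closed[OF eta_in[OF x] as(2)]])
  finally have "\<psi> x a = \<zero>\<^bsub>stk x\<^esub>" using psi_zero_iff eta_in x as(1) by simp
  then show ?thesis
    using S.integral[OF _ P(1) psi_closed[OF x as(2)]] as(4) psi_Units_nonzero[OF x as(2,3)] by simp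
qed

lemma cosp_fraction:
  assumes x: "x \<in> U" and k: "k \<in> carrier KK"
  obtains a s where "a \<in> carrier A" "s \<in> carrier A" "s \<notin> p \<eta>"
    "k \<otimes>\<^bsub>KK\<^esub> cospecialize \<XX> \<eta> (\<psi> x s) = cospecialize \<XX> \<eta> (\<psi> x a)"
proof -
  have gx: "generalizes \<eta> x" using eta_generalizes x U_top by auto
  obtain a s where as: "a \<in> carrier A" "s \<in> carrier A" "s \<notin> p \<eta>" "k \<otimes>\<^bsub>KK\<^esub> \<psi> \<eta> s = \<psi> \<eta> a" using fraction[OF eta_in[OF x] k] .
  then show ?thesis using that cospecialize_psi[OF x eta_in[OF x] gx] by metis
qed

text \<open>The intersection \<open>q\<close> of the primes of all points of \<open>Z\<close> in the
  chart is prime because \<open>Z\<close> is irreducible. Its point lies in \<open>Z\<close> because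
  \<open>Z\<close> is closed, and is dense in \<open>Z\<close> because \<open>Z \<inter> U\<close>
  is.\<close>

lemma generic_in_chart:
  assumes Z: "closedin T Z" "irreducible_subset T Z" and z: "z \<in> Z" "z \<in> U"
  shows "\<exists>\<zeta>\<in>U. T closure_of {\<zeta>} = Z"
proof -
  let ?C = "Z \<inter> U"
  define q where "q = \<Inter>(p ` ?C)"
  have q_sub: "q \<subseteq> p y" if "y \<in> ?C" for y using that by (auto simp: q_def)
  have qA: "q \<subseteq> carrier A" using q_sub[of z] p_carrier[of z] z by blast
  have irr: "Z \<subseteq> F \<or> Z \<subseteq> G" if "closedin T F" "closedin T G" "Z \<subseteq> F \<union> G" for F G
    using Z(2) that unfolding irreducible_subset_def by blast
  have "primeideal q A"
  proof (rule primeidealI)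
    show "ideal q A" unfolding q_def
      by (rule A.i_Intersect) (use p_prime z in \<open>auto simp: primeideal_def\<close>)
    show "cring A" by (rule A.cring_axioms)
    show "carrier A \<noteq> q" using one_notin[OF z(2)] q_sub[of z] z by blast
    fix a b assume ab: "a \<in> carrier A" "b \<in> carrier A" "a \<otimes>\<^bsub>A\<^esub> b \<in> q"
    \<comment> \<open>The complement is taken in the whole space, not in \<open>U\<close>, so that
      it is closed there and irreducibility of \<open>Z\<close> applies.\<close>
    let ?F = "\<lambda>a. topspace T - {x \<in> U. a \<notin> p x}"
    have "Z \<subseteq> ?F a \<union> ?F b"
    proof
      fix y assume y: "y \<in> Z"
      have "y \<in> topspace T" using closedin_subset[OF Z(1)] y by blast
      moreover have "a \<in> p y \<or> b \<in> p y" if "y \<in> U"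
        using prime_mult[OF that ab(1,2)] q_sub[of y] ab(3) y that by blast
      ultimately show "y \<in> ?F a \<union> ?F b" by blast
    qed
    then have "Z \<subseteq> ?F a \<or> Z \<subseteq> ?F b"
      by (intro irr) (use basic_open ab in \<open>auto intro!: closedin_diff\<close>)
    then show "a \<in> q \<or> b \<in> q" unfolding q_def by blast
  qed
  then obtain \<zeta> where \<zeta>: "\<zeta> \<in> U" "p \<zeta> = q" using p_surj by blast
  have gen: "generalizes \<zeta> y" if "y \<in> ?C" for y using generalizes_iff[of y \<zeta>] \<zeta> q_sub that by auto
  have \<zeta>Z: "\<zeta> \<in> Z"
  proof (rule ccontr)
    assume n: "\<zeta> \<notin> Z"
    have "openin T (U - Z)" using openin_diff[OF U Z(1)] .
    then obtain s where s: "s \<in> carrier A" "s \<notin> p \<zeta>" "\<And>y. \<lbrakk>y \<in> U; s \<notin> p y\<rbrakk> \<Longrightarrow> y \<in> U - Z"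
      using basic_nbhd[of "U - Z" \<zeta>] n \<zeta> by blast
    then obtain y where "y \<in> ?C" "s \<notin> p y" unfolding \<zeta>(2) q_def by blast
    then show False using s(3) by blast
  qed
  have "T closure_of {\<zeta>} \<subseteq> Z" using closure_of_minimal[of "{\<zeta>}" Z T] \<zeta>Z Z(1) by blast
  moreover have "Z \<subseteq> T closure_of {\<zeta>}"
  proof
    fix y assume y: "y \<in> Z"
    then have yt: "y \<in> topspace T" using closedin_subset[OF Z(1)] by blast
    have "generalizes \<zeta> y" unfolding generalizes_def
    proof (intro allI impI, elim conjE)
      fix N assume N: "openin T N" "y \<in> N"
      \<comment> \<open>Two open sets that meet an irreducible set also meet each other inside
        it.\<close>
      have "\<exists>w. w \<in> ?C \<and> w \<in> N"
      proof (rule ccontr)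
        assume no: "\<not> ?thesis"
        have "Z \<subseteq> topspace T - N \<or> Z \<subseteq> topspace T - U"
        proof (rule irr)
          show "Z \<subseteq> (topspace T - N) \<union> (topspace T - U)" using no closedin_subset[OF Z(1)] by blast
        qed (use N U in auto)
        then show False using y N z by blast
      qed
      then obtain w where "w \<in> ?C" "w \<in> N" by blast
      then show "\<zeta> \<in> N" using gen N unfolding generalizes_def by blast
    qed
    then show "y \<in> T closure_of {\<zeta>}" using in_closure_iff[OF yt] by blast
  qed
  ultimately show ?thesis using \<zeta> by blast
qed

end

lemma field_KK: "field KK"
proof -
  obtain U A p \<psi> where U: "\<eta> \<in> U" "normal_chart \<XX> U A p \<psi>" by (rule normal_chart_at[OF eta_top])
  show ?thesis using field_KK_chart[OF U(2,1)] .
qed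

lemma top_irreducible: "irreducible_subset T (topspace T)"
  using closure_irreducible(2)[OF eta_top] by (simp add: eta_closure)

definition gen :: "'a set \<Rightarrow> 'a" where "gen Z = generic_point T Z"

lemma gen:
  assumes "prime_divisor \<XX> Z" shows "gen Z \<in> topspace T" "T closure_of {gen Z} = Z"
proof -
  have Z: "closedin T Z" "irreducible_subset T Z" using assms by (auto simp: prime_divisor_def)
  then obtain z where z: "z \<in> Z" "z \<in> topspace T" by (auto simp: irreducible_subset_def)
  obtain U A p \<psi> where U: "z \<in> U" "normal_chart \<XX> U A p \<psi>" by (rule normal_chart_at[OF z(2)])
  obtain \<zeta> where \<zeta>: "\<zeta> \<in> U" "T closure_of {\<zeta>} = Z" using generic_in_chart[OF U(2) Z z(1) U(1)] by blast
  have "\<zeta> \<in> topspace T" using U_top[OF U(2)] \<zeta> by blast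
  then show "gen Z \<in> topspace T" "T closure_of {gen Z} = Z" using generic_point_eq[OF _ \<zeta>(2)] \<zeta> by (auto simp: gen_def)
qed

lemma gen_in_open:
  assumes "prime_divisor \<XX> Z" "openin T N" "x \<in> Z" "x \<in> N" shows "gen Z \<in> N"
proof -
  have "x \<in> topspace T" using assms(2,4) openin_subset by blast
  then have "generalizes (gen Z) x" using in_closure_iff[of x "gen Z"] gen(2)[OF assms(1)] assms(3) by simp
  then show ?thesis using assms(2,4) unfolding generalizes_def by blast
qed

text \<open>The closure of \<open>y\<close> is an irreducible closed set between \<open>Z\<close>
  and the whole space, and codimension one leaves only the two ends. All dimension theory of the
  stalk rests on this.\<close>

lemma generalization_of_gen:
  assumes Z: "prime_divisor \<XX> Z" and y: "generalizes y (gen Z)" shows "y = gen Z \<or> y = \<eta>"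
proof -
  note g = gen[OF Z]
  have yt: "y \<in> topspace T" using generalizes_top[OF y g(1)] .
  let ?Y = "T closure_of {y}"
  have "gen Z \<in> ?Y" using in_closure_iff[OF g(1)] y by simp
  then have "Z \<subseteq> ?Y"
    using closure_of_minimal[of "{gen Z}" ?Y T] g(2) by simp
  then have "?Y = Z \<or> ?Y = topspace T"
    using codim_one_between[of T Z ?Y "topspace T"] Z closure_irreducible[OF yt] top_irreducible
      closure_of_subset_topspace[of T "{y}"] unfolding prime_divisor_def by simp
  then show ?thesis using closure_inj[OF yt g(1)] closure_inj[OF yt eta_top] g(2) eta_closure by auto
qed

lemma gen_neq_eta: assumes "prime_divisor \<XX> Z" shows "gen Z \<noteq> \<eta>"
  using gen(2)[OF assms] eta_closure codim_one_proper[of T Z] assms unfolding prime_divisor_def by auto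

text \<open>A prime of the stalk pulls back to the prime of a point generalizing
  \<open>gen Z\<close>. The only such points are \<open>gen Z\<close> and \<open>\<eta>\<close>, and
  they account for the maximal and the zero ideal.\<close>

lemma one_dim_stalk:
  assumes Z: "prime_divisor \<XX> Z" shows "one_dimensional_normal (stalk \<XX> (gen Z))"
proof -
  let ?z = "gen Z" let ?B = "stalk \<XX> ?z"
  note g = gen[OF Z]
  obtain U A p \<psi> where XU: "?z \<in> U" "normal_chart \<XX> U A p \<psi>" by (rule normal_chart_at[OF g(1)])
  interpret normal_chart \<XX> U A p \<psi> by (rule XU(2))
  interpret B: domain ?B by (rule stalk_domain[OF XU(1)])
  interpret BN: noetherian_ring ?B by (rule stalk_noetherian[OF XU(1)])
  have eU: "\<eta> \<in> U" using eta_in[OF XU(2,1)] .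
  have loc: "\<exists>!M. maximalideal M ?B" using stalk_local[OF g(1)] by (simp add: local_ring_def)
  have pr: "J = {\<zero>\<^bsub>?B\<^esub>} \<or> J = the_maximal_ideal ?B" if J: "primeideal J ?B" for J
  proof -
    let ?q = "{a \<in> carrier A. \<psi> ?z a \<in> J}"
    have q: "primeideal ?q A" "?q \<subseteq> p ?z" using preimage_prime[OF XU(1) J] .
    then obtain y where y: "y \<in> U" "p y = ?q" using p_surj by blast
    then have "generalizes y ?z" using generalizes_iff[OF XU(1) y(1)] q(2) by simp
    then consider "y = ?z" | "y = \<eta>" using generalization_of_gen[OF Z] by blast
    then show ?thesis
    proof cases
      case 1
      then have "maximalideal J ?B" using prime_contains_maximal[OF XU(1) J] y(2) by simp
      then have "the_maximal_ideal ?B = J" unfolding the_maximal_ideal_def using loc by (intro the1_equality)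
      then show ?thesis by simp
    next
      case 2
      then have "?q \<subseteq> ker ?z" using ker_eq[OF XU(2,1)] y(2) by simp
      then show ?thesis using prime_contained_zero[OF XU(1) J] by blast
    qed
  qed
  \<comment> \<open>If the maximal ideal were zero, every nonzero element would be a unit; an
    element of \<open>p (gen Z)\<close> outside \<open>p \<eta>\<close> gives a nonzero
    nonunit.\<close>
  have nz: "the_maximal_ideal ?B \<noteq> {\<zero>\<^bsub>?B\<^esub>}"
  proof
    assume M0: "the_maximal_ideal ?B = {\<zero>\<^bsub>?B\<^esub>}"
    have "maximalideal (the_maximal_ideal ?B) ?B" unfolding the_maximal_ideal_def by (rule theI'[OF loc])
    then have M: "maximalideal {\<zero>\<^bsub>?B\<^esub>} ?B" using M0 by simp
    have "p \<eta> \<noteq> p ?z" using p_inj[OF eU XU(1)] gen_neq_eta[OF Z] by metis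
    then obtain a where a: "a \<in> p ?z" "a \<notin> p \<eta>" using p_eta[OF XU(2,1)] by blast
    have aA: "a \<in> carrier A" using a p_carrier[OF XU(1)] by blast
    let ?a = "\<psi> ?z a"
    have aB: "?a \<in> carrier ?B" "?a \<noteq> \<zero>\<^bsub>?B\<^esub>" using psi_closed[OF XU(1) aA] psi_zero_iff[OF XU(2,1) aA] a by auto
    have "PIdl\<^bsub>?B\<^esub> ?a = {\<zero>\<^bsub>?B\<^esub>} \<or> PIdl\<^bsub>?B\<^esub> ?a = carrier ?B"
    proof (rule maximalideal.I_maximal[OF M])
      show "ideal (PIdl\<^bsub>?B\<^esub> ?a) ?B" by (rule B.cgenideal_ideal[OF aB(1)])
      show "{\<zero>\<^bsub>?B\<^esub>} \<subseteq> PIdl\<^bsub>?B\<^esub> ?a"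
        using additive_subgroup.zero_closed[OF ideal.axioms(1)[OF B.cgenideal_ideal[OF aB(1)]]] by simp
      show "PIdl\<^bsub>?B\<^esub> ?a \<subseteq> carrier ?B" using ideal.Icarr[OF B.cgenideal_ideal[OF aB(1)]] by blast
    qed
    moreover have "?a \<in> PIdl\<^bsub>?B\<^esub> ?a" by (rule B.cgenideal_self[OF aB(1)])
    ultimately have "PIdl\<^bsub>?B\<^esub> ?a = carrier ?B" using aB(2) by blast
    then have "?a \<in> Units ?B" using B.ideal_eq_carrier_iff[OF aB(1)] by simp
    then show False using psi_nonunit[OF XU(1) a(1)] by blast
  qed
  show ?thesis
    by unfold_locales (use pr nz stalk_normal[OF g(1)] stalk_local[OF g(1)] in auto)
qed

lemma dvr: assumes Z: "prime_divisor \<XX> Z" shows "dvr_valuation (stalk \<XX> (gen Z)) KK (cospecialize \<XX> \<eta>)"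
proof -
  let ?z = "gen Z" let ?B = "stalk \<XX> ?z"
  note g = gen[OF Z]
  obtain U A p \<psi> where XU: "?z \<in> U" "normal_chart \<XX> U A p \<psi>" by (rule normal_chart_at[OF g(1)])
  interpret normal_chart \<XX> U A p \<psi> by (rule XU(2))
  interpret one_dimensional_normal ?B by (rule one_dim_stalk[OF Z])
  interpret K: field KK by (rule field_KK)
  show ?thesis
  proof unfold_locales
    show "cospecialize \<XX> \<eta> \<in> ring_hom ?B KK" by (rule cospecialize_hom[OF eta_generalizes[OF g(1)] g(1)])
    show "a = \<zero>\<^bsub>?B\<^esub>" if "a \<in> carrier ?B" "cospecialize \<XX> \<eta> a = \<zero>\<^bsub>KK\<^esub>" for a
      using cosp_inj[OF XU(2,1) that] .
    fix k assume k: "k \<in> carrier KK"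
    obtain a s where as: "a \<in> carrier A" "s \<in> carrier A" "s \<notin> p \<eta>"
      "k \<otimes>\<^bsub>KK\<^esub> cospecialize \<XX> \<eta> (\<psi> ?z s) = cospecialize \<XX> \<eta> (\<psi> ?z a)" using cosp_fraction[OF XU(2,1) k] .
    then have "\<psi> ?z s \<in> carrier ?B - {\<zero>\<^bsub>?B\<^esub>}" using psi_zero_iff[OF XU(2,1)] psi_closed[OF XU(1)] by simp
    then show "\<exists>a\<in>carrier ?B. \<exists>b\<in>carrier ?B - {\<zero>\<^bsub>?B\<^esub>}. k \<otimes>\<^bsub>KK\<^esub> cospecialize \<XX> \<eta> b = cospecialize \<XX> \<eta> a"
      using as psi_closed[OF XU(1) as(1)] by blast
  qed
qed

lemma ord_along_eq: "prime_divisor \<XX> Z \<Longrightarrow> ord_along \<XX> Z = dvr_valuation.ordv (stalk \<XX> (gen Z)) KK (cospecialize \<XX> \<eta>)"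
  using dvr_valuation.ordv_def[OF dvr]
  by (simp add: ord_along_def Let_def gen_def \<eta>_def function_field_def fun_eq_iff)

lemma ord_valuation: "prime_divisor \<XX> Z \<Longrightarrow> valuation KK (ord_along \<XX> Z)"
  using dvr_valuation.ordv_valuation[OF dvr] ord_along_eq by simp

text \<open>Write \<open>k = a/s\<close> and \<open>c = a s\<close>. Where \<open>c\<close> does not
  vanish, \<open>a\<close> and \<open>s\<close> are units of the stalk and the order is zero. Where
  it vanishes, \<open>gen Z\<close> is one of the finitely many points given by the primes in
  \<open>F\<close>.\<close>

lemma ord_finite_chart:
  assumes ch: "normal_chart \<XX> U A p \<psi>" and k: "k \<in> carrier KK" "k \<noteq> \<zero>\<^bsub>KK\<^esub>"
  shows "finite {Z. prime_divisor \<XX> Z \<and> Z \<inter> U \<noteq> {} \<and> ord_along \<XX> Z k \<noteq> 0}"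
proof (cases "U = {}")
  case True
  then show ?thesis by simp
next
  case False
  then obtain x where x: "x \<in> U" by blast
  interpret normal_chart \<XX> U A p \<psi> by (rule ch)
  interpret K: field KK by (rule field_KK)
  have eU: "\<eta> \<in> U" using eta_in[OF ch x] .
  obtain a s where as: "a \<in> carrier A" "s \<in> carrier A" "s \<notin> p \<eta>" "k \<otimes>\<^bsub>KK\<^esub> \<psi> \<eta> s = \<psi> \<eta> a" using fraction[OF eU k(1)] .
  have "\<psi> \<eta> s \<noteq> \<zero>\<^bsub>KK\<^esub>" using psi_zero_iff[OF ch eU as(2)] as(3) by simp
  then have "\<psi> \<eta> a \<noteq> \<zero>\<^bsub>KK\<^esub>" using K.integral[OF _ k(1) psi_closed[OF eU as(2)]] as(4) k(2) by auto
  then have a: "a \<notin> p \<eta>" using psi_zero_iff[OF ch eU as(1)] by simp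
  \<comment> \<open>One element whose vanishing locus contains both the zeros and the poles of
    \<open>k\<close>.\<close>
  define c where "c = a \<otimes>\<^bsub>A\<^esub> s"
  have c: "c \<in> carrier A" "c \<notin> p \<eta>" using as a prime_mult[OF eU as(1,2)] by (auto simp: c_def)
  from AN.finite_minimal_primes[OF A.cring_axioms A.cgenideal_ideal[OF c(1)]]
  obtain F where F: "finite F" "\<forall>q\<in>F. primeideal q A \<and> PIdl\<^bsub>A\<^esub> c \<subseteq> q"
    "\<forall>q. primeideal q A \<and> PIdl\<^bsub>A\<^esub> c \<subseteq> q \<longrightarrow> (\<exists>q'\<in>F. q' \<subseteq> q)"
    by (elim exE conjE) (rule that)
  let ?S = "{Z. prime_divisor \<XX> Z \<and> Z \<inter> U \<noteq> {} \<and> ord_along \<XX> Z k \<noteq> 0}"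
  have gU: "gen Z \<in> U" if "Z \<in> ?S" for Z using that gen_in_open[OF _ U] by blast
  have "p (gen Z) \<in> F" if Z: "Z \<in> ?S" for Z
  proof -
    have pd: "prime_divisor \<XX> Z" and o: "ord_along \<XX> Z k \<noteq> 0" using Z by auto
    let ?z = "gen Z"
    note zU = gU[OF Z]
    have gx: "generalizes \<eta> ?z" using eta_generalizes U_top[OF ch] zU by blast
    interpret dvr_valuation "stalk \<XX> ?z" KK "cospecialize \<XX> \<eta>" by (rule dvr[OF pd])
    have "a \<in> p ?z \<or> s \<in> p ?z"
    proof (rule ccontr)
      assume n: "\<not> ?thesis"
      then have u: "\<psi> ?z a \<in> Units (stk ?z)" "\<psi> ?z s \<in> Units (stk ?z)" using psi_Units[OF zU] as by auto
      have "k \<otimes>\<^bsub>KK\<^esub> cospecialize \<XX> \<eta> (\<psi> ?z s) = cospecialize \<XX> \<eta> (\<psi> ?z a)"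
        using as cospecialize_psi[OF zU eU gx] by simp
      then have "ordv k = 0" by (rule ordv_zero[OF k(1) u])
      then show False using o ord_along_eq[OF pd] by simp
    qed
    then have "c \<in> p ?z" unfolding c_def
      using ideal.I_r_closed[OF primeideal.axioms(1)[OF p_prime[OF zU]], of a s]
        ideal.I_l_closed[OF primeideal.axioms(1)[OF p_prime[OF zU]], of s a] as by blast
    then have "PIdl\<^bsub>A\<^esub> c \<subseteq> p ?z" using A.cgenideal_minimal[OF primeideal.axioms(1)[OF p_prime[OF zU]]] by blast
    \<comment> \<open>The point of \<open>q\<close> generalizes \<open>gen Z\<close>, so it is
      \<open>gen Z\<close> or \<open>\<eta>\<close>; the latter is excluded because \<open>c\<close>
      lies in \<open>q\<close> but not in \<open>p \<eta>\<close>.\<close>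
    then obtain q where q: "q \<in> F" "q \<subseteq> p ?z" using F(3) p_prime[OF zU] by blast
    obtain y where y: "y \<in> U" "p y = q" using p_surj[of q] F(2) q(1) by blast
    have "generalizes y ?z" using generalizes_iff[OF zU y(1)] y(2) q(2) by simp
    then have "y = ?z \<or> y = \<eta>" by (rule generalization_of_gen[OF pd])
    moreover have "c \<in> p y" using F(2) q(1) A.cgenideal_self[OF c(1)] y(2) by blast
    ultimately have "y = ?z" using c(2) by blast
    then show ?thesis using y q by simp
  qed
  then have "(\<lambda>Z. p (gen Z)) ` ?S \<subseteq> F" by blast
  moreover have "inj_on (\<lambda>Z. p (gen Z)) ?S"
  proof (rule inj_onI)
    fix Z Z' assume ZZ: "Z \<in> ?S" "Z' \<in> ?S" "p (gen Z) = p (gen Z')"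
    then have "gen Z = gen Z'" using p_inj gU by blast
    then show "Z = Z'" using gen(2) ZZ by (metis (no_types, lifting) mem_Collect_eq)
  qed
  ultimately show ?thesis using F(1) inj_on_finite by blast
qed

text \<open>Quasi-compactness reduces to finitely many charts; every prime divisor meets the one
  containing its generic point.\<close>

lemma ord_finite:
  assumes k: "k \<in> carrier KK" "k \<noteq> \<zero>\<^bsub>KK\<^esub>"
  shows "finite {Z. prime_divisor \<XX> Z \<and> ord_along \<XX> Z k \<noteq> 0}"
proof -
  define \<U> where "\<U> = {U. \<exists>A p \<psi>. normal_chart \<XX> U A p \<psi>}"
  have op: "openin T U" if "U \<in> \<U>" for U using that normal_chart.U by (auto simp: \<U>_def)
  have "topspace T \<subseteq> \<Union>\<U>"
  proof
    fix x assume x: "x \<in> topspace T"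
    obtain U A p \<psi> where "x \<in> U" "normal_chart \<XX> U A p \<psi>" by (rule normal_chart_at[OF x])
    then show "x \<in> \<Union>\<U>" by (auto simp: \<U>_def)
  qed
  then obtain \<F> where \<F>: "finite \<F>" "\<F> \<subseteq> \<U>" "topspace T \<subseteq> \<Union>\<F>"
    using quasi_compact op unfolding compact_space_def compactin_def by meson
  let ?S = "\<lambda>U. {Z. prime_divisor \<XX> Z \<and> Z \<inter> U \<noteq> {} \<and> ord_along \<XX> Z k \<noteq> 0}"
  have "finite (?S U)" if UF: "U \<in> \<F>" for U
  proof -
    obtain A p \<psi> where "normal_chart \<XX> U A p \<psi>" using UF \<F>(2) unfolding \<U>_def by blast
    then show ?thesis by (rule ord_finite_chart[OF _ k])
  qed
  then have fin: "finite (\<Union>(?S ` \<F>))" using \<F>(1) by blast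
  have "{Z. prime_divisor \<XX> Z \<and> ord_along \<XX> Z k \<noteq> 0} \<subseteq> \<Union>(?S ` \<F>)"
  proof
    fix Z assume Z: "Z \<in> {Z. prime_divisor \<XX> Z \<and> ord_along \<XX> Z k \<noteq> 0}"
    then have "gen Z \<in> topspace T" "gen Z \<in> Z"
      using gen[of Z] in_closure_iff[of "gen Z" "gen Z"] by (auto simp: generalizes_def)
    then obtain U where "U \<in> \<F>" "gen Z \<in> U" using \<F>(3) by blast
    then show "Z \<in> \<Union>(?S ` \<F>)" using Z \<open>gen Z \<in> Z\<close> by blast
  qed
  then show ?thesis using fin finite_subset by blast
qed

end

section \<open>The class group\<close>

lemma generate_free_Abelian_group:
  "generate (free_Abelian_group S) (frag_of ` S) = carrier (free_Abelian_group S)"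
proof
  interpret F: group "free_Abelian_group S" by simp
  have sub: "frag_of ` S \<subseteq> carrier (free_Abelian_group S)" by auto
  show "generate (free_Abelian_group S) (frag_of ` S) \<subseteq> carrier (free_Abelian_group S)"
    using F.generate_incl[OF sub] .
  interpret H: subgroup "generate (free_Abelian_group S) (frag_of ` S)" "free_Abelian_group S"
    by (rule F.generate_is_subgroup[OF sub])
  show "carrier (free_Abelian_group S) \<subseteq> generate (free_Abelian_group S) (frag_of ` S)"
  proof
    fix x assume "x \<in> carrier (free_Abelian_group S)"
    then have "Poly_Mapping.keys x \<subseteq> S" by simp
    then show "x \<in> generate (free_Abelian_group S) (frag_of ` S)"
    proof (rule free_Abelian_group_induct)
      show "0 \<in> generate (free_Abelian_group S) (frag_of ` S)" using H.one_closed by simp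
      show "x - y \<in> generate (free_Abelian_group S) (frag_of ` S)"
        if "Poly_Mapping.keys y \<subseteq> S" "x \<in> generate (free_Abelian_group S) (frag_of ` S)"
          "y \<in> generate (free_Abelian_group S) (frag_of ` S)" for x y
        using H.m_closed[OF that(2) H.m_inv_closed[OF that(3)]] that(1) by simp
      show "frag_of a \<in> generate (free_Abelian_group S) (frag_of ` S)" if "a \<in> S" for a
        by (rule generate.incl) (use that in blast)
    qed
  qed
qed

context Connected_Normal_Noetherian_Scheme
begin

abbreviation "W \<equiv> Weil_divisors \<XX>"
abbreviation "principals \<equiv> principal_divisors \<XX>"

lemma comm_group_W: "comm_group W"
  unfolding Weil_divisors_def by (rule abelian_free_Abelian_group)

lemma W_simps: "x \<otimes>\<^bsub>W\<^esub> y = x + y" "\<one>\<^bsub>W\<^esub> = 0"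
    "x \<in> carrier W \<longleftrightarrow> Poly_Mapping.keys x \<subseteq> {Z. prime_divisor \<XX> Z}"
  by (simp_all add: Weil_divisors_def)

text \<open>The function inside \<open>div_of\<close> may be read back only when its support is
  finite, which is \<open>ord_finite\<close>.\<close>

lemma lookup_div_of:
  assumes "k \<in> carrier KK" "k \<noteq> \<zero>\<^bsub>KK\<^esub>"
  shows "Poly_Mapping.lookup (div_of \<XX> k) Z = (if prime_divisor \<XX> Z then ord_along \<XX> Z k else 0)"
proof -
  have "{Z. (if prime_divisor \<XX> Z then ord_along \<XX> Z k else 0) \<noteq> 0} = {Z. prime_divisor \<XX> Z \<and> ord_along \<XX> Z k \<noteq> 0}"
    by auto
  then show ?thesis using ord_finite[OF assms] unfolding div_of_def by (simp add: Abs_poly_mapping_inverse)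
qed

lemma div_of_mult:
  assumes "k \<in> carrier KK" "k \<noteq> \<zero>\<^bsub>KK\<^esub>" "l \<in> carrier KK" "l \<noteq> \<zero>\<^bsub>KK\<^esub>"
  shows "div_of \<XX> (k \<otimes>\<^bsub>KK\<^esub> l) = div_of \<XX> k + div_of \<XX> l"
proof (rule poly_mapping_eqI)
  interpret K: field KK by (rule field_KK)
  fix Z
  have kl: "k \<otimes>\<^bsub>KK\<^esub> l \<in> carrier KK" "k \<otimes>\<^bsub>KK\<^esub> l \<noteq> \<zero>\<^bsub>KK\<^esub>" using assms by (auto simp: K.integral_iff)
  show "Poly_Mapping.lookup (div_of \<XX> (k \<otimes>\<^bsub>KK\<^esub> l)) Z = Poly_Mapping.lookup (div_of \<XX> k + div_of \<XX> l) Z"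
    using ord_valuation[of Z] assms
    by (simp add: lookup_add lookup_div_of[OF kl] lookup_div_of[OF assms(1,2)] lookup_div_of[OF assms(3,4)] valuation_def)
qed

lemma principal_iff: "D \<in> principals \<longleftrightarrow> (\<exists>k. k \<in> carrier KK \<and> k \<noteq> \<zero>\<^bsub>KK\<^esub> \<and> D = div_of \<XX> k)"
  by (auto simp: principal_divisors_def function_field_eq)

lemma principal_subgroup: "subgroup principals W"
proof -
  interpret W: comm_group W by (rule comm_group_W)
  interpret K: field KK by (rule field_KK)
  have one: "div_of \<XX> \<one>\<^bsub>KK\<^esub> = 0" using div_of_mult[of "\<one>\<^bsub>KK\<^esub>" "\<one>\<^bsub>KK\<^esub>"] by simp
  have sub: "principals \<subseteq> carrier W"
  proof
    fix D assume "D \<in> principals"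
    then obtain k where k: "k \<in> carrier KK" "k \<noteq> \<zero>\<^bsub>KK\<^esub>" "D = div_of \<XX> k" by (auto simp: principal_iff)
    then show "D \<in> carrier W"
      unfolding W_simps by (auto simp: in_keys_iff lookup_div_of[OF k(1,2)] split: if_splits)
  qed
  show ?thesis
  proof (rule W.subgroupI[OF sub])
    show "principals \<noteq> {}" using principal_iff K.one_closed K.one_not_zero by blast
    fix D assume D: "D \<in> principals"
    then obtain k where k: "k \<in> carrier KK" "k \<noteq> \<zero>\<^bsub>KK\<^esub>" "D = div_of \<XX> k" by (auto simp: principal_iff)
    then have u: "k \<in> Units KK" using K.field_Units by blast
    have i: "inv\<^bsub>KK\<^esub> k \<in> carrier KK" "inv\<^bsub>KK\<^esub> k \<noteq> \<zero>\<^bsub>KK\<^esub>" "k \<otimes>\<^bsub>KK\<^esub> inv\<^bsub>KK\<^esub> k = \<one>\<^bsub>KK\<^esub>"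
      using K.Units_inv_Units[OF u] K.field_Units u by auto
    have "D + div_of \<XX> (inv\<^bsub>KK\<^esub> k) = 0" using div_of_mult[OF k(1,2) i(1,2)] i(3) one k(3) by simp
    then have "- D = div_of \<XX> (inv\<^bsub>KK\<^esub> k)" by (simp add: minus_unique)
    moreover have "inv\<^bsub>W\<^esub> D = - D" using sub D unfolding Weil_divisors_def by auto
    ultimately show "inv\<^bsub>W\<^esub> D \<in> principals" using principal_iff i by auto
    fix E assume "E \<in> principals"
    then obtain l where l: "l \<in> carrier KK" "l \<noteq> \<zero>\<^bsub>KK\<^esub>" "E = div_of \<XX> l" by (auto simp: principal_iff)
    have "k \<otimes>\<^bsub>KK\<^esub> l \<in> carrier KK" "k \<otimes>\<^bsub>KK\<^esub> l \<noteq> \<zero>\<^bsub>KK\<^esub>" using k l by (auto simp: K.integral_iff)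
    then show "D \<otimes>\<^bsub>W\<^esub> E \<in> principals"
      unfolding W_simps k(3) l(3) div_of_mult[OF k(1,2) l(1,2), symmetric] principal_iff by blast
  qed
qed

lemma principal_normal: "normal principals W"
  using comm_group.normal_iff_subgroup[OF comm_group_W] principal_subgroup by blast

lemma group_class_group: "group (class_group \<XX>)"
  unfolding class_group_def by (rule normal.factorgroup_is_group[OF principal_normal])

definition comb :: "nat \<Rightarrow> (nat \<Rightarrow> ('a set \<Rightarrow>\<^sub>0 int)) \<Rightarrow> (nat \<Rightarrow>\<^sub>0 int) \<Rightarrow> ('a set \<Rightarrow>\<^sub>0 int)" where
  "comb r D n = (\<Sum>i=1..r. frag_cmul (Poly_Mapping.lookup n i) (D i))"

lemma comb_add: "comb r D (m + n) = comb r D m + comb r D n"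
  by (simp add: comb_def lookup_add frag_cmul_distrib sum.distrib)

lemma comb_minus: "comb r D (- n) = - comb r D n"
proof -
  have "comb r D (- n) + comb r D n = 0" unfolding comb_add[symmetric] by (simp add: comb_def)
  then show ?thesis by (simp add: eq_neg_iff_add_eq_0)
qed

lemma comb_single:
  assumes "i \<in> {1..r}" shows "comb r D (Poly_Mapping.single i 1) = D i"
proof -
  have "comb r D (Poly_Mapping.single i 1) = (\<Sum>j=1..r. if j = i then D j else 0)"
    unfolding comb_def by (rule sum.cong) (auto simp: lookup_single when_def)
  then show ?thesis using assms by simp
qed

lemma comb_W: assumes "\<forall>i\<in>{1..r}. D i \<in> carrier W" shows "comb r D n \<in> carrier W"
  unfolding comb_def Weil_divisors_def
proof (rule sum_closed_free_Abelian_group)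
  fix i assume "i \<in> {1..r}"
  then have "Poly_Mapping.keys (D i) \<subseteq> {Z. prime_divisor \<XX> Z}" using assms by (simp add: W_simps)
  then show "frag_cmul (Poly_Mapping.lookup n i) (D i) \<in> carrier (free_Abelian_group {Z. prime_divisor \<XX> Z})"
    using keys_cmul[of "Poly_Mapping.lookup n i" "D i"] by simp
qed

text \<open>Turns membership in a generated subgroup into an exponent vector; inverses of generators
  become negative exponents.\<close>

lemma class_combination:
  assumes D: "\<forall>i\<in>{1..r}. D i \<in> carrier W"
    and c: "c \<in> generate (class_group \<XX>) ((\<lambda>i. divisor_class \<XX> (D i)) ` {1..r})"
  shows "\<exists>n. Poly_Mapping.keys n \<subseteq> {1..r} \<and> c = divisor_class \<XX> (comb r D n)"
proof -
  interpret W: comm_group W by (rule comm_group_W)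
  interpret N: normal principals W by (rule principal_normal)
  have keys1: "Poly_Mapping.keys (Poly_Mapping.single i (1::int)) \<subseteq> {1..r}" if "i \<in> {1..r}" for i
    using that by simp
  note dc = divisor_class_def
  show ?thesis using c
  proof (induction rule: generate.induct)
    case one
    have "comb r D 0 = 0" by (simp add: comb_def)
    then have "\<one>\<^bsub>class_group \<XX>\<^esub> = divisor_class \<XX> (comb r D 0)"
      using W.coset_mult_one[OF N.subset] by (simp add: class_group_def FactGroup_def dc W_simps)
    then show ?case by (intro exI[of _ 0]) auto
  next
    case (incl h)
    then obtain i where i: "i \<in> {1..r}" "h = divisor_class \<XX> (D i)" by blast
    then show ?case using keys1[OF i(1)] comb_single[OF i(1)] by metis
  next
    case (inv h)
    then obtain i where i: "i \<in> {1..r}" "h = divisor_class \<XX> (D i)" by blast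
    have DW: "D i \<in> carrier W" using D i by blast
    then have "h \<in> carrier (W Mod principals)" using i(2) by (auto simp: dc carrier_FactGroup)
    then have "inv\<^bsub>class_group \<XX>\<^esub> h = set_inv\<^bsub>W\<^esub> h"
      unfolding class_group_def by (rule N.inv_FactGroup)
    also have "\<dots> = principals #>\<^bsub>W\<^esub> (inv\<^bsub>W\<^esub> D i)" unfolding i(2) dc by (rule N.rcos_inv[OF DW])
    also have "inv\<^bsub>W\<^esub> D i = - D i" using DW unfolding Weil_divisors_def by simp
    also have "\<dots> = comb r D (- Poly_Mapping.single i 1)" using comb_single[OF i(1), of D] by (simp add: comb_minus)
    finally show ?case using keys1[OF i(1)] by (intro exI[of _ "- Poly_Mapping.single i 1"]) (auto simp: dc)
  next
    case (eng h1 h2)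
    then obtain m n where mn: "Poly_Mapping.keys m \<subseteq> {1..r}" "h1 = divisor_class \<XX> (comb r D m)"
      "Poly_Mapping.keys n \<subseteq> {1..r}" "h2 = divisor_class \<XX> (comb r D n)" by blast
    have "h1 \<otimes>\<^bsub>class_group \<XX>\<^esub> h2 = h1 <#>\<^bsub>W\<^esub> h2" by (simp add: class_group_def FactGroup_def)
    also have "\<dots> = divisor_class \<XX> (comb r D (m + n))"
      unfolding mn dc comb_add using N.rcos_sum[OF comb_W[OF D] comb_W[OF D]] by (simp add: W_simps)
    finally show ?case using mn keys_add[of m n] by (intro exI[of _ "m + n"]) auto
  qed
qed

text \<open>All hypotheses of \<open>multisection_factorial\<close> are now available; what remains
  is to derive \<open>real\<close> from generation of the class group and to match the valuation
  conditions with membership in \<open>H0\<close>.\<close>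

theorem multisection_ring_factorial:
  assumes D: "\<forall>i\<in>{1..r}. D i \<in> carrier W" and gen: "classes_generate \<XX> r D"
  shows "factorial_domain (multisection_ring \<XX> r D)"
proof -
  interpret K: field KK by (rule field_KK)
  interpret W: comm_group W by (rule comm_group_W)
  interpret N: normal principals W by (rule principal_normal)
  let ?P = "{Z. prime_divisor \<XX> Z}"
  let ?L = "laurent_ring KK r"
  define d where "d Z n = Poly_Mapping.lookup (comb r D n) Z" for Z n
  have "factorial_domain (?L\<lparr>carrier := {f \<in> carrier ?L.
           \<forall>n. f n \<noteq> \<zero>\<^bsub>KK\<^esub> \<longrightarrow> (\<forall>Z\<in>?P. 0 \<le> ord_along \<XX> Z (f n) + d Z n)}\<rparr>)"
  proof (rule K.multisection_factorial)
    show "valuation KK (ord_along \<XX> Z)" if "Z \<in> ?P" for Z using ord_valuation that by simp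
    show "finite {Z \<in> ?P. ord_along \<XX> Z a \<noteq> 0}" if "a \<in> carrier KK" "a \<noteq> \<zero>\<^bsub>KK\<^esub>" for a
      using ord_finite[OF that] by simp
    show "d Z (m + n) = d Z m + d Z n" for Z m n by (simp add: d_def comb_add lookup_add)
    show "finite {Z \<in> ?P. d Z n \<noteq> 0}" for n
      by (rule finite_subset[of _ "Poly_Mapping.keys (comb r D n)"]) (auto simp: d_def in_keys_iff)
    fix m :: "'a set \<Rightarrow> int" assume m: "finite {Z \<in> ?P. m Z \<noteq> 0}"
    \<comment> \<open>The values \<open>m\<close> are prescribed only on prime divisors; extended by
      zero they form a Weil divisor.\<close>
    define E where "E = Abs_poly_mapping (\<lambda>Z. if Z \<in> ?P then m Z else 0)"
    have "{Z. (if Z \<in> ?P then m Z else 0) \<noteq> 0} = {Z \<in> ?P. m Z \<noteq> 0}" by auto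
    then have E: "Poly_Mapping.lookup E Z = (if Z \<in> ?P then m Z else 0)" for Z
      using m unfolding E_def by (simp add: Abs_poly_mapping_inverse)
    have EW: "E \<in> carrier W" unfolding W_simps by (auto simp: in_keys_iff E split: if_splits)
    then have "divisor_class \<XX> E \<in> carrier (class_group \<XX>)"
      by (auto simp: class_group_def divisor_class_def carrier_FactGroup)
    then obtain n where n: "Poly_Mapping.keys n \<subseteq> {1..r}" "divisor_class \<XX> E = divisor_class \<XX> (comb r D n)"
      using class_combination[OF D] gen unfolding classes_generate_def by blast
    \<comment> \<open>Equal classes mean that \<open>E\<close> is the divisor of some
      \<open>a\<close> plus the combination with exponents \<open>n\<close>; the pair
      \<open>a\<close>, \<open>n\<close> is the required monomial.\<close>
    have "E \<in> principals #>\<^bsub>W\<^esub> comb r D n"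
      using W.rcos_self[OF EW principal_subgroup] n(2) by (simp add: divisor_class_def)
    then obtain q where q: "q \<in> principals" "E = q + comb r D n" by (auto simp: r_coset_def W_simps)
    obtain a where a: "a \<in> carrier KK" "a \<noteq> \<zero>\<^bsub>KK\<^esub>" "q = div_of \<XX> a" using q(1) principal_iff by blast
    have "m Z = ord_along \<XX> Z a + d Z n" if "Z \<in> ?P" for Z
      using E[of Z] that q(2) by (simp add: a(3) lookup_add lookup_div_of[OF a(1,2)] d_def)
    then show "\<exists>a n. a \<in> carrier KK \<and> a \<noteq> \<zero>\<^bsub>KK\<^esub> \<and> Poly_Mapping.keys n \<subseteq> {1..r} \<and>
        (\<forall>Z\<in>?P. m Z = ord_along \<XX> Z a + d Z n)" using a n by blast
  qed
  \<comment> \<open>\<open>H0\<close> tests every set \<open>Z\<close>, but off the prime divisors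
    both summands are zero. It contains zero, so vanishing coefficients impose nothing, and
    nonvanishing ones have exponents supported in \<open>{1..r}\<close>.\<close>
  moreover have "{f \<in> carrier ?L. \<forall>n. f n \<noteq> \<zero>\<^bsub>KK\<^esub> \<longrightarrow> (\<forall>Z\<in>?P. 0 \<le> ord_along \<XX> Z (f n) + d Z n)}
      = {f \<in> carrier ?L. \<forall>n. Poly_Mapping.keys n \<subseteq> {1..r} \<longrightarrow> f n \<in> H0 \<XX> (comb r D n)}"
  proof (rule Collect_cong, rule conj_cong[OF refl], rule all_cong1)
    fix f n assume f: "f \<in> carrier ?L"
    have fK: "f n \<in> carrier KK" and fn: "f n \<noteq> \<zero>\<^bsub>KK\<^esub> \<Longrightarrow> Poly_Mapping.keys n \<subseteq> {1..r}"
      using f K.FS_closed unfolding laurent_ring_carrier by blast+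
    have d0: "d Z n = 0" if "Z \<notin> ?P" for Z
      using comb_W[OF D, of n] that unfolding W_simps d_def by (metis in_keys_iff subsetD)
    show "(f n \<noteq> \<zero>\<^bsub>KK\<^esub> \<longrightarrow> (\<forall>Z\<in>?P. 0 \<le> ord_along \<XX> Z (f n) + d Z n)) =
        (Poly_Mapping.keys n \<subseteq> {1..r} \<longrightarrow> f n \<in> H0 \<XX> (comb r D n))"
    proof (cases "f n = \<zero>\<^bsub>KK\<^esub>")
      case True
      then show ?thesis by (simp add: H0_def function_field_eq)
    next
      case False
      have "(0 \<le> Poly_Mapping.lookup (div_of \<XX> (f n) + comb r D n) Z) \<longleftrightarrow>
          (Z \<in> ?P \<longrightarrow> 0 \<le> ord_along \<XX> Z (f n) + d Z n)" for Z
        using d0[of Z] by (simp add: lookup_add lookup_div_of[OF fK False] d_def)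
      then have "f n \<in> H0 \<XX> (comb r D n) \<longleftrightarrow> (\<forall>Z\<in>?P. 0 \<le> ord_along \<XX> Z (f n) + d Z n)"
        using fK False by (simp add: H0_def function_field_eq)
      then show ?thesis using False fn by simp
    qed
  qed
  ultimately show ?thesis
    unfolding multisection_ring_def function_field_eq comb_def by simp
qed

text \<open>Ensures that the statement about all total coordinate rings is not vacuous: the
  \<open>D i\<close> are representatives of the classes to which the isomorphism sends the standard
  basis, and these generate.\<close>

lemma total_coordinate_ring_exists:
  assumes "class_group \<XX> \<cong> free_Abelian_group {1..s::nat}"
  shows "\<exists>R. is_total_coordinate_ring \<XX> R"
proof -
  let ?F = "free_Abelian_group {1..s}"
  have "?F \<cong> class_group \<XX>" using group.iso_sym[OF group_class_group assms] .
  then obtain g where g: "g \<in> iso ?F (class_group \<XX>)" by (auto simp: is_iso_def)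
  then have hom: "g \<in> hom ?F (class_group \<XX>)" and surj: "g ` carrier ?F = carrier (class_group \<XX>)"
    by (auto simp: iso_def bij_betw_def)
  interpret h: group_hom ?F "class_group \<XX>" g
    by (rule group_hom.intro[OF group_free_Abelian_group group_class_group group_hom_axioms.intro[OF hom]])
  have "\<exists>E\<in>carrier W. g (frag_of i) = divisor_class \<XX> E" if "i \<in> {1..s}" for i
  proof -
    have "g (frag_of i) \<in> carrier (class_group \<XX>)" using h.hom_closed that by simp
    then show ?thesis by (auto simp: class_group_def carrier_FactGroup divisor_class_def)
  qed
  then obtain D where D: "\<forall>i\<in>{1..s}. D i \<in> carrier W \<and> g (frag_of i) = divisor_class \<XX> (D i)" by metis
  have "(\<lambda>i. divisor_class \<XX> (D i)) ` {1..s} = g ` frag_of ` {1..s}"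
    unfolding image_image by (rule image_cong) (use D in auto)
  moreover have "frag_of ` {1..s} \<subseteq> carrier ?F" by auto
  ultimately have "generate (class_group \<XX>) ((\<lambda>i. divisor_class \<XX> (D i)) ` {1..s}) = carrier (class_group \<XX>)"
    using h.generate_img generate_free_Abelian_group[of "{1..s}"] surj by metis
  then show ?thesis using assms D unfolding is_total_coordinate_ring_def classes_generate_def by blast
qed

end

theorem corollary1p2:
  fixes \<XX> :: "('a, 'b) ringed_space"
  assumes "Connected_Normal_Noetherian_Scheme \<XX>"
  shows "(\<forall>r D. (\<forall>i\<in>{1..r}. D i \<in> carrier (Weil_divisors \<XX>)) \<and> classes_generate \<XX> r D
            \<longrightarrow> factorial_domain (multisection_ring \<XX> r D))
       \<and> ((\<exists>s::nat. class_group \<XX> \<cong> free_Abelian_group {1..s})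
            \<longrightarrow> (\<exists>T. is_total_coordinate_ring \<XX> T) \<and>
                (\<forall>T. is_total_coordinate_ring \<XX> T \<longrightarrow> factorial_domain T))"
proof -
  interpret Connected_Normal_Noetherian_Scheme \<XX> by (rule assms)
  show ?thesis
  proof (intro conjI allI impI)
    show "factorial_domain (multisection_ring \<XX> r D)"
      if "(\<forall>i\<in>{1..r}. D i \<in> carrier W) \<and> classes_generate \<XX> r D" for r D
      using that by (intro multisection_ring_factorial) auto
    show "\<exists>R. is_total_coordinate_ring \<XX> R" if "\<exists>s::nat. class_group \<XX> \<cong> free_Abelian_group {1..s}"
      using that total_coordinate_ring_exists by blast
    show "factorial_domain R" if "is_total_coordinate_ring \<XX> R" for R
      using that multisection_ring_factorial unfolding is_total_coordinate_ring_def by (elim exE conjE) simp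
  qed
qed

end
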